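(* Assume (A). A c\`adl\`ag adapted process $Y\equiv(y^n)$ solves the BSDE $$Y_t+\int_{(t,T]}\int_E Z(s,x)\,\mu(ds,dx)=\xi+\int_{(t,T]}\int_E f\bigl(\cdot,s,x,Y_{s-},Z_s(\cdot)\bigr)\,\nu(ds,dx),\qquad t\in[0,T],$$ if and only if for $\mathbb{P}$-almost all $\omega$ and all $n\ge0$ we have $$y^n_{D_n(\omega)}(t)=u^n_{D_n(\omega)}+\int_t^T\!\int_E f\{\widehat{y}^{\,n+1}\}^n_{D_n(\omega)}\bigl(s,x,y^n_{D_n(\omega)}(s),-y^n_{D_n(\omega)}(s)\bigr)\,\nu^n_{D_n(\omega)}(ds,dx),\qquad t\in[0,T].\quad(\ast)$$ If further $\mathbb{P}(S_{M+1}=\infty)=1$ for some nonrandom integer $M$, then $Y\equiv(y^n)$ is a solution if and only if for $\mathbb{P}$-almost all $\omega$ we have $(\ast)$ for all $n=0,\dots,M-1$, and $y^M_{D_M(\omega)}(t)=u^M_{D_M(\omega)}$ for all $t\in[0,T]$ (this common value being $\xi(\omega)$ when $S_M(\omega)\le T$).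
   Context: Point process. $(\Omega,\mathcal{F},\mathbb{P})$ is a probability space, $T\in(0,\infty)$ is fixed, $(E,\mathcal{E})$ is a Lusin space with its Borel $\sigma$-field, $\Delta\in E$ a distinguished point. $(S_n,X_n)_{n\ge1}$ is a nonexplosive multivariate point process: $S_n$ takes values in $(0,T]\cup\{\infty\}$, $X_n$ in $E$, $S_n\le S_{n+1}$ everywhere, $S_n<S_{n+1}$ if $S_n\le T$, $X_n=\Delta$ if $S_n=\infty$, and $\Omega=\bigcup_n\{S_n>T\}$; put $S_0=0$, $X_0=\Delta$. The associated random measure is $\mu(dt,dx)=\sum_{n\ge1:\,S_n\le T}\varepsilon_{(S_n,X_n)}(dt,dx)$ ($\varepsilon$ = Dirac measure). $(\mathcal{F}_t)_{t\ge0}$ is the filtration generated by the point process (the smallest one for which each $S_n$ is a stopping time and $X_n$ is $\mathcal{F}_{S_n}$-measurable). A function on $\Omega\times[0,T]\times G$, with $(G,\mathcal{G})$ measurable, is called predictable if it is measurable with respect to $\mathcal{P}\otimes\mathcal{G}$, $\mathcal{P}$ being the predictable $\sigma$-field on $\Omega\times[0,T]$. $\nu$ is the predictable compensator of $\mu$, disintegrated as $\nu(\omega,dt,dx)=dA_t(\omega)\,\phi_{\omega,t}(dx)$, $\phi$ a transition probability from $(\Omega\times[0,T],\mathcal{P})$ into $(E,\mathcal{E})$, $A$ increasing, c\`adl\`ag, predictable, $A_0=0$. Assumption (A): (A$_1$) $A$ is continuous; (A$_2$) $\mathbb{P}(S_{n+1}>T\mid\mathcal{F}_{S_n})>0$ for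 all $n\ge0$. BSDE. $\xi$ is an $\mathcal{F}_T$-measurable real random variable. $\mathcal{B}(E)$ is the set of Borel real functions on $E$; $Z_{\omega,t}(x)=Z(\omega,t,x)$, $Z_t(\cdot)=Z_{\omega,t}$. The generator $f$ is a real function on $\Omega\times[0,T]\times E\times\mathbb{R}\times\mathcal{B}(E)$ such that $f(\omega,t,x,y,Z_{\omega,t}(\cdot))$ is predictable for every predictable $Z$ on $\Omega\times[0,T]\times E$, and for some $L,L'\ge0$: $|f(\omega,t,x,y',\zeta)-f(\omega,t,x,y,\zeta)|\le L'|y'-y|$; $\int_E|f(\omega,t,x,y,\zeta)-f(\omega,t,x,y,\zeta')|\,\phi_{\omega,t}(dx)\le L\int_E|\zeta'(x)-\zeta(x)|\,\phi_{\omega,t}(dx)$; $\int_0^T\int_E|f(t,x,0,0)|\,\nu(dt,dx)<\infty$ a.s. (the last $0$ being the zero function). A solution is an adapted c\`adl\`ag process $Y$ for which there exists a predictable function $Z$ with $\int_0^T\int_E|Z(s,x)|\,\nu(ds,dx)<\infty$ a.s. such that the BSDE holds for all $t\in[0,T]$, outside a $\mathbb{P}$-null set. Any solution $Y$ is a.s. continuous outside the times $S_n$, with $\Delta Y_{S_n}=Z(S_n,X_n)$ if $S_n\le T$. Pathwise representation. Let $\mathcal{S}=([0,T]\times E)\cup\{(\infty,\Delta)\}$ and let $H_n\subset\mathcal{S}^{n+1}$ be the set of $D=((t_0,x_0),\dots,(t_n,x_n))$ with $(t_0,x_0)=(0,\Delta)$, $t_{j+1}\ge t_j$, $t_{j+1}>t_j$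 if $t_j\le T$, and $(t_j,x_j)=(\infty,\Delta)$ if $t_j>T$; $D^{\max}=t_n$; $H_n$ carries its Borel $\sigma$-field. $D\cup\{(t,x)\}\in H_{n+1}$ denotes $D$ with $(t,x)$ appended ($t>D^{\max}$). $D_n=((S_0,X_0),\dots,(S_n,X_n))$ is a random element of $H_n$. - $\xi$: Borel functions $D\mapsto u^n_D$ on $H_n$ with $u^n_D=0$ if $D^{\max}=\infty$, and $\xi(\omega)=u^n_{D_n(\omega)}$ if $S_n(\omega)\le T<S_{n+1}(\omega)$. - $Y\equiv(y^n)$ (for $Y$ c\`adl\`ag adapted, continuous outside the $S_n$'s) means: $y^n_D(t)$ is Borel on $H_n\times[0,T]$, $y^n_D=0$ if $D^{\max}=\infty$, $t\mapsto y^n_D(t)$ is continuous on $[0,T]$ and constant on $[0,T\wedge D^{\max}]$, and $Y_t(\omega)=y^n_{D_n(\omega)}(t)$ if $S_n(\omega)\le t<S_{n+1}(\omega)$, $t\le T$. - $Z\equiv(z^n)$ (for $Z$ predictable) means: $z^n_D(t,x)$ is Borel on $H_n\times[0,T]\times E$, is $0$ if $D^{\max}=\infty$, and $Z(\omega,t,x)=z^n_{D_n(\omega)}(t,x)$ if $S_n(\omega)<t\le S_{n+1}(\omega)\wedge T$. - $\widehat{y}^{\,n+1}_D(t,x)=y^{n+1}_{D\cup\{(t,x)\}}(t)\,1_{\{t>D^{\max}\}}$ for $(D,t,x)\in H_n\times[0,T]\times E$. If $Y\equiv(y^n)$ is a solution, the associated $Z$ is always taken to be $Z\equiv(z^n)$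 with $z^n_D(t,x)=\widehat{y}^{\,n+1}_D(t,x)-y^n_D(t)$. - The $\mathcal{F}_{S_n}$-conditional law of $(S_{n+1},X_{n+1})$ is $G^n_{D_n}$, with $G^n_D(dt,dx)=G'^n_D(dt)\,\phi^n_{D,t}(dx)$ a transition probability from $H_n$ to $[0,\infty]\times E$, $G'^n_D((T,\infty))=0$, and $g^n_D(t):=G'^n_D((t,\infty])$ chosen (thanks to (A)) continuous in $t$ with $g^n_D(T)>0$, and $g^n_D(D^{\max})=1$ if $D^{\max}<\infty$. Put $\nu^n_D(dt,dx)=\frac{1}{g^n_D(t)}G^n_D(dt,dx)$ on $[0,T]\times E$. Then $\nu(\omega;dt,dx)=\sum_{n\ge0}\nu^n_{D_n(\omega)}(dt,dx)\,1_{\{S_n<t\le S_{n+1}\wedge T\}}$. - Generator: for each real-valued Borel function $z^n=z^n_D(t,x)$ on $H_n\times[0,T]\times E$ with $z^n_D(t,x)=0$ if $D^{\max}=\infty$, $f\{z^n\}^n=f\{z^n\}^n_D(t,x,y,w)$ is a Borel function on $H_n\times[0,T]\times E\times\mathbb{R}\times\mathbb{R}$, vanishing if $D^{\max}=\infty$, with $f(\omega,t,x,y,\zeta)=f\{z^n\}^n_{D_n(\omega)}(t,x,y,w)$ whenever $S_n(\omega)<t\le S_{n+1}(\omega)$, $t\le T$, and $\zeta(\cdot)=w+z^n_{D_n(\omega)}(t,\cdot)$.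
   Formalization: "Solution" requires Z to be ν-integrable, which (∗) does not imply (e.g. Cauchy marks, f=0); the proved equivalences add a.s. ν-integrability of the associated Z beside (∗), or drop integrability of Z from the notion of solving the BSDE, in both parts. *)

theory Defs
  imports "HOL-Probability.Probability"
begin

text \<open>A Lusin space is a Hausdorff space that is the image of a Polish space under a continuous
  bijection. Transporting the Polish topology along the bijection, this is the existence of a finer
  Polish topology on the same points.\<close>

definition lusin_space :: "'a topology \<Rightarrow> bool" where
  "lusin_space X \<longleftrightarrow> Hausdorff_space X \<and>
     (\<exists>Y. topspace Y = topspace X \<and> (\<forall>U. openin X U \<longrightarrow> openin Y U) \<and>
          completely_metrizable_space Y \<and> second_countable Y)"

text \<open>The time axis \<open>[0,\<infinity>]\<close> is the type \<^typ>\<open>ennreal\<close>; \<open>T\<close> is a point of it with \<open>0 < T < \<infinity>\<close>.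
  Filtrations are thus also indexed by \<open>\<infinity>\<close>; for the smallest filtration carrying a point process
  this only adds the \<open>\<sigma>\<close>-field generated by all the others.\<close>

definition carries_mpp ::
  "'w set \<Rightarrow> (nat \<Rightarrow> 'w \<Rightarrow> ennreal) \<Rightarrow> (nat \<Rightarrow> 'w \<Rightarrow> 'e::topological_space) \<Rightarrow> (ennreal \<Rightarrow> 'w measure) \<Rightarrow> bool"
where
  "carries_mpp \<Omega> S X F \<longleftrightarrow> filtration \<Omega> F \<and>
     (\<forall>n. stopping_time F (S n)) \<and>
     (\<forall>n. X n \<in> filtration.pre_sigma \<Omega> F (S n) \<rightarrow>\<^sub>M borel)"

definition generated_filtration ::
  "'w set \<Rightarrow> (nat \<Rightarrow> 'w \<Rightarrow> ennreal) \<Rightarrow> (nat \<Rightarrow> 'w \<Rightarrow> 'e::topological_space) \<Rightarrow> (ennreal \<Rightarrow> 'w measure) \<Rightarrow> bool"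
where
  "generated_filtration \<Omega> S X F \<longleftrightarrow> carries_mpp \<Omega> S X F \<and>
     (\<forall>F'. carries_mpp \<Omega> S X F' \<longrightarrow> (\<forall>t. sets (F t) \<subseteq> sets (F' t)))"

definition predictable_sigma :: "'w set \<Rightarrow> ennreal \<Rightarrow> (ennreal \<Rightarrow> 'w measure) \<Rightarrow> ('w \<times> ennreal) measure" where
  "predictable_sigma \<Omega> T F = sigma (\<Omega> \<times> {0..T})
     ({B \<times> {0} | B. B \<in> sets (F 0)} \<union> {B \<times> {s<..t} | B s t. s \<le> t \<and> t \<le> T \<and> B \<in> sets (F s)})"

definition predictable_fun ::
  "'w set \<Rightarrow> ennreal \<Rightarrow> (ennreal \<Rightarrow> 'w measure) \<Rightarrow> ('w \<Rightarrow> ennreal \<Rightarrow> 'e::topological_space \<Rightarrow> 'b::topological_space) \<Rightarrow> bool"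
where
  "predictable_fun \<Omega> T F Z \<longleftrightarrow>
     (\<lambda>((\<omega>, t), x). Z \<omega> t x) \<in> borel_measurable (predictable_sigma \<Omega> T F \<Otimes>\<^sub>M borel)"

definition cadlag :: "ennreal \<Rightarrow> (ennreal \<Rightarrow> real) \<Rightarrow> bool" where
  "cadlag T h \<longleftrightarrow> (\<forall>t\<in>{0..<T}. (h \<longlongrightarrow> h t) (at_right t)) \<and> (\<forall>t\<in>{0<..T}. \<exists>l. (h \<longlongrightarrow> l) (at_left t))"

definition adapted_cadlag ::
  "'w set \<Rightarrow> ennreal \<Rightarrow> (ennreal \<Rightarrow> 'w measure) \<Rightarrow> (ennreal \<Rightarrow> 'w \<Rightarrow> real) \<Rightarrow> bool" where
  "adapted_cadlag \<Omega> T F Y \<longleftrightarrow>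
     (\<forall>t\<in>{0..T}. Y t \<in> borel_measurable (F t)) \<and> (\<forall>\<omega>\<in>\<Omega>. cadlag T (\<lambda>t. Y t \<omega>))"

text \<open>The sum of the Dirac measures at the points \<open>(S n \<omega>, X n \<omega>)\<close> with \<open>n \<ge> 1\<close> and \<open>S n \<omega> \<le> T\<close>.\<close>

definition jump_measure ::
  "ennreal \<Rightarrow> (nat \<Rightarrow> 'w \<Rightarrow> ennreal) \<Rightarrow> (nat \<Rightarrow> 'w \<Rightarrow> 'e::topological_space) \<Rightarrow> 'w \<Rightarrow> (ennreal \<times> 'e) measure"
where
  "jump_measure T S X \<omega> =
     distr (count_space {n. 1 \<le> n \<and> S n \<omega> \<le> T}) (borel \<Otimes>\<^sub>M borel) (\<lambda>n. (S n \<omega>, X n \<omega>))"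

text \<open>The Stieltjes measure \<open>da\<close> of a right-continuous increasing function \<open>a\<close> on \<open>[0,T]\<close> with
  \<open>a 0 = 0\<close>. The function is continued constantly to the left of \<open>0\<close> (as \<^term>\<open>ennreal r = 0\<close> for
  \<open>r \<le> 0\<close>) and to the right of \<open>T\<close>, so that the measure is carried by \<open>(0,T]\<close>.\<close>

definition stieltjes_measure :: "ennreal \<Rightarrow> (ennreal \<Rightarrow> real) \<Rightarrow> ennreal measure" where
  "stieltjes_measure T a = distr (interval_measure (\<lambda>r. a (min (ennreal r) T))) borel ennreal"

text \<open>\<open>\<nu>\<close> is the compensator of \<open>\<mu>\<close>: both integrate nonnegative predictable functions to the same
  expectation. The predictability of \<open>\<nu>\<close> itself is part of the disintegration required below.\<close>

definition same_predictable_expectation ::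
  "'w measure \<Rightarrow> ennreal \<Rightarrow> (ennreal \<Rightarrow> 'w measure) \<Rightarrow>
   ('w \<Rightarrow> (ennreal \<times> 'e::topological_space) measure) \<Rightarrow> ('w \<Rightarrow> (ennreal \<times> 'e) measure) \<Rightarrow> bool"
where
  "same_predictable_expectation M T F \<mu> \<nu> \<longleftrightarrow>
     (\<forall>h :: 'w \<Rightarrow> ennreal \<Rightarrow> 'e \<Rightarrow> ennreal. predictable_fun (space M) T F h \<longrightarrow>
       (\<integral>\<^sup>+\<omega>. (\<integral>\<^sup>+p\<in>{0..T} \<times> UNIV. h \<omega> (fst p) (snd p) \<partial>\<mu> \<omega>) \<partial>M) =
       (\<integral>\<^sup>+\<omega>. (\<integral>\<^sup>+p\<in>{0..T} \<times> UNIV. h \<omega> (fst p) (snd p) \<partial>\<nu> \<omega>) \<partial>M))"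

type_synonym 'e hist = "nat \<Rightarrow> ennreal \<times> 'e"

text \<open>\<open>H\<^sub>n\<close>: a history \<open>D = (D 0, \<dots>, D n)\<close> is an extensional function on \<open>{..n}\<close>, its last time
  \<open>D\<^sup>m\<^sup>a\<^sup>x\<close> is \<open>fst (D n)\<close>, and appending \<open>(t, x)\<close> is \<open>D(Suc n := (t, x))\<close>.
  Over a Lusin mark space the trace of the product \<open>\<sigma>\<close>-field is the Borel \<open>\<sigma>\<close>-field of \<open>H\<^sub>n\<close>.\<close>

definition hist_set :: "ennreal \<Rightarrow> 'e \<Rightarrow> nat \<Rightarrow> 'e hist set" where
  "hist_set T \<Delta> n = {D \<in> {..n} \<rightarrow>\<^sub>E ({0..T} \<times> UNIV \<union> {(\<infinity>, \<Delta>)}).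
     D 0 = (0, \<Delta>) \<and>
     (\<forall>j<n. fst (D j) \<le> fst (D (Suc j)) \<and> (fst (D j) \<le> T \<longrightarrow> fst (D j) < fst (D (Suc j)))) \<and>
     (\<forall>j\<le>n. T < fst (D j) \<longrightarrow> D j = (\<infinity>, \<Delta>))}"

definition hist_space :: "ennreal \<Rightarrow> 'e::topological_space \<Rightarrow> nat \<Rightarrow> 'e hist measure" where
  "hist_space T \<Delta> n = restrict_space (\<Pi>\<^sub>M j\<in>{..n}. borel \<Otimes>\<^sub>M borel) (hist_set T \<Delta> n)"

abbreviation time_space :: "ennreal \<Rightarrow> ennreal measure" where
  "time_space T \<equiv> restrict_space borel {0..T}"

definition history :: "(nat \<Rightarrow> 'w \<Rightarrow> ennreal) \<Rightarrow> (nat \<Rightarrow> 'w \<Rightarrow> 'e) \<Rightarrow> nat \<Rightarrow> 'w \<Rightarrow> 'e hist" where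
  "history S X n \<omega> = (\<lambda>j\<in>{..n}. (S j \<omega>, X j \<omega>))"

text \<open>Borel functions on \<open>H\<^sub>n \<times> [0,T] \<times> E\<close> that vanish when \<open>D\<^sup>m\<^sup>a\<^sup>x = \<infinity>\<close>.\<close>

definition hist_fun ::
  "ennreal \<Rightarrow> 'e::topological_space \<Rightarrow> nat \<Rightarrow> ('e hist \<Rightarrow> ennreal \<Rightarrow> 'e \<Rightarrow> real) \<Rightarrow> bool" where
  "hist_fun T \<Delta> n z \<longleftrightarrow>
     (\<lambda>(D, t, x). z D t x) \<in> borel_measurable (hist_space T \<Delta> n \<Otimes>\<^sub>M time_space T \<Otimes>\<^sub>M borel) \<and>
     (\<forall>D\<in>hist_set T \<Delta> n. fst (D n) = \<infinity> \<longrightarrow> (\<forall>t\<in>{0..T}. \<forall>x. z D t x = 0))"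

definition represents_xi ::
  "'w set \<Rightarrow> ennreal \<Rightarrow> 'e::topological_space \<Rightarrow> (nat \<Rightarrow> 'w \<Rightarrow> ennreal) \<Rightarrow> (nat \<Rightarrow> 'w \<Rightarrow> 'e) \<Rightarrow>
   ('w \<Rightarrow> real) \<Rightarrow> (nat \<Rightarrow> 'e hist \<Rightarrow> real) \<Rightarrow> bool"
where
  "represents_xi \<Omega> T \<Delta> S X \<xi> u \<longleftrightarrow>
     (\<forall>n. u n \<in> borel_measurable (hist_space T \<Delta> n)) \<and>
     (\<forall>n. \<forall>D\<in>hist_set T \<Delta> n. fst (D n) = \<infinity> \<longrightarrow> u n D = 0) \<and>
     (\<forall>\<omega>\<in>\<Omega>. \<forall>n. S n \<omega> \<le> T \<and> T < S (Suc n) \<omega> \<longrightarrow> \<xi> \<omega> = u n (history S X n \<omega>))"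

definition represents_Y ::
  "'w set \<Rightarrow> ennreal \<Rightarrow> 'e::topological_space \<Rightarrow> (nat \<Rightarrow> 'w \<Rightarrow> ennreal) \<Rightarrow> (nat \<Rightarrow> 'w \<Rightarrow> 'e) \<Rightarrow>
   (ennreal \<Rightarrow> 'w \<Rightarrow> real) \<Rightarrow> (nat \<Rightarrow> 'e hist \<Rightarrow> ennreal \<Rightarrow> real) \<Rightarrow> bool"
where
  "represents_Y \<Omega> T \<Delta> S X Y y \<longleftrightarrow>
     (\<forall>n. (\<lambda>(D, t). y n D t) \<in> borel_measurable (hist_space T \<Delta> n \<Otimes>\<^sub>M time_space T)) \<and>
     (\<forall>n. \<forall>D\<in>hist_set T \<Delta> n.
        (fst (D n) = \<infinity> \<longrightarrow> (\<forall>t\<in>{0..T}. y n D t = 0)) \<and>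
        continuous_on {0..T} (y n D) \<and>
        (\<forall>t\<in>{0..min T (fst (D n))}. y n D t = y n D 0)) \<and>
     (\<forall>\<omega>\<in>\<Omega>. \<forall>n. \<forall>t\<in>{0..T}. S n \<omega> \<le> t \<and> t < S (Suc n) \<omega> \<longrightarrow> Y t \<omega> = y n (history S X n \<omega>) t)"

definition represents_Z ::
  "'w set \<Rightarrow> ennreal \<Rightarrow> 'e::topological_space \<Rightarrow> (nat \<Rightarrow> 'w \<Rightarrow> ennreal) \<Rightarrow> (nat \<Rightarrow> 'w \<Rightarrow> 'e) \<Rightarrow>
   ('w \<Rightarrow> ennreal \<Rightarrow> 'e \<Rightarrow> real) \<Rightarrow> (nat \<Rightarrow> 'e hist \<Rightarrow> ennreal \<Rightarrow> 'e \<Rightarrow> real) \<Rightarrow> bool"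
where
  "represents_Z \<Omega> T \<Delta> S X Z z \<longleftrightarrow>
     (\<forall>n. hist_fun T \<Delta> n (z n)) \<and>
     (\<forall>\<omega>\<in>\<Omega>. \<forall>n x. \<forall>t\<in>{0..T}. S n \<omega> < t \<and> t \<le> S (Suc n) \<omega> \<longrightarrow>
        Z \<omega> t x = z n (history S X n \<omega>) t x)"

text \<open>\<open>yhat y n\<close> is the function built from the component of index \<open>n + 1\<close> of \<open>y\<close>; it lives on
  \<open>H\<^sub>n \<times> [0,T] \<times> E\<close>.\<close>

definition yhat ::
  "(nat \<Rightarrow> 'e hist \<Rightarrow> ennreal \<Rightarrow> real) \<Rightarrow> nat \<Rightarrow> 'e hist \<Rightarrow> ennreal \<Rightarrow> 'e \<Rightarrow> real" where
  "yhat y n D t x = (if fst (D n) < t then y (Suc n) (D(Suc n := (t, x))) t else 0)"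

definition associated_z ::
  "(nat \<Rightarrow> 'e hist \<Rightarrow> ennreal \<Rightarrow> real) \<Rightarrow> nat \<Rightarrow> 'e hist \<Rightarrow> ennreal \<Rightarrow> 'e \<Rightarrow> real" where
  "associated_z y n D t x = yhat y n D t x - y n D t"

text \<open>\<open>surv (G n D)\<close> is \<open>g\<^sup>n\<^sub>D\<close>, the survival function of the time marginal of \<open>G\<^sup>n\<^sub>D\<close>, and
  \<open>nu_hist T G n D\<close> is \<open>\<nu>\<^sup>n\<^sub>D\<close>.\<close>

definition surv :: "(ennreal \<times> 'e) measure \<Rightarrow> ennreal \<Rightarrow> ennreal" where
  "surv N t = emeasure N ({t<..} \<times> UNIV)"

definition nu_hist ::
  "ennreal \<Rightarrow> (nat \<Rightarrow> 'e hist \<Rightarrow> (ennreal \<times> 'e) measure) \<Rightarrow> nat \<Rightarrow> 'e hist \<Rightarrow> (ennreal \<times> 'e) measure" where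
  "nu_hist T G n D = density (G n D) (\<lambda>(t, x). indicator {0..T} t / surv (G n D) t)"

locale marked_point_process = prob_space M
  for M :: "'w measure" +
  fixes T :: ennreal
    and \<Delta> :: "'e::topological_space"
    and S :: "nat \<Rightarrow> 'w \<Rightarrow> ennreal"
    and X :: "nat \<Rightarrow> 'w \<Rightarrow> 'e"
    and F :: "ennreal \<Rightarrow> 'w measure"
  assumes lusin: "lusin_space (euclidean :: 'e topology)"
    and T_pos: "0 < T" and T_finite: "T < \<infinity>"
    and S_measurable: "\<And>n. S n \<in> borel_measurable M"
    and X_measurable: "\<And>n. X n \<in> M \<rightarrow>\<^sub>M borel"
    and S_0: "\<And>\<omega>. \<omega> \<in> space M \<Longrightarrow> S 0 \<omega> = 0"
    and X_0: "\<And>\<omega>. \<omega> \<in> space M \<Longrightarrow> X 0 \<omega> = \<Delta>"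
    and S_range: "\<And>n \<omega>. \<omega> \<in> space M \<Longrightarrow> S (Suc n) \<omega> \<in> {0<..T} \<union> {\<infinity>}"
    and S_mono: "\<And>n \<omega>. \<omega> \<in> space M \<Longrightarrow> S n \<omega> \<le> S (Suc n) \<omega>"
    and S_strict: "\<And>n \<omega>. \<omega> \<in> space M \<Longrightarrow> S n \<omega> \<le> T \<Longrightarrow> S n \<omega> < S (Suc n) \<omega>"
    and X_infinity: "\<And>n \<omega>. \<omega> \<in> space M \<Longrightarrow> S n \<omega> = \<infinity> \<Longrightarrow> X n \<omega> = \<Delta>"
    and nonexplosive: "space M = (\<Union>n. {\<omega> \<in> space M. T < S n \<omega>})"
    and F_generated: "generated_filtration (space M) S X F"

text \<open>\<open>\<nu>(\<omega>,dt,dx) = dA\<^sub>t(\<omega>) \<phi>\<^bsub>\<omega>,t\<^esub>(dx)\<close> is the compensator of the jump measure.\<close>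

locale compensated_point_process = marked_point_process M T \<Delta> S X F
  for M :: "'w measure" and T :: ennreal and \<Delta> :: "'e::topological_space"
    and S :: "nat \<Rightarrow> 'w \<Rightarrow> ennreal" and X :: "nat \<Rightarrow> 'w \<Rightarrow> 'e" and F :: "ennreal \<Rightarrow> 'w measure" +
  fixes A :: "ennreal \<Rightarrow> 'w \<Rightarrow> real"
    and \<phi> :: "'w \<times> ennreal \<Rightarrow> 'e measure"
    and \<nu> :: "'w \<Rightarrow> (ennreal \<times> 'e) measure"
  assumes A_0: "\<And>\<omega>. \<omega> \<in> space M \<Longrightarrow> A 0 \<omega> = 0"
    and A_mono: "\<And>\<omega>. \<omega> \<in> space M \<Longrightarrow> mono_on {0..T} (\<lambda>t. A t \<omega>)"
    and A_cadlag: "\<And>\<omega>. \<omega> \<in> space M \<Longrightarrow> cadlag T (\<lambda>t. A t \<omega>)"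
    and A_predictable: "(\<lambda>(\<omega>, t). A t \<omega>) \<in> borel_measurable (predictable_sigma (space M) T F)"
    and \<phi>_kernel: "\<phi> \<in> predictable_sigma (space M) T F \<rightarrow>\<^sub>M prob_algebra borel"
    and \<nu>_sets: "\<And>\<omega>. \<omega> \<in> space M \<Longrightarrow> sets (\<nu> \<omega>) = sets (borel \<Otimes>\<^sub>M borel)"
    and \<nu>_disintegration: "\<And>\<omega> C. \<omega> \<in> space M \<Longrightarrow> C \<in> sets (borel \<Otimes>\<^sub>M borel) \<Longrightarrow>
          emeasure (\<nu> \<omega>) C =
            (\<integral>\<^sup>+t\<in>{0..T}. emeasure (\<phi> (\<omega>, t)) {x. (t, x) \<in> C} \<partial>stieltjes_measure T (\<lambda>t. A t \<omega>))"
    and \<nu>_compensator: "same_predictable_expectation M T F (jump_measure T S X) \<nu>"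

text \<open>\<open>G n (history S X n \<omega>)\<close> is the conditional law of the next point given \<open>\<F>\<^bsub>S\<^sub>n\<^esub>\<close>, in the version
  with continuous survival function. The compensator being unique only up to a null set, its
  expression through \<open>G\<close> is required almost surely.\<close>

locale disintegrated_point_process = compensated_point_process M T \<Delta> S X F A \<phi> \<nu>
  for M :: "'w measure" and T :: ennreal and \<Delta> :: "'e::topological_space"
    and S :: "nat \<Rightarrow> 'w \<Rightarrow> ennreal" and X :: "nat \<Rightarrow> 'w \<Rightarrow> 'e" and F :: "ennreal \<Rightarrow> 'w measure"
    and A :: "ennreal \<Rightarrow> 'w \<Rightarrow> real" and \<phi> :: "'w \<times> ennreal \<Rightarrow> 'e measure"
    and \<nu> :: "'w \<Rightarrow> (ennreal \<times> 'e) measure" +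
  fixes G :: "nat \<Rightarrow> 'e hist \<Rightarrow> (ennreal \<times> 'e) measure"
  assumes G_kernel: "\<And>n. G n \<in> hist_space T \<Delta> n \<rightarrow>\<^sub>M prob_algebra (borel \<Otimes>\<^sub>M borel)"
    and G_conditional_law: "\<And>n C. C \<in> sets (borel \<Otimes>\<^sub>M borel) \<Longrightarrow>
          AE \<omega> in M. real_cond_exp M (filtration.pre_sigma (space M) F (S n))
              (indicator {\<omega> \<in> space M. (S (Suc n) \<omega>, X (Suc n) \<omega>) \<in> C}) \<omega> =
            measure (G n (history S X n \<omega>)) C"
    and G_no_late: "\<And>n D. D \<in> hist_set T \<Delta> n \<Longrightarrow> emeasure (G n D) ({T<..<\<infinity>} \<times> UNIV) = 0"
    and surv_continuous: "\<And>n D. D \<in> hist_set T \<Delta> n \<Longrightarrow> continuous_on {0..<\<infinity>} (surv (G n D))"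
    and surv_T_pos: "\<And>n D. D \<in> hist_set T \<Delta> n \<Longrightarrow> 0 < surv (G n D) T"
    and surv_last: "\<And>n D. D \<in> hist_set T \<Delta> n \<Longrightarrow> fst (D n) < \<infinity> \<Longrightarrow> surv (G n D) (fst (D n)) = 1"
    and \<nu>_hist: "AE \<omega> in M. \<forall>C\<in>sets (borel \<Otimes>\<^sub>M borel). emeasure (\<nu> \<omega>) C =
          (\<Sum>n. emeasure (nu_hist T G n (history S X n \<omega>))
                 (C \<inter> {S n \<omega><..min (S (Suc n) \<omega>) T} \<times> UNIV))"

text \<open>In \<open>fr n z D t x y w\<close>, the pathwise form of the generator \<open>f\<close>, the function \<open>z\<close> is the one
  in braces.\<close>

locale bsde_setting = disintegrated_point_process M T \<Delta> S X F A \<phi> \<nu> G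
  for M :: "'w measure" and T :: ennreal and \<Delta> :: "'e::topological_space"
    and S :: "nat \<Rightarrow> 'w \<Rightarrow> ennreal" and X :: "nat \<Rightarrow> 'w \<Rightarrow> 'e" and F :: "ennreal \<Rightarrow> 'w measure"
    and A :: "ennreal \<Rightarrow> 'w \<Rightarrow> real" and \<phi> :: "'w \<times> ennreal \<Rightarrow> 'e measure"
    and \<nu> :: "'w \<Rightarrow> (ennreal \<times> 'e) measure"
    and G :: "nat \<Rightarrow> 'e hist \<Rightarrow> (ennreal \<times> 'e) measure" +
  fixes \<xi> :: "'w \<Rightarrow> real"
    and u :: "nat \<Rightarrow> 'e hist \<Rightarrow> real"
    and f :: "'w \<Rightarrow> ennreal \<Rightarrow> 'e \<Rightarrow> real \<Rightarrow> ('e \<Rightarrow> real) \<Rightarrow> real"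
    and fr :: "nat \<Rightarrow> ('e hist \<Rightarrow> ennreal \<Rightarrow> 'e \<Rightarrow> real) \<Rightarrow>
               'e hist \<Rightarrow> ennreal \<Rightarrow> 'e \<Rightarrow> real \<Rightarrow> real \<Rightarrow> real"
  assumes \<xi>_measurable: "\<xi> \<in> borel_measurable (F T)"
    and \<xi>_repr: "represents_xi (space M) T \<Delta> S X \<xi> u"
    and f_predictable: "\<And>Z :: 'w \<Rightarrow> ennreal \<Rightarrow> 'e \<Rightarrow> real. predictable_fun (space M) T F Z \<Longrightarrow>
          (\<lambda>(((\<omega>, t), x), y). f \<omega> t x y (Z \<omega> t)) \<in>
            borel_measurable ((predictable_sigma (space M) T F \<Otimes>\<^sub>M borel) \<Otimes>\<^sub>M borel)"
    and f_lipschitz_y: "\<exists>L'\<ge>0. \<forall>\<omega>\<in>space M. \<forall>t\<in>{0..T}. \<forall>x y y'. \<forall>\<zeta>\<in>borel_measurable borel.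
          \<bar>f \<omega> t x y' \<zeta> - f \<omega> t x y \<zeta>\<bar> \<le> L' * \<bar>y' - y\<bar>"
    and f_lipschitz_z: "\<exists>L\<ge>0. \<forall>\<omega>\<in>space M. \<forall>t\<in>{0..T}. \<forall>y.
          \<forall>\<zeta>\<in>borel_measurable borel. \<forall>\<zeta>'\<in>borel_measurable borel.
          (\<integral>\<^sup>+x. ennreal \<bar>f \<omega> t x y \<zeta> - f \<omega> t x y \<zeta>'\<bar> \<partial>\<phi> (\<omega>, t)) \<le>
            ennreal L * (\<integral>\<^sup>+x. ennreal \<bar>\<zeta>' x - \<zeta> x\<bar> \<partial>\<phi> (\<omega>, t))"
    and f_zero_integrable: "AE \<omega> in M.
          (\<integral>\<^sup>+p\<in>{0..T} \<times> UNIV. ennreal \<bar>f \<omega> (fst p) (snd p) 0 (\<lambda>_. 0)\<bar> \<partial>\<nu> \<omega>) < \<infinity>"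
    and fr_measurable: "\<And>n z. hist_fun T \<Delta> n z \<Longrightarrow>
          (\<lambda>(D, t, x, y, w). fr n z D t x y w) \<in> borel_measurable
            (hist_space T \<Delta> n \<Otimes>\<^sub>M time_space T \<Otimes>\<^sub>M borel \<Otimes>\<^sub>M borel \<Otimes>\<^sub>M borel)"
    and fr_infinity: "\<And>n z D t x y w. hist_fun T \<Delta> n z \<Longrightarrow> D \<in> hist_set T \<Delta> n \<Longrightarrow>
          fst (D n) = \<infinity> \<Longrightarrow> t \<in> {0..T} \<Longrightarrow> fr n z D t x y w = 0"
    and fr_repr: "\<And>n z \<omega> t x y w. hist_fun T \<Delta> n z \<Longrightarrow> \<omega> \<in> space M \<Longrightarrow>
          S n \<omega> < t \<Longrightarrow> t \<le> S (Suc n) \<omega> \<Longrightarrow> t \<le> T \<Longrightarrow>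
          f \<omega> t x y (\<lambda>x'. w + z (history S X n \<omega>) t x') = fr n z (history S X n \<omega>) t x y w"

definition assumption_A ::
  "'w measure \<Rightarrow> ennreal \<Rightarrow> (nat \<Rightarrow> 'w \<Rightarrow> ennreal) \<Rightarrow> (ennreal \<Rightarrow> 'w measure) \<Rightarrow>
   (ennreal \<Rightarrow> 'w \<Rightarrow> real) \<Rightarrow> bool"
where
  "assumption_A M T S F A \<longleftrightarrow>
     (AE \<omega> in M. continuous_on {0..T} (\<lambda>t. A t \<omega>)) \<and>
     (\<forall>n. AE \<omega> in M. 0 < real_cond_exp M (filtration.pre_sigma (space M) F (S n))
                             (indicator {\<omega> \<in> space M. T < S (Suc n) \<omega>}) \<omega>)"

text \<open>Lebesgue integrals are total in the library (with value \<open>0\<close> off the integrable functions), so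
  the convergence of the integrals of \<open>f\<close> is stated along with each equation. The integrals with
  respect to \<open>\<mu>\<close> are finite sums.\<close>

definition bsde_equation ::
  "'w measure \<Rightarrow> ennreal \<Rightarrow> (nat \<Rightarrow> 'w \<Rightarrow> ennreal) \<Rightarrow> (nat \<Rightarrow> 'w \<Rightarrow> 'e::topological_space) \<Rightarrow>
   ('w \<Rightarrow> (ennreal \<times> 'e) measure) \<Rightarrow> ('w \<Rightarrow> real) \<Rightarrow>
   ('w \<Rightarrow> ennreal \<Rightarrow> 'e \<Rightarrow> real \<Rightarrow> ('e \<Rightarrow> real) \<Rightarrow> real) \<Rightarrow>
   (ennreal \<Rightarrow> 'w \<Rightarrow> real) \<Rightarrow> ('w \<Rightarrow> ennreal \<Rightarrow> 'e \<Rightarrow> real) \<Rightarrow> bool"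
where
  "bsde_equation M T S X \<nu> \<xi> f Y Z \<longleftrightarrow>
     (AE \<omega> in M.
        set_integrable (\<nu> \<omega>) ({0<..T} \<times> UNIV)
          (\<lambda>(s, x). f \<omega> s x (Lim (at_left s) (\<lambda>r. Y r \<omega>)) (Z \<omega> s)) \<and>
        (\<forall>t\<in>{0..T}.
           Y t \<omega> + (LINT (s, x):{t<..T} \<times> UNIV|jump_measure T S X \<omega>. Z \<omega> s x) =
           \<xi> \<omega> + (LINT (s, x):{t<..T} \<times> UNIV|\<nu> \<omega>.
                     f \<omega> s x (Lim (at_left s) (\<lambda>r. Y r \<omega>)) (Z \<omega> s))))"

definition nu_integrable ::
  "'w measure \<Rightarrow> ennreal \<Rightarrow> ('w \<Rightarrow> (ennreal \<times> 'e::topological_space) measure) \<Rightarrow>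
   ('w \<Rightarrow> ennreal \<Rightarrow> 'e \<Rightarrow> real) \<Rightarrow> bool"
where
  "nu_integrable M T \<nu> Z \<longleftrightarrow>
     (AE \<omega> in M. (\<integral>\<^sup>+p\<in>{0..T} \<times> UNIV. ennreal \<bar>Z \<omega> (fst p) (snd p)\<bar> \<partial>\<nu> \<omega>) < \<infinity>)"

definition bsde_solution ::
  "'w measure \<Rightarrow> ennreal \<Rightarrow> (nat \<Rightarrow> 'w \<Rightarrow> ennreal) \<Rightarrow> (nat \<Rightarrow> 'w \<Rightarrow> 'e::topological_space) \<Rightarrow>
   (ennreal \<Rightarrow> 'w measure) \<Rightarrow> ('w \<Rightarrow> (ennreal \<times> 'e) measure) \<Rightarrow> ('w \<Rightarrow> real) \<Rightarrow>
   ('w \<Rightarrow> ennreal \<Rightarrow> 'e \<Rightarrow> real \<Rightarrow> ('e \<Rightarrow> real) \<Rightarrow> real) \<Rightarrow> (ennreal \<Rightarrow> 'w \<Rightarrow> real) \<Rightarrow> bool"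
where
  "bsde_solution M T S X F \<nu> \<xi> f Y \<longleftrightarrow> adapted_cadlag (space M) T F Y \<and>
     (\<exists>Z. predictable_fun (space M) T F Z \<and> nu_integrable M T \<nu> Z \<and>
          bsde_equation M T S X \<nu> \<xi> f Y Z)"

definition pathwise_equation ::
  "ennreal \<Rightarrow> (nat \<Rightarrow> 'e hist \<Rightarrow> (ennreal \<times> 'e) measure) \<Rightarrow> (nat \<Rightarrow> 'e hist \<Rightarrow> real) \<Rightarrow>
   (nat \<Rightarrow> ('e hist \<Rightarrow> ennreal \<Rightarrow> 'e \<Rightarrow> real) \<Rightarrow> 'e hist \<Rightarrow> ennreal \<Rightarrow> 'e \<Rightarrow> real \<Rightarrow> real \<Rightarrow> real) \<Rightarrow>
   (nat \<Rightarrow> 'e hist \<Rightarrow> ennreal \<Rightarrow> real) \<Rightarrow> nat \<Rightarrow> 'e hist \<Rightarrow> bool"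
where
  "pathwise_equation T G u fr y n D \<longleftrightarrow>
     set_integrable (nu_hist T G n D) ({0<..T} \<times> UNIV)
       (\<lambda>(s, x). fr n (yhat y n) D s x (y n D s) (- y n D s)) \<and>
     (\<forall>t\<in>{0..T}. y n D t = u n D +
        (LINT (s, x):{t<..T} \<times> UNIV|nu_hist T G n D.
           fr n (yhat y n) D s x (y n D s) (- y n D s)))"

text \<open>The integrability of \<open>Z\<close> demanded of a solution, for the \<open>Z\<close> associated with \<open>y\<close>. The pathwise
  equations do not entail it: let \<open>f = 0\<close>, let there be at most one jump, with \<open>S 1\<close> uniform on \<open>(0,T]\<close>
  or infinite with probability \<open>1/2\<close> each, an independent Cauchy distributed mark, and let \<open>\<xi>\<close> be that
  mark if \<open>S 1 \<le> T\<close> and \<open>0\<close> otherwise.\<close>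

definition associated_Z_integrable ::
  "'w measure \<Rightarrow> ennreal \<Rightarrow> 'e::topological_space \<Rightarrow> (nat \<Rightarrow> 'w \<Rightarrow> ennreal) \<Rightarrow> (nat \<Rightarrow> 'w \<Rightarrow> 'e) \<Rightarrow>
   (ennreal \<Rightarrow> 'w measure) \<Rightarrow> ('w \<Rightarrow> (ennreal \<times> 'e) measure) \<Rightarrow>
   (nat \<Rightarrow> 'e hist \<Rightarrow> ennreal \<Rightarrow> real) \<Rightarrow> bool"
where
  "associated_Z_integrable M T \<Delta> S X F \<nu> y \<longleftrightarrow>
     (\<exists>Z. predictable_fun (space M) T F Z \<and> represents_Z (space M) T \<Delta> S X Z (associated_z y) \<and>
          nu_integrable M T \<nu> Z)"

end

theory Submission
  imports Defs
begin

text \<open>Between two jumps nothing random happens: on \<open>(S n, S (n + 1)]\<close> the process is the function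
  \<open>y n\<close> of the history \<open>D = H n \<omega>\<close>, the compensator is the measure \<open>\<nu>h n D\<close>, and for the
  \<open>Z\<close> associated with \<open>y\<close> the generator is the integrand \<open>driver n D\<close> of the pathwise equation
  (\<open>bsde_driver_eq_driver\<close>, \<open>\<nu>_set_integral_on_interval\<close>). On each such interval the BSDE and the
  pathwise equation therefore have the same increments. The work lies in passing from one interval
  to the next, and from an interval to all of \<open>[0,T]\<close>.

  From the pathwise equations to the BSDE: a predictable \<open>Z\<close> with the associated components exists
  (\<open>ex_predictable_representing\<close>), and at a jump time it is the jump of \<open>Y\<close>. So both sides of the
  BSDE also jump by the same amount at each \<open>S n\<close>, and the BSDE follows by induction on \<open>n\<close>,
  downwards from the last jump before \<open>T\<close> (\<open>bsde_at_of_pathwise\<close>).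

  From the BSDE to the pathwise equations: here \<open>Z\<close> is an arbitrary predictable function. As the
  compensator has no atoms in time, comparing the BSDE before and at a jump shows that \<open>Z\<close>, evaluated
  at the jump, is the jump of \<open>Y\<close> (\<open>jump_of_bsde\<close>). Thus \<open>Z\<close> agrees with the associated function at
  all points of the jump measure, hence almost everywhere for the compensator, since the set where
  they differ is predictable (\<open>compensator_AE_zero\<close>). The Lipschitz condition in \<open>\<zeta>\<close>, which is
  integrated over the marks, makes the two generators agree as well
  (\<open>bsde_driver_AE_eq_driver\<close>). Now the BSDE on \<open>{S n \<le> T < S (n + 1)}\<close> is the pathwise equation of
  index \<open>n\<close> on \<open>[S n, T]\<close>, and before \<open>S n\<close> both \<open>y n\<close> and the integral are constant
  (\<open>pathwise_on_last_interval\<close>). Whether the pathwise equation holds is a measurable property of the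
  history (\<open>pathwise_measurable\<close>), and given the history the next jump comes after \<open>T\<close> with positive
  probability. So the equation holds almost surely on the whole of \<open>{S n \<le> T}\<close>
  (\<open>AE_history_if_AE_last\<close>), whether or not another jump follows.

  If there are almost surely at most \<open>m\<close> jumps, then \<open>\<nu>h m\<close> is almost surely zero along the
  histories and the equation of index \<open>m\<close> says that \<open>y m = u m\<close>; the later equations read \<open>0 = 0\<close>
  (\<open>AE_pathwise_iff_bounded_jumps\<close>).\<close>

section \<open>Histories and the filtration of the point process\<close>

context marked_point_process
begin

abbreviation H :: "nat \<Rightarrow> 'w \<Rightarrow> 'e hist" where
  "H \<equiv> history S X"

lemma carries: "carries_mpp (space M) S X F"
  using F_generated by (simp add: generated_filtration_def)

sublocale filtration "space M" F
  using carries by (simp add: carries_mpp_def)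

lemma stopping_time_S: "stopping_time F (S n)"
  using carries by (simp add: carries_mpp_def)

lemma X_pre_sigma: "X n \<in> pre_sigma (S n) \<rightarrow>\<^sub>M borel"
  using carries by (simp add: carries_mpp_def)

lemma S_finite_or_infinity: "\<omega> \<in> space M \<Longrightarrow> S n \<omega> \<in> {0..T} \<union> {\<infinity>}"
  using S_0[of \<omega>] S_range[of \<omega> "n - 1"] by (cases n) auto

lemma S_le_T_iff: "\<omega> \<in> space M \<Longrightarrow> S n \<omega> \<le> T \<longleftrightarrow> S n \<omega> \<noteq> \<infinity>"
  using S_finite_or_infinity[of \<omega> n] T_finite by (auto simp: top_unique)

lemma S_mono_le: "\<omega> \<in> space M \<Longrightarrow> m \<le> n \<Longrightarrow> S m \<omega> \<le> S n \<omega>"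
  by (rule lift_Suc_mono_le[of "\<lambda>n. S n \<omega>"]) (auto intro: S_mono)

lemma S_strict_mono:
  assumes "\<omega> \<in> space M" "m < n" "S m \<omega> \<le> T" shows "S m \<omega> < S n \<omega>"
proof -
  have "S m \<omega> < S (Suc m) \<omega>" using assms S_strict by auto
  also have "\<dots> \<le> S n \<omega>" using assms by (intro S_mono_le) auto
  finally show ?thesis .
qed

text \<open>The constant filtration \<open>M\<close> carries the point process as well, and \<open>F\<close> is the smallest
  filtration that does.\<close>

lemma sets_F_subset: "sets (F t) \<subseteq> sets M"
proof -
  let ?F = "\<lambda>_::ennreal. M"
  have fil: "filtration (space M) ?F"
    by unfold_locales auto
  have st: "stopping_time ?F (S n)" for n
    using S_measurable by (auto simp: stopping_time_def)
  have "X n \<in> filtration.pre_sigma (space M) ?F (S n) \<rightarrow>\<^sub>M borel" for n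
  proof -
    have "sets (filtration.pre_sigma (space M) ?F (S n)) = sets M"
    proof -
      have "{\<omega> \<in> B. S n \<omega> \<le> t} \<in> sets M" if "B \<in> sets M" for B t
      proof -
        have "{\<omega> \<in> B. S n \<omega> \<le> t} = B \<inter> {\<omega> \<in> space M. S n \<omega> \<le> t}"
          using that sets.sets_into_space by auto
        then show ?thesis using that S_measurable[of n] by auto
      qed
      moreover have "B \<in> sets M" if "\<forall>t. {\<omega> \<in> B. S n \<omega> \<le> t} \<in> sets M" for B
        using that[rule_format, of \<infinity>] by simp
      ultimately have "{B. \<forall>t. {\<omega> \<in> B. S n \<omega> \<le> t} \<in> sets M} = sets M"
        by blast
      then show ?thesis
        using filtration.sets_pre_sigma[OF fil st, of n] by simp
    qed
    then show ?thesis
      using X_measurable[of n] by (simp cong: measurable_cong_sets)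
  qed
  then have "carries_mpp (space M) S X ?F"
    using fil st by (auto simp: carries_mpp_def)
  then show ?thesis
    using F_generated by (auto simp: generated_filtration_def)
qed

lemma subalgebra_pre_sigma: "subalgebra M (pre_sigma (S n))"
proof -
  have "B \<in> sets M" if "B \<in> sets (pre_sigma (S n))" for B
    using sets_pre_sigmaD[OF stopping_time_S that, of \<infinity>] sets_F_subset by auto
  then show ?thesis
    by (auto simp: subalgebra_def space_pre_sigma)
qed

lemma history_in_hist_set:
  assumes "\<omega> \<in> space M" shows "H n \<omega> \<in> hist_set T \<Delta> n"
  unfolding hist_set_def mem_Collect_eq
proof (intro conjI allI impI)
  have *: "(S j \<omega>, X j \<omega>) \<in> {0..T} \<times> UNIV \<union> {(\<infinity>, \<Delta>)}" for j
    using S_finite_or_infinity[OF assms, of j] X_infinity[OF assms, of j] by auto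
  show "H n \<omega> \<in> {..n} \<rightarrow>\<^sub>E {0..T} \<times> UNIV \<union> {(\<infinity>, \<Delta>)}"
    unfolding history_def by (rule restrict_PiE_iff[THEN iffD2]) (use * in blast)
  show "H n \<omega> 0 = (0, \<Delta>)"
    using assms by (simp add: history_def S_0 X_0)
  fix j
  show "fst (H n \<omega> j) \<le> fst (H n \<omega> (Suc j))" if "j < n"
    using that S_mono[OF assms] by (simp add: history_def)
  show "fst (H n \<omega> j) < fst (H n \<omega> (Suc j))" if "j < n" "fst (H n \<omega> j) \<le> T"
    using that S_strict[OF assms] by (simp add: history_def)
  show "H n \<omega> j = (\<infinity>, \<Delta>)" if "j \<le> n" "T < fst (H n \<omega> j)"
    using that S_le_T_iff[OF assms, of j] X_infinity[OF assms, of j] by (auto simp: history_def simp flip: not_le)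
qed

lemma last_time_history [simp]: "fst (H n \<omega> n) = S n \<omega>"
  by (simp add: history_def)

lemma history_Suc: "(H n \<omega>)(Suc n := (S (Suc n) \<omega>, X (Suc n) \<omega>)) = H (Suc n) \<omega>"
  by (auto simp: history_def fun_eq_iff le_Suc_eq)

lemma history_pre_sigma: "H n \<in> pre_sigma (S n) \<rightarrow>\<^sub>M hist_space T \<Delta> n"
proof -
  have "(\<lambda>\<omega>. (S j \<omega>, X j \<omega>)) \<in> pre_sigma (S n) \<rightarrow>\<^sub>M borel \<Otimes>\<^sub>M borel" if "j \<le> n" for j
  proof -
    have "(\<lambda>\<omega>. (S j \<omega>, X j \<omega>)) \<in> pre_sigma (S j) \<rightarrow>\<^sub>M borel \<Otimes>\<^sub>M borel"
      using measurable_stopping_time_pre_sigma[OF stopping_time_S] X_pre_sigma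
      by (intro measurable_Pair) auto
    moreover have "sets (pre_sigma (S j)) \<subseteq> sets (pre_sigma (S n))"
      using that by (intro mono_pre_sigma stopping_time_S S_mono_le)
    ultimately show ?thesis
      by (auto simp: measurable_def space_pre_sigma)
  qed
  then have "(\<lambda>\<omega>. \<lambda>j\<in>{..n}. (S j \<omega>, X j \<omega>)) \<in> pre_sigma (S n) \<rightarrow>\<^sub>M (\<Pi>\<^sub>M j\<in>{..n}. borel \<Otimes>\<^sub>M borel)"
    by (intro measurable_restrict) auto
  then show ?thesis
    unfolding hist_space_def
    using history_in_hist_set by (intro measurable_restrict_space2) (auto simp: space_pre_sigma history_def[abs_def])
qed

lemma history_measurable: "H n \<in> M \<rightarrow>\<^sub>M hist_space T \<Delta> n"
  using measurable_from_subalg[OF subalgebra_pre_sigma history_pre_sigma] .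

end

lemma space_hist_space: "space (hist_space T \<Delta> n) = hist_set T \<Delta> n"
proof -
  have "hist_set T \<Delta> n \<subseteq> {..n} \<rightarrow>\<^sub>E UNIV"
    unfolding hist_set_def by (blast intro: PiE_mono[THEN subsetD])
  then show ?thesis
    by (auto simp: hist_space_def space_restrict_space space_PiM space_pair_measure)
qed

lemma last_time_measurable: "(\<lambda>D. fst (D n)) \<in> hist_space T \<Delta> n \<rightarrow>\<^sub>M borel"
  unfolding hist_space_def by (intro measurable_restrict_space1) measurable

lemma min_time_space [measurable]: "(\<lambda>t::ennreal. min t T) \<in> borel \<rightarrow>\<^sub>M time_space T"
  by (intro measurable_restrict_space2) auto

lemma hist_set_append:
  assumes "D \<in> hist_set T \<Delta> n" "fst (D n) < t" "t \<le> T"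
  shows "D(Suc n := (t, x)) \<in> hist_set T \<Delta> (Suc n)"
  unfolding hist_set_def mem_Collect_eq
proof (intro conjI allI impI)
  let ?A = "{0..T} \<times> UNIV \<union> {(\<infinity>, \<Delta>)}"
  have D: "D \<in> {..n} \<rightarrow>\<^sub>E ?A" "D 0 = (0, \<Delta>)"
    "\<And>j. j < n \<Longrightarrow> fst (D j) \<le> fst (D (Suc j))"
    "\<And>j. j < n \<Longrightarrow> fst (D j) \<le> T \<Longrightarrow> fst (D j) < fst (D (Suc j))"
    "\<And>j. j \<le> n \<Longrightarrow> T < fst (D j) \<Longrightarrow> D j = (\<infinity>, \<Delta>)"
    using assms(1) unfolding hist_set_def by blast+
  show "D(Suc n := (t, x)) \<in> {..Suc n} \<rightarrow>\<^sub>E ?A"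
    unfolding atMost_Suc by (rule PiE_fun_upd[OF _ D(1)]) (use assms(3) in simp)
  show "(D(Suc n := (t, x))) 0 = (0, \<Delta>)"
    using D by simp
  let ?D = "D(Suc n := (t, x))"
  fix j
  show "fst (?D j) \<le> fst (?D (Suc j))" if "j < Suc n"
    using that D(3) assms(2) by (cases "j = n") auto
  show "fst (?D j) < fst (?D (Suc j))" if "j < Suc n" "fst (?D j) \<le> T"
    using that D(4)[of j] assms(2) by (cases "j = n") auto
  show "?D j = (\<infinity>, \<Delta>)" if "j \<le> Suc n" "T < fst (?D j)"
    using that D(5)[of j] assms(3) by (cases "j = Suc n") auto
qed

section \<open>Predictable functions and functions of histories\<close>

context marked_point_process
begin

abbreviation \<P> :: "('w \<times> ennreal) measure" where
  "\<P> \<equiv> predictable_sigma (space M) T F"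

lemma predictable_generator_subset:
  "{B \<times> {0} | B. B \<in> sets (F 0)} \<union> {B \<times> {s<..t} | B s t. s \<le> t \<and> t \<le> T \<and> B \<in> sets (F s)}
     \<subseteq> Pow (space M \<times> {0..T})"
  using sets.sets_into_space[of _ "F _"] by (auto simp: space_F dest!: sets.sets_into_space)

lemma space_predictable: "space \<P> = space M \<times> {0..T}"
  unfolding predictable_sigma_def using predictable_generator_subset by (rule space_measure_of)

lemma predictable_rectangle:
  assumes "s \<le> t" "t \<le> T" "B \<in> sets (F s)" shows "B \<times> {s<..t} \<in> sets \<P>"
  unfolding predictable_sigma_def sets_measure_of[OF predictable_generator_subset]
  using assms by (intro sigma_sets.Basic) auto

lemma snd_predictable: "snd \<in> \<P> \<rightarrow>\<^sub>M time_space T"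
proof (rule measurable_restrict_space2)
  show "snd \<in> space \<P> \<rightarrow> {0..T}" by (auto simp: space_predictable)
  show "snd \<in> \<P> \<rightarrow>\<^sub>M borel"
  proof (rule borel_measurableI_greater)
    fix r :: ennreal
    have "{p \<in> space \<P>. r < snd p} = (if r \<le> T then space M \<times> {r<..T} else {})"
      by (auto simp: space_predictable)
    also have "\<dots> \<in> sets \<P>"
      using predictable_rectangle[of r T "space M"] sets.top[of "F r"] by (auto simp: space_F)
    finally show "{p \<in> space \<P>. r < snd p} \<in> sets \<P>" .
  qed
qed

text \<open>After the stopping time \<open>S n\<close> the whole \<open>\<sigma>\<close>-field of its past is available to predictable
  functions: if \<open>S n \<le> q < t\<close> for a \<open>q\<close> in a countable set, then \<open>B \<inter> {S n \<le> q}\<close> lies in \<open>F q\<close>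
  and \<open>t\<close> in \<open>(q,T]\<close>.\<close>

lemma predictable_after:
  assumes "B \<in> sets (pre_sigma (S n))"
  shows "{p \<in> space \<P>. fst p \<in> B \<and> S n (fst p) < snd p} \<in> sets \<P>"
proof -
  obtain Q :: "ennreal set" where Q: "countable Q" "\<And>x y. x < y \<Longrightarrow> \<exists>b\<in>Q. x \<le> b \<and> b < y"
    using countable_separating_set_linorder2 by auto
  have B: "B \<subseteq> space M"
    using sets.sets_into_space[OF assms] by (simp add: space_pre_sigma)
  have "{p \<in> space \<P>. fst p \<in> B \<and> S n (fst p) < snd p}
      = (\<Union>q\<in>Q \<inter> {..T}. {\<omega> \<in> B. S n \<omega> \<le> q} \<times> {q<..T})"
  proof (intro equalityI subsetI)
    fix p assume p: "p \<in> {p \<in> space \<P>. fst p \<in> B \<and> S n (fst p) < snd p}"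
    then obtain q where "q \<in> Q" "S n (fst p) \<le> q" "q < snd p" using Q(2) by blast
    with p show "p \<in> (\<Union>q\<in>Q \<inter> {..T}. {\<omega> \<in> B. S n \<omega> \<le> q} \<times> {q<..T})"
      by (intro UN_I[of q]) (auto simp: space_predictable)
  next
    fix p assume "p \<in> (\<Union>q\<in>Q \<inter> {..T}. {\<omega> \<in> B. S n \<omega> \<le> q} \<times> {q<..T})"
    then show "p \<in> {p \<in> space \<P>. fst p \<in> B \<and> S n (fst p) < snd p}"
      using B by (auto simp: space_predictable)
  qed
  also have "\<dots> \<in> sets \<P>"
    using Q(1) sets_pre_sigmaD[OF stopping_time_S assms]
    by (intro sets.countable_UN'') (auto intro!: predictable_rectangle)
  finally show ?thesis .
qed

lemma fst_predictable_after:
  "fst \<in> restrict_space \<P> {p. S n (fst p) < snd p} \<rightarrow>\<^sub>M pre_sigma (S n)"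
proof (rule measurableI)
  fix B assume B: "B \<in> sets (pre_sigma (S n))"
  have "fst -` B \<inter> space (restrict_space \<P> {p. S n (fst p) < snd p}) =
      {p. S n (fst p) < snd p} \<inter> {p \<in> space \<P>. fst p \<in> B \<and> S n (fst p) < snd p}"
    by (auto simp: space_restrict_space)
  then show "fst -` B \<inter> space (restrict_space \<P> {p. S n (fst p) < snd p}) \<in>
      sets (restrict_space \<P> {p. S n (fst p) < snd p})"
    using predictable_after[OF B] by (simp add: sets_restrict_space)
qed (auto simp: space_restrict_space space_predictable space_pre_sigma)

lemma pair_predictable: "(\<lambda>p. p) \<in> M \<Otimes>\<^sub>M time_space T \<rightarrow>\<^sub>M \<P>"
proof -
  have "sets \<P> \<subseteq> sets (M \<Otimes>\<^sub>M time_space T)"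
    unfolding predictable_sigma_def sets_measure_of[OF predictable_generator_subset]
  proof (rule sets.sigma_sets_subset'; safe?)
    fix B assume "B \<in> sets (F 0)"
    then show "B \<times> {0} \<in> sets (M \<Otimes>\<^sub>M time_space T)"
      using sets_F_subset by (intro pair_measureI) (auto simp: sets_restrict_space_iff)
  next
    fix B s t assume "B \<in> sets (F s)" "s \<le> t" "t \<le> T"
    then show "B \<times> {s<..t} \<in> sets (M \<Otimes>\<^sub>M time_space T)"
      using sets_F_subset by (intro pair_measureI) (auto simp: sets_restrict_space_iff)
  next
    have "space M \<times> {0..T} = space (M \<Otimes>\<^sub>M time_space T)"
      by (simp add: space_pair_measure space_restrict_space)
    then show "space M \<times> {0..T} \<in> sets (M \<Otimes>\<^sub>M time_space T)"
      by (metis sets.top)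
  qed
  then show ?thesis
    by (auto simp: measurable_def space_predictable space_pair_measure space_restrict_space
        intro!: sets.Int)
qed

text \<open>The compensator and the laws of the next point live on \<open>[0,\<infinity>] \<times> E\<close>, predictable functions
  only on \<open>[0,T]\<close>. Evaluating at \<open>min t T\<close> extends the latter measurably, without changing them on
  \<open>[0,T]\<close>.\<close>

lemma predictable_fun_jointly_measurable:
  assumes "predictable_fun (space M) T F (Z :: 'w \<Rightarrow> ennreal \<Rightarrow> 'e \<Rightarrow> 'b::topological_space)"
  shows "(\<lambda>(\<omega>, t, x). Z \<omega> (min t T) x) \<in> M \<Otimes>\<^sub>M (borel \<Otimes>\<^sub>M borel) \<rightarrow>\<^sub>M borel"
proof -
  have "(\<lambda>q. (fst q, min (fst (snd q)) T)) \<in> M \<Otimes>\<^sub>M (borel \<Otimes>\<^sub>M (borel :: 'e measure)) \<rightarrow>\<^sub>M M \<Otimes>\<^sub>M time_space T"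
    by measurable
  from measurable_compose[OF this pair_predictable]
  have "(\<lambda>q. ((fst q, min (fst (snd q)) T), snd (snd q))) \<in>
      M \<Otimes>\<^sub>M (borel \<Otimes>\<^sub>M borel) \<rightarrow>\<^sub>M \<P> \<Otimes>\<^sub>M (borel :: 'e measure)"
    by measurable
  from measurable_compose[OF this assms[unfolded predictable_fun_def]]
  show ?thesis by (simp add: case_prod_beta')
qed

lemma predictable_fun_section:
  assumes "predictable_fun (space M) T F (Z :: 'w \<Rightarrow> ennreal \<Rightarrow> 'e \<Rightarrow> 'b::topological_space)" "\<omega> \<in> space M"
  shows "(\<lambda>(t, x). Z \<omega> (min t T) x) \<in> borel \<Otimes>\<^sub>M borel \<rightarrow>\<^sub>M borel"
  using measurable_Pair2[OF predictable_fun_jointly_measurable[OF assms(1)] assms(2)]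
  by (simp add: case_prod_beta')

lemma predictable_fun_slice:
  assumes "predictable_fun (space M) T F (Z :: 'w \<Rightarrow> ennreal \<Rightarrow> 'e \<Rightarrow> 'b::topological_space)" "\<omega> \<in> space M"
    "t \<le> T"
  shows "Z \<omega> t \<in> borel \<rightarrow>\<^sub>M borel"
  using measurable_Pair2[OF predictable_fun_section[OF assms(1,2)], of t] assms(3)
  by (simp add: min_absorb1)

lemma ex_interval:
  assumes "\<omega> \<in> space M" "0 < t" "t \<le> T"
  obtains n where "S n \<omega> < t" "t \<le> S (Suc n) \<omega>"
proof -
  obtain m where "T < S m \<omega>" using nonexplosive assms(1) by blast
  then have ex: "\<exists>m. t \<le> S m \<omega>" using assms(3) by (intro exI[of _ m]) auto
  define m where "m = (LEAST m. t \<le> S m \<omega>)"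
  have m: "t \<le> S m \<omega>" unfolding m_def using ex by (rule LeastI_ex)
  have "m \<noteq> 0" using m S_0[OF assms(1)] assms(2) by (cases m) auto
  then obtain k where k: "m = Suc k" by (cases m) auto
  have "\<not> t \<le> S k \<omega>" using not_less_Least[of k "\<lambda>m. t \<le> S m \<omega>"] k by (simp add: m_def)
  then show ?thesis using that[of k] m k by auto
qed

lemma ex_last_jump:
  assumes "\<omega> \<in> space M" "t \<le> T"
  obtains n where "S n \<omega> \<le> t" "t < S (Suc n) \<omega>"
proof -
  obtain m where "T < S m \<omega>" using nonexplosive assms(1) by blast
  then have ex: "\<exists>m. t < S m \<omega>" using assms by (intro exI[of _ m]) auto
  define m where "m = (LEAST m. t < S m \<omega>)"
  have m: "t < S m \<omega>" unfolding m_def using ex by (rule LeastI_ex)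
  have "m \<noteq> 0" using m S_0[OF assms(1)] by (cases m) auto
  then obtain k where k: "m = Suc k" by (cases m) auto
  have "\<not> t < S k \<omega>" using not_less_Least[of k "\<lambda>m. t < S m \<omega>"] k by (simp add: m_def)
  then show ?thesis using that[of k] m k by auto
qed

lemma interval_unique:
  assumes "\<omega> \<in> space M" "S m \<omega> < t" "t \<le> S (Suc m) \<omega>" "S n \<omega> < t" "t \<le> S (Suc n) \<omega>"
  shows "m = n"
proof -
  have *: False if "m < n" "t \<le> S (Suc m) \<omega>" "S n \<omega> < t" for m n
    using S_mono_le[OF assms(1), of "Suc m" n] that by auto
  show ?thesis using *[of m n] *[of n m] assms by (cases m n rule: linorder_cases) auto
qed

text \<open>The components are glued together along the intervals \<open>(S n, S (n + 1)]\<close>. Each of these is a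
  predictable set, and on it the history \<open>H n\<close> is a predictable function by
  \<open>fst_predictable_after\<close>.\<close>

lemma ex_predictable_representing:
  assumes z: "\<And>n. hist_fun T \<Delta> n (z n)"
  obtains Z where "predictable_fun (space M) T F Z" "represents_Z (space M) T \<Delta> S X Z z"
proof -
  \<comment> \<open>the index of the interval that contains \<open>t\<close>; time \<open>0\<close> lies in none of them\<close>
  define N where "N \<omega> t = (THE n. S n \<omega> < t \<and> t \<le> S (Suc n) \<omega>)" for \<omega> t
  have N: "N \<omega> t = n" if "\<omega> \<in> space M" "S n \<omega> < t" "t \<le> S (Suc n) \<omega>" for \<omega> t n
    unfolding N_def using that interval_unique by (intro the_equality) blast+
  define Z where "Z \<omega> t x = (if t = 0 then 0 else z (N \<omega> t) (H (N \<omega> t) \<omega>) t x)" for \<omega> t x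
  have Z: "Z \<omega> t x = z n (H n \<omega>) t x" if "\<omega> \<in> space M" "S n \<omega> < t" "t \<le> S (Suc n) \<omega>" for \<omega> t n x
    using that N[OF that] by (auto simp: Z_def)
  define I where "I n = {p \<in> space \<P>. S n (fst p) < snd p \<and> snd p \<le> S (Suc n) (fst p)}" for n
  have after: "{p \<in> space \<P>. S n (fst p) < snd p} \<in> sets \<P>" for n
  proof -
    have "{p \<in> space \<P>. S n (fst p) < snd p} =
        {p \<in> space \<P>. fst p \<in> space (pre_sigma (S n)) \<and> S n (fst p) < snd p}"
      by (auto simp: space_pre_sigma space_predictable)
    then show ?thesis using predictable_after[OF sets.top, of n] by simp
  qed
  have I_sets: "I n \<in> sets \<P>" for n
  proof -
    have "I n = {p \<in> space \<P>. S n (fst p) < snd p} - {p \<in> space \<P>. S (Suc n) (fst p) < snd p}"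
      by (auto simp: I_def)
    then show ?thesis using after by auto
  qed
  define I0 where "I0 = {p \<in> space \<P>. snd p = 0}"
  have "I0 = snd -` {0} \<inter> space \<P>" by (auto simp: I0_def)
  also have "\<dots> \<in> sets \<P>"
    by (rule measurable_sets[OF snd_predictable]) (auto simp: sets_restrict_space_iff)
  finally have I0_sets: "I0 \<in> sets \<P>" .
  let ?C = "insert (I0 \<times> (UNIV :: 'e set)) (range (\<lambda>n. I n \<times> UNIV))"
  have sets_time: "I n \<times> (UNIV :: 'e set) \<in> sets (\<P> \<Otimes>\<^sub>M borel)" for n
    using I_sets by (intro pair_measureI) auto
  have on_I: "(\<lambda>((\<omega>, t), x). Z \<omega> t x) \<in> borel_measurable (restrict_space (\<P> \<Otimes>\<^sub>M borel) (I n \<times> UNIV))" for n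
  proof -
    let ?R = "restrict_space (\<P> \<Otimes>\<^sub>M (borel :: 'e measure)) (I n \<times> UNIV)"
    have sp: "space ?R = I n \<times> UNIV"
      by (auto simp: space_restrict_space space_pair_measure I_def)
    have "fst \<in> ?R \<rightarrow>\<^sub>M restrict_space \<P> {p. S n (fst p) < snd p}"
    proof (rule measurable_restrict_space2)
      have "I n \<times> (UNIV :: 'e set) \<subseteq> {q. S n (fst (fst q)) < snd (fst q)}" by (auto simp: I_def)
      then show "fst \<in> space ?R \<rightarrow> {p. S n (fst p) < snd p}" unfolding sp by blast
      show "fst \<in> ?R \<rightarrow>\<^sub>M \<P>" by (intro measurable_restrict_space1) simp
    qed
    from measurable_compose[OF measurable_compose[OF this fst_predictable_after] history_pre_sigma]
    have 1: "(\<lambda>q. H n (fst (fst q))) \<in> ?R \<rightarrow>\<^sub>M hist_space T \<Delta> n" .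
    have 2: "(\<lambda>q. snd (fst q)) \<in> ?R \<rightarrow>\<^sub>M time_space T"
      by (intro measurable_restrict_space1 measurable_compose[OF measurable_fst snd_predictable])
    have 3: "snd \<in> ?R \<rightarrow>\<^sub>M borel"
      by (intro measurable_restrict_space1) simp
    have "(\<lambda>q. (H n (fst (fst q)), snd (fst q), snd q)) \<in> ?R \<rightarrow>\<^sub>M hist_space T \<Delta> n \<Otimes>\<^sub>M time_space T \<Otimes>\<^sub>M borel"
      using 1 2 3 by (intro measurable_Pair)
    moreover have "(\<lambda>(D, t, x). z n D t x) \<in> borel_measurable (hist_space T \<Delta> n \<Otimes>\<^sub>M time_space T \<Otimes>\<^sub>M borel)"
      using z[of n] by (simp add: hist_fun_def)
    ultimately have "(\<lambda>q. (\<lambda>(D, t, x). z n D t x) (H n (fst (fst q)), snd (fst q), snd q)) \<in> borel_measurable ?R"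
      by (rule measurable_compose)
    then have "(\<lambda>q. z n (H n (fst (fst q))) (snd (fst q)) (snd q)) \<in> borel_measurable ?R"
      by simp
    then show ?thesis
    proof (rule measurable_cong[THEN iffD1, rotated])
      fix q assume "q \<in> space ?R"
      then have "q \<in> I n \<times> UNIV" unfolding sp .
      then show "z n (H n (fst (fst q))) (snd (fst q)) (snd q) = (\<lambda>((\<omega>, t), x). Z \<omega> t x) q"
        by (auto simp: I_def space_predictable Z)
    qed
  qed
  have on_I0: "(\<lambda>((\<omega>, t), x). Z \<omega> t x) \<in> borel_measurable (restrict_space (\<P> \<Otimes>\<^sub>M borel) (I0 \<times> UNIV))"
    by (rule measurable_cong[THEN iffD1, OF _ measurable_const[of 0]])
       (auto simp: space_restrict_space I0_def Z_def)
  have cover: "space (\<P> \<Otimes>\<^sub>M (borel :: 'e measure)) \<subseteq> \<Union>?C"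
  proof
    fix q assume "q \<in> space (\<P> \<Otimes>\<^sub>M (borel :: 'e measure))"
    then obtain \<omega> t x where q: "q = ((\<omega>, t), x)" "\<omega> \<in> space M" "t \<le> T"
      by (auto simp: space_pair_measure space_predictable)
    show "q \<in> \<Union>?C"
    proof (cases "t = 0")
      case True then show ?thesis using q by (auto simp: I0_def space_predictable)
    next
      case False
      then obtain n where "S n \<omega> < t" "t \<le> S (Suc n) \<omega>"
        using ex_interval[OF q(2) _ q(3)] by (auto simp: zero_less_iff_neq_zero)
      then have "q \<in> I n \<times> UNIV" using q by (auto simp: I_def space_predictable)
      then show ?thesis by blast
    qed
  qed
  have "predictable_fun (space M) T F Z"
    unfolding predictable_fun_def
  proof (rule measurable_piecewise_restrict[OF _ _ cover])
    show "countable ?C" by auto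
    show "\<Omega> \<inter> space (\<P> \<Otimes>\<^sub>M borel) \<in> sets (\<P> \<Otimes>\<^sub>M borel)" if "\<Omega> \<in> ?C" for \<Omega>
    proof -
      have "\<Omega> \<in> sets (\<P> \<Otimes>\<^sub>M borel)"
        using that sets_time pair_measureI[OF I0_sets, of UNIV borel] by auto
      then show ?thesis by (simp add: sets.Int_space_eq2)
    qed
    show "(\<lambda>((\<omega>, t), x). Z \<omega> t x) \<in> borel_measurable (restrict_space (\<P> \<Otimes>\<^sub>M borel) \<Omega>)"
      if "\<Omega> \<in> ?C" for \<Omega>
      using that on_I on_I0 by blast
  qed
  moreover have "represents_Z (space M) T \<Delta> S X Z z"
    using z Z by (auto simp: represents_Z_def)
  ultimately show ?thesis by (rule that)
qed

text \<open>Only on \<open>{D\<^sup>m\<^sup>a\<^sup>x < t}\<close> is the extended sequence a history, hence the restriction.\<close>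

lemma hist_append_measurable:
  "(\<lambda>(D, t, x). D(Suc n := (t, x))) \<in>
     restrict_space (hist_space T \<Delta> n \<Otimes>\<^sub>M time_space T \<Otimes>\<^sub>M borel) {(D, t, x). fst (D n) < t}
       \<rightarrow>\<^sub>M hist_space T \<Delta> (Suc n)" (is "?h \<in> ?R \<rightarrow>\<^sub>M _")
proof -
  have sp: "D \<in> hist_set T \<Delta> n \<and> t \<le> T \<and> fst (D n) < t" if "(D, t, x) \<in> space ?R" for D t x
    using that by (auto simp: space_restrict_space space_pair_measure space_hist_space)
  have fst_R: "fst \<in> ?R \<rightarrow>\<^sub>M (\<Pi>\<^sub>M j\<in>{..n}. borel \<Otimes>\<^sub>M borel)"
  proof (rule measurable_restrict_space1)
    have "fst \<in> hist_space T \<Delta> n \<Otimes>\<^sub>M time_space T \<Otimes>\<^sub>M (borel :: 'e measure) \<rightarrow>\<^sub>M hist_space T \<Delta> n"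
      by simp
    then show "fst \<in> hist_space T \<Delta> n \<Otimes>\<^sub>M time_space T \<Otimes>\<^sub>M (borel :: 'e measure) \<rightarrow>\<^sub>M (\<Pi>\<^sub>M j\<in>{..n}. borel \<Otimes>\<^sub>M borel)"
      unfolding hist_space_def measurable_restrict_space2_iff by blast
  qed
  have "(\<lambda>t. t) \<in> time_space T \<rightarrow>\<^sub>M borel"
    by (intro measurable_restrict_space1) simp
  note time = measurable_compose[OF measurable_compose[OF measurable_snd measurable_fst] this]
  have "(\<lambda>q. (fst (snd q), snd (snd q))) \<in> ?R \<rightarrow>\<^sub>M borel \<Otimes>\<^sub>M borel"
    by (rule measurable_restrict_space1, rule measurable_Pair[OF time]) simp
  then have snd_R: "snd \<in> ?R \<rightarrow>\<^sub>M borel \<Otimes>\<^sub>M borel"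
    by simp
  have "(\<lambda>q. (fst q)(Suc n := snd q)) \<in> ?R \<rightarrow>\<^sub>M (\<Pi>\<^sub>M j\<in>{..Suc n}. borel \<Otimes>\<^sub>M borel)"
    using fst_R snd_R by (intro measurable_fun_upd[where J = "{..n}"]) auto
  also have "(\<lambda>q. (fst q)(Suc n := snd q)) = ?h"
    by (simp add: fun_eq_iff)
  finally have "?h \<in> ?R \<rightarrow>\<^sub>M (\<Pi>\<^sub>M j\<in>{..Suc n}. borel \<Otimes>\<^sub>M borel)" .
  moreover have "?h \<in> space ?R \<rightarrow> hist_set T \<Delta> (Suc n)"
  proof
    fix q assume "q \<in> space ?R"
    moreover obtain D t x where q: "q = (D, t, x)" by (cases q)
    ultimately have "D \<in> hist_set T \<Delta> n" "t \<le> T" "fst (D n) < t" using sp by blast+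
    then show "?h q \<in> hist_set T \<Delta> (Suc n)" unfolding q by (simp add: hist_set_append)
  qed
  ultimately show ?thesis
    unfolding hist_space_def[of T \<Delta> "Suc n"] by (intro measurable_restrict_space2)
qed

lemma hist_fun_yhat:
  assumes "represents_Y (space M) T \<Delta> S X Y y"
  shows "hist_fun T \<Delta> n (yhat y n)"
proof -
  let ?N = "hist_space T \<Delta> n \<Otimes>\<^sub>M time_space T \<Otimes>\<^sub>M (borel :: 'e measure)"
  let ?A = "{q. fst (fst q n) < fst (snd q)}"
  have time: "(\<lambda>t. t) \<in> time_space T \<rightarrow>\<^sub>M borel"
    by (intro measurable_restrict_space1) simp
  have A: "?A \<inter> space ?N \<in> sets ?N"
  proof -
    have [measurable]: "(\<lambda>q. fst (fst q n)) \<in> borel_measurable ?N"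
      by (rule measurable_compose[OF measurable_fst last_time_measurable])
    have [measurable]: "(\<lambda>q. fst (snd q)) \<in> borel_measurable ?N"
      by (rule measurable_compose[OF measurable_compose[OF measurable_snd measurable_fst] time])
    have "{q \<in> space ?N. fst (fst q n) < fst (snd q)} \<in> sets ?N" by measurable
    then show ?thesis by (simp add: Int_def conj_commute)
  qed
  have "(\<lambda>q. (fst q)(Suc n := snd q)) \<in> restrict_space ?N ?A \<rightarrow>\<^sub>M hist_space T \<Delta> (Suc n)"
  proof -
    have *: "(\<lambda>q. (fst q)(Suc n := snd q)) = (\<lambda>(D, t, x). (D :: 'e hist)(Suc n := (t, x)))"
      "?A = {(D, t, x). fst (D n) < t}"
      by (auto simp: fun_eq_iff)
    show ?thesis unfolding * by (rule hist_append_measurable)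
  qed
  moreover have "(\<lambda>q. fst (snd q)) \<in> restrict_space ?N ?A \<rightarrow>\<^sub>M time_space T"
    by (intro measurable_restrict_space1) simp
  ultimately have "(\<lambda>q. ((fst q)(Suc n := snd q), fst (snd q))) \<in> restrict_space ?N ?A \<rightarrow>\<^sub>M
      hist_space T \<Delta> (Suc n) \<Otimes>\<^sub>M time_space T"
    by (rule measurable_Pair)
  moreover have "(\<lambda>(D, t). y (Suc n) D t) \<in> borel_measurable (hist_space T \<Delta> (Suc n) \<Otimes>\<^sub>M time_space T)"
    using assms by (simp add: represents_Y_def)
  ultimately have "(\<lambda>q. (\<lambda>(D, t). y (Suc n) D t) ((fst q)(Suc n := snd q), fst (snd q)))
      \<in> borel_measurable (restrict_space ?N ?A)"
    by (rule measurable_compose)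
  then have "(\<lambda>q. y (Suc n) ((fst q)(Suc n := snd q)) (fst (snd q))) \<in> borel_measurable (restrict_space ?N ?A)"
    by simp
  then have "(\<lambda>q. if q \<in> ?A then y (Suc n) ((fst q)(Suc n := snd q)) (fst (snd q)) else 0) \<in> borel_measurable ?N"
    using A by (subst measurable_If_restrict_space_iff) (auto simp: Int_def conj_commute)
  also have "(\<lambda>q. if q \<in> ?A then y (Suc n) ((fst q)(Suc n := snd q)) (fst (snd q)) else 0) =
      (\<lambda>(D, t, x). yhat y n D t x)"
    by (rule ext, rename_tac q, case_tac q) (simp add: yhat_def)
  finally show ?thesis
    using T_finite by (simp add: hist_fun_def yhat_def)
qed

lemma hist_fun_associated_z:
  assumes "represents_Y (space M) T \<Delta> S X Y y"
  shows "hist_fun T \<Delta> n (associated_z y n)"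
proof -
  let ?N = "hist_space T \<Delta> n \<Otimes>\<^sub>M time_space T \<Otimes>\<^sub>M (borel :: 'e measure)"
  have "(\<lambda>q. (fst q, fst (snd q))) \<in> ?N \<rightarrow>\<^sub>M hist_space T \<Delta> n \<Otimes>\<^sub>M time_space T"
    by simp
  moreover have "(\<lambda>(D, t). y n D t) \<in> borel_measurable (hist_space T \<Delta> n \<Otimes>\<^sub>M time_space T)"
    using assms by (simp add: represents_Y_def)
  ultimately have "(\<lambda>q. (\<lambda>(D, t). y n D t) (fst q, fst (snd q))) \<in> borel_measurable ?N"
    by (rule measurable_compose)
  then have "(\<lambda>q. y n (fst q) (fst (snd q))) \<in> borel_measurable ?N"
    by simp
  then show ?thesis
    using hist_fun_yhat[OF assms, of n] assms
    by (auto simp: hist_fun_def associated_z_def represents_Y_def case_prod_beta' yhat_def)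
qed

end

section \<open>Tail integrals and measures agreeing on a set\<close>

lemma at_left_nontrivial:
  fixes s :: "'a :: {dense_linorder, linorder_topology}"
  assumes "r < s" shows "at_left s \<noteq> bot"
proof
  assume "at_left s = bot"
  then have "eventually (\<lambda>_. False) (at_left s)" by simp
  then obtain b where "b < s" "\<And>y. b < y \<Longrightarrow> y < s \<Longrightarrow> False"
    unfolding eventually_at_left[OF assms] by blast
  then show False using dense[of b s] by blast
qed

lemma restrict_space_eqI:
  assumes sets: "sets M1 = sets M2" and J: "J \<in> sets M1"
    and agree: "\<And>C. C \<in> sets M1 \<Longrightarrow> C \<subseteq> J \<Longrightarrow> emeasure M1 C = emeasure M2 C"
  shows "restrict_space M1 J = restrict_space M2 J"
proof (rule measure_eqI)
  show "sets (restrict_space M1 J) = sets (restrict_space M2 J)"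
    using sets by (rule sets_restrict_space_cong)
  fix C assume "C \<in> sets (restrict_space M1 J)"
  then have C: "C \<in> sets M1" "C \<subseteq> J"
    using J by (auto simp: sets_restrict_space_iff)
  then show "emeasure (restrict_space M1 J) C = emeasure (restrict_space M2 J) C"
    using J sets agree by (simp add: emeasure_restrict_space)
qed

lemma set_integral_agree:
  fixes g :: "'a \<Rightarrow> real"
  assumes sets: "sets M1 = sets M2" and J: "J \<in> sets M1"
    and agree: "\<And>C. C \<in> sets M1 \<Longrightarrow> C \<subseteq> J \<Longrightarrow> emeasure M1 C = emeasure M2 C"
  shows "set_integrable M1 J g \<longleftrightarrow> set_integrable M2 J g"
    and "(LINT p:J|M1. g p) = (LINT p:J|M2. g p)"
proof -
  have eq: "restrict_space M1 J = restrict_space M2 J"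
    by (rule restrict_space_eqI[OF assms])
  have J2: "J \<in> sets M2" using J sets by simp
  show "set_integrable M1 J g \<longleftrightarrow> set_integrable M2 J g"
    using arg_cong[OF eq, of "\<lambda>N. integrable N g"] J J2
    by (simp add: integrable_restrict_space set_integrable_def)
  show "(LINT p:J|M1. g p) = (LINT p:J|M2. g p)"
    using arg_cong[OF eq, of "\<lambda>N. integral\<^sup>L N g"] J J2
    by (simp add: integral_restrict_space set_lebesgue_integral_def)
qed

lemma time_strip_sets:
  "B \<in> sets borel \<Longrightarrow> B \<times> UNIV \<in> sets (borel \<Otimes>\<^sub>M borel)"
  by (intro pair_measureI) auto

lemma tail_integral_right_limit:
  fixes N :: "(ennreal \<times> 'e::topological_space) measure" and g :: "_ \<Rightarrow> real"
  assumes sets: "sets N = sets (borel \<Otimes>\<^sub>M borel)"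
    and g: "set_integrable N ({0<..T} \<times> UNIV) g" and "t < T"
  shows "((\<lambda>r. LINT p:{r<..T} \<times> UNIV|N. g p) \<longlongrightarrow> (LINT p:{t<..T} \<times> UNIV|N. g p)) (at_right t)"
proof (rule tendsto_at_right_sequentially[OF \<open>t < T\<close>])
  fix r :: "nat \<Rightarrow> ennreal"
  assume r: "\<And>n. t < r n" "\<And>n. r n < T" "decseq r" "r \<longlonglongrightarrow> t"
  have eq: "(\<Union>i. {r i<..T} \<times> (UNIV :: 'e set)) = {t<..T} \<times> UNIV"
  proof -
    have "\<exists>i. r i < s" if "t < s" for s
      using order_tendstoD(2)[OF r(4) that] by (auto simp: eventually_sequentially)
    moreover have "t < s" if "r i < s" for s i
      using r(1)[of i] that by (rule less_trans)
    ultimately show ?thesis by fastforce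
  qed
  have "(\<lambda>i. LINT p:{r i<..T} \<times> UNIV|N. g p) \<longlonglongrightarrow> (LINT p:(\<Union>i. {r i<..T} \<times> UNIV)|N. g p)"
  proof (rule set_integral_cont_up)
    show "{r i<..T} \<times> UNIV \<in> sets N" for i unfolding sets by (rule time_strip_sets) simp
    show "incseq (\<lambda>i. {r i<..T} \<times> (UNIV :: 'e set))"
      using decseqD[OF r(3)] by (fastforce simp: incseq_def)
    show "set_integrable N (\<Union>i. {r i<..T} \<times> UNIV) g"
      unfolding eq by (rule set_integrable_subset[OF g]) (auto simp: sets time_strip_sets zero_less_iff_neq_zero)
  qed
  then show "(\<lambda>i. LINT p:{r i<..T} \<times> UNIV|N. g p) \<longlonglongrightarrow> (LINT p:{t<..T} \<times> UNIV|N. g p)"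
    unfolding eq .
qed

text \<open>The left limit is the integral over \<open>[t,T]\<close>, and \<open>t\<close> carries no mass.\<close>

lemma tail_integral_left_limit:
  fixes N :: "(ennreal \<times> 'e::topological_space) measure" and g :: "_ \<Rightarrow> real"
  assumes sets: "sets N = sets (borel \<Otimes>\<^sub>M borel)"
    and g: "set_integrable N ({0<..T} \<times> UNIV) g" and t: "0 < t" "t \<le> T"
    and atom: "emeasure N ({t} \<times> UNIV) = 0"
  shows "((\<lambda>r. LINT p:{r<..T} \<times> UNIV|N. g p) \<longlongrightarrow> (LINT p:{t<..T} \<times> UNIV|N. g p)) (at_left t)"
proof (rule tendsto_at_left_sequentially[OF \<open>0 < t\<close>])
  fix r :: "nat \<Rightarrow> ennreal"
  assume r: "\<And>n. r n < t" "\<And>n. 0 < r n" "incseq r" "r \<longlonglongrightarrow> t"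
  have strip: "B \<times> UNIV \<in> sets N" if "B \<in> sets borel" for B
    unfolding sets using that by (rule time_strip_sets)
  have int: "set_integrable N (B \<times> UNIV) g" if "B \<in> sets borel" "B \<subseteq> {0<..T}" for B
    using that by (intro set_integrable_subset[OF g] strip) auto
  have eq: "(\<Inter>i. {r i<..T} \<times> (UNIV :: 'e set)) = {t..T} \<times> UNIV"
  proof -
    have "t \<le> s" if "\<And>i. r i < s" for s
      using LIMSEQ_le_const2[OF r(4), of s] that by (auto intro: less_imp_le)
    moreover have "r i < s" if "t \<le> s" for s i
      using r(1)[of i] that by (rule less_le_trans)
    ultimately show ?thesis by auto
  qed
  have "(\<lambda>i. LINT p:{r i<..T} \<times> UNIV|N. g p) \<longlonglongrightarrow> (LINT p:(\<Inter>i. {r i<..T} \<times> UNIV)|N. g p)"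
  proof (rule set_integral_cont_down)
    show "{r i<..T} \<times> UNIV \<in> sets N" for i by (rule strip) simp
    show "decseq (\<lambda>i. {r i<..T} \<times> (UNIV :: 'e set))"
      using incseqD[OF r(3)] by (fastforce simp: decseq_def)
    show "set_integrable N ({r 0<..T} \<times> UNIV) g"
      using r(2)[of 0] by (intro int) (auto intro: less_trans)
  qed
  also have "(LINT p:(\<Inter>i. {r i<..T} \<times> UNIV)|N. g p) = (LINT p:{t<..T} \<times> UNIV|N. g p)"
    unfolding eq
  proof (rule set_integral_cong_set)
    have "{t} \<times> UNIV \<in> null_sets N"
      using atom strip[of "{t}"] by auto
    from AE_not_in[OF this] show "AE p in N. p \<in> {t<..T} \<times> UNIV \<longleftrightarrow> p \<in> {t..T} \<times> (UNIV :: 'e set)"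
      by eventually_elim auto
    show "set_borel_measurable N ({t<..T} \<times> UNIV) g" "set_borel_measurable N ({t..T} \<times> UNIV) g"
      using int[of "{t<..T}"] int[of "{t..T}"] t
      by (auto simp: set_integrable_def set_borel_measurable_def subset_iff intro: less_trans less_le_trans)
  qed
  finally show "(\<lambda>i. LINT p:{r i<..T} \<times> UNIV|N. g p) \<longlonglongrightarrow> (LINT p:{t<..T} \<times> UNIV|N. g p)" .
qed

section \<open>The kernels on histories and the compensator\<close>

context disintegrated_point_process
begin

abbreviation \<nu>h :: "nat \<Rightarrow> 'e hist \<Rightarrow> (ennreal \<times> 'e) measure" where
  "\<nu>h \<equiv> nu_hist T G"

lemma G_prob_sets:
  assumes "D \<in> hist_set T \<Delta> n"
  shows "prob_space (G n D)" "sets (G n D) = sets (borel \<Otimes>\<^sub>M borel)"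
  using measurable_space[OF G_kernel, of D n] assms
  by (auto simp: space_hist_space space_prob_algebra)

lemma G_subprob: "G n \<in> hist_space T \<Delta> n \<rightarrow>\<^sub>M subprob_algebra (borel \<Otimes>\<^sub>M borel)"
  by (rule measurable_prob_algebraD[OF G_kernel])

lemma surv_jointly_measurable:
  "(\<lambda>q. surv (G n (fst q)) (snd q)) \<in> borel_measurable (hist_space T \<Delta> n \<Otimes>\<^sub>M borel)"
  unfolding surv_def
proof (rule emeasure_measurable_subprob_algebra2)
  let ?N = "hist_space T \<Delta> n \<Otimes>\<^sub>M (borel :: ennreal measure)"
  show "(\<lambda>q. G n (fst q)) \<in> ?N \<rightarrow>\<^sub>M subprob_algebra (borel \<Otimes>\<^sub>M borel)"
    by (rule measurable_compose[OF measurable_fst G_subprob])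
  have "{q \<in> space (?N \<Otimes>\<^sub>M (borel \<Otimes>\<^sub>M (borel :: 'e measure))). snd (fst q) < fst (snd q)}
      \<in> sets (?N \<Otimes>\<^sub>M (borel \<Otimes>\<^sub>M borel))"
    by measurable
  also have "{q \<in> space (?N \<Otimes>\<^sub>M (borel \<Otimes>\<^sub>M (borel :: 'e measure))). snd (fst q) < fst (snd q)} =
      (SIGMA q:space ?N. {snd q<..} \<times> UNIV)"
    by (auto simp: space_pair_measure)
  finally show "(SIGMA q:space ?N. {snd q<..} \<times> (UNIV :: 'e set)) \<in> sets (?N \<Otimes>\<^sub>M (borel \<Otimes>\<^sub>M borel))" .
qed

lemma surv_measurable:
  assumes "D \<in> hist_set T \<Delta> n" shows "surv (G n D) \<in> borel_measurable borel"
  using measurable_Pair2[OF surv_jointly_measurable, of D n] assms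
  by (simp add: space_hist_space)

lemma weight_measurable:
  assumes "D \<in> hist_set T \<Delta> n"
  shows "(\<lambda>(t, x). indicator {0..T} t / surv (G n D) t) \<in> borel_measurable (G n D)"
proof -
  have [measurable]: "surv (G n D) \<in> borel_measurable borel" by (rule surv_measurable[OF assms])
  show ?thesis by (simp cong: measurable_cong_sets add: G_prob_sets[OF assms] case_prod_beta')
qed

lemma sets_nu_hist:
  assumes "D \<in> hist_set T \<Delta> n" shows "sets (\<nu>h n D) = sets (borel \<Otimes>\<^sub>M borel)"
  using G_prob_sets[OF assms] by (simp add: nu_hist_def)

lemma nu_hist_null:
  assumes "D \<in> hist_set T \<Delta> n" "C \<in> sets (borel \<Otimes>\<^sub>M borel)" "emeasure (G n D) C = 0"
  shows "emeasure (\<nu>h n D) C = 0"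
proof -
  have "C \<in> null_sets (G n D)" using assms G_prob_sets by auto
  from AE_not_in[OF this] have "C \<in> null_sets (\<nu>h n D)"
    unfolding nu_hist_def null_sets_density_iff[OF weight_measurable[OF assms(1)]]
    using assms(2) G_prob_sets[OF assms(1)] by auto
  then show ?thesis by auto
qed

lemma G_time_split:
  assumes "D \<in> hist_set T \<Delta> n" "r \<le> s"
  shows "surv (G n D) r = emeasure (G n D) ({r<..s} \<times> UNIV) + surv (G n D) s"
proof -
  have "{r<..} \<times> (UNIV :: 'e set) = {r<..s} \<times> UNIV \<union> {s<..} \<times> UNIV"
    using assms(2) by auto
  then show ?thesis
    unfolding surv_def using G_prob_sets(2)[OF assms(1)]
    by (subst plus_emeasure) (auto simp: time_strip_sets)
qed

lemma surv_finite:
  assumes "D \<in> hist_set T \<Delta> n" shows "surv (G n D) r \<noteq> \<infinity>"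
proof -
  interpret N: prob_space "G n D" by (rule G_prob_sets[OF assms])
  show ?thesis by (simp add: surv_def N.emeasure_eq_measure)
qed

text \<open>An atom of \<open>\<nu>h n D\<close> at time \<open>s\<close> is one of \<open>G n D\<close>, and would be a jump of the survival
  function.\<close>

lemma nu_hist_no_atom:
  assumes D: "D \<in> hist_set T \<Delta> n" and s: "0 < s" "s \<le> T"
  shows "emeasure (\<nu>h n D) ({s} \<times> UNIV) = 0"
proof (rule nu_hist_null[OF D])
  show "{s} \<times> UNIV \<in> sets (borel \<Otimes>\<^sub>M borel)" by (rule time_strip_sets) simp
  let ?a = "emeasure (G n D) ({s} \<times> UNIV)" and ?g = "surv (G n D)"
  \<comment> \<open>the mass of \<open>(r,s]\<close>, which bounds that of the atom, tends to \<open>0\<close> as \<open>r\<close> increases to \<open>s\<close>\<close>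
  have le: "?a + ?g s \<le> ?g r" if "r < s" for r
  proof -
    have "?a \<le> emeasure (G n D) ({r<..s} \<times> UNIV)"
      using that G_prob_sets[OF D] by (intro emeasure_mono) (auto intro: time_strip_sets)
    then show ?thesis using G_time_split[OF D, of r s] that by (simp add: add_right_mono)
  qed
  obtain r where r: "\<And>i. r i < s" "r \<longlonglongrightarrow> s"
    using approx_from_below_dense_linorder[OF s(1)] by auto
  have "s < \<infinity>" using s T_finite by auto
  have "(\<lambda>i. ?g (r i)) \<longlonglongrightarrow> ?g s"
    using continuous_on_tendsto_compose[OF surv_continuous[OF D] r(2)] r(1) \<open>s < \<infinity>\<close>
    by (force simp: eventually_sequentially intro: less_trans)
  then have "?a + ?g s \<le> ?g s"
    by (rule LIMSEQ_le_const) (use le r(1) in auto)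
  then have "?g s + ?a \<le> ?g s + 0" by (simp add: add.commute)
  then show "?a = 0"
    using surv_finite[OF D, of s] unfolding ennreal_add_left_cancel_le by simp
qed

text \<open>The survival function is still \<open>1\<close> at \<open>D\<^sup>m\<^sup>a\<^sup>x\<close>: the next point comes strictly later.\<close>

lemma nu_hist_null_past:
  assumes D: "D \<in> hist_set T \<Delta> n" "fst (D n) < \<infinity>"
  shows "emeasure (\<nu>h n D) ({..fst (D n)} \<times> UNIV) = 0"
proof (rule nu_hist_null[OF D(1)])
  let ?d = "fst (D n)"
  show "{..?d} \<times> UNIV \<in> sets (borel \<Otimes>\<^sub>M borel)" by (rule time_strip_sets) simp
  interpret N: prob_space "G n D" by (rule G_prob_sets[OF D(1)])
  have "space (G n D) = {..?d} \<times> UNIV \<union> {?d<..} \<times> UNIV"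
    using sets_eq_imp_space_eq[OF G_prob_sets(2)[OF D(1)]] by (auto simp: space_pair_measure)
  then have "1 = emeasure (G n D) ({..?d} \<times> UNIV) + surv (G n D) ?d"
    unfolding surv_def N.emeasure_space_1[symmetric] using G_prob_sets(2)[OF D(1)]
    by (subst plus_emeasure) (auto simp: time_strip_sets)
  then show "emeasure (G n D) ({..?d} \<times> UNIV) = 0"
    using surv_last[OF D] by simp
qed

text \<open>The history is taken as a function \<open>\<theta>\<close> of a further variable because this is needed both for
  \<open>\<theta> = H n\<close> on \<open>M\<close> and for the identity on \<open>hist_space T \<Delta> n\<close>.\<close>

lemma nn_integral_nu_hist_measurable:
  assumes \<theta>: "\<theta> \<in> N \<rightarrow>\<^sub>M hist_space T \<Delta> n"
    and h: "(\<lambda>q. h (fst q) (snd q)) \<in> borel_measurable (N \<Otimes>\<^sub>M (borel \<Otimes>\<^sub>M borel))"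
  shows "(\<lambda>w. \<integral>\<^sup>+p. h w p \<partial>\<nu>h n (\<theta> w)) \<in> borel_measurable N"
proof -
  let ?B = "borel \<Otimes>\<^sub>M borel :: (ennreal \<times> 'e) measure"
  let ?k = "\<lambda>w p. indicator {0..T} (fst p) / surv (G n (\<theta> w)) (fst p) * h w p"
  have "(\<lambda>q. (\<theta> (fst q), fst (snd q))) \<in> N \<Otimes>\<^sub>M ?B \<rightarrow>\<^sub>M hist_space T \<Delta> n \<Otimes>\<^sub>M borel"
    by (intro measurable_Pair measurable_compose[OF measurable_fst \<theta>]) simp
  from measurable_compose[OF this surv_jointly_measurable]
  have [measurable]: "(\<lambda>q. surv (G n (\<theta> (fst q))) (fst (snd q))) \<in> borel_measurable (N \<Otimes>\<^sub>M ?B)"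
    by simp
  note h[measurable]
  have "(\<lambda>q. ?k (fst q) (snd q)) \<in> borel_measurable (N \<Otimes>\<^sub>M ?B)"
    by measurable
  then have "(\<lambda>w. \<integral>\<^sup>+p. ?k w p \<partial>G n (\<theta> w)) \<in> borel_measurable N"
    by (intro nn_integral_measurable_subprob_algebra2[where N = ?B] measurable_compose[OF \<theta> G_subprob])
       (simp add: case_prod_beta')
  then show ?thesis
  proof (rule measurable_cong[THEN iffD1, rotated])
    fix w assume w: "w \<in> space N"
    then have D: "\<theta> w \<in> hist_set T \<Delta> n"
      using measurable_space[OF \<theta>] by (simp add: space_hist_space)
    have "h w \<in> borel_measurable (G n (\<theta> w))"
      using measurable_Pair2[OF h w] by (simp cong: measurable_cong_sets add: G_prob_sets[OF D])
    then show "(\<integral>\<^sup>+p. ?k w p \<partial>G n (\<theta> w)) = (\<integral>\<^sup>+p. h w p \<partial>\<nu>h n (\<theta> w))"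
      unfolding nu_hist_def
      by (subst nn_integral_density[OF weight_measurable[OF D]]) (auto simp: case_prod_beta')
  qed
qed

lemma integrable_nu_hist_measurable:
  assumes \<theta>: "\<theta> \<in> N \<rightarrow>\<^sub>M hist_space T \<Delta> n"
    and h: "(\<lambda>q. h (fst q) (snd q) :: real) \<in> borel_measurable (N \<Otimes>\<^sub>M (borel \<Otimes>\<^sub>M borel))"
  shows "Measurable.pred N (\<lambda>w. integrable (\<nu>h n (\<theta> w)) (h w))"
proof -
  have "(\<lambda>w. \<integral>\<^sup>+p. ennreal (norm (h w p)) \<partial>\<nu>h n (\<theta> w)) \<in> borel_measurable N"
    using h by (intro nn_integral_nu_hist_measurable[OF \<theta>]) simp
  then have "Measurable.pred N (\<lambda>w. (\<integral>\<^sup>+p. ennreal (norm (h w p)) \<partial>\<nu>h n (\<theta> w)) < \<infinity>)"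
    by simp
  then show ?thesis
  proof (rule measurable_cong[THEN iffD1, rotated])
    fix w assume w: "w \<in> space N"
    then have D: "\<theta> w \<in> hist_set T \<Delta> n"
      using measurable_space[OF \<theta>] by (simp add: space_hist_space)
    have "h w \<in> borel_measurable (\<nu>h n (\<theta> w))"
      using measurable_Pair2[OF h w] by (simp cong: measurable_cong_sets add: sets_nu_hist[OF D])
    then show "((\<integral>\<^sup>+p. ennreal (norm (h w p)) \<partial>\<nu>h n (\<theta> w)) < \<infinity>) = integrable (\<nu>h n (\<theta> w)) (h w)"
      by (simp add: integrable_iff_bounded)
  qed
qed

lemma integral_nu_hist_measurable:
  assumes \<theta>: "\<theta> \<in> N \<rightarrow>\<^sub>M hist_space T \<Delta> n"
    and h: "(\<lambda>q. h (fst q) (snd q) :: real) \<in> borel_measurable (N \<Otimes>\<^sub>M (borel \<Otimes>\<^sub>M borel))"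
  shows "(\<lambda>w. \<integral>p. h w p \<partial>\<nu>h n (\<theta> w)) \<in> borel_measurable N"
proof -
  have [measurable]: "(\<lambda>w. \<integral>\<^sup>+p. ennreal (h w p) \<partial>\<nu>h n (\<theta> w)) \<in> borel_measurable N"
    "(\<lambda>w. \<integral>\<^sup>+p. ennreal (- h w p) \<partial>\<nu>h n (\<theta> w)) \<in> borel_measurable N"
    using h by (auto intro!: nn_integral_nu_hist_measurable[OF \<theta>])
  note [measurable] = integrable_nu_hist_measurable[OF assms]
  have "(\<lambda>w. \<integral>p. h w p \<partial>\<nu>h n (\<theta> w)) =
      (\<lambda>w. if integrable (\<nu>h n (\<theta> w)) (h w)
           then enn2real (\<integral>\<^sup>+p. ennreal (h w p) \<partial>\<nu>h n (\<theta> w)) - enn2real (\<integral>\<^sup>+p. ennreal (- h w p) \<partial>\<nu>h n (\<theta> w))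
           else 0)"
    by (auto simp: fun_eq_iff real_lebesgue_integral_def not_integrable_integral_eq)
  also have "\<dots> \<in> borel_measurable N" by measurable
  finally show ?thesis .
qed

text \<open>The exceptional null set of \<open>\<nu>_hist\<close> is fixed once and for all, so that the arguments at a given
  \<open>\<omega>\<close> are free of null sets in \<open>\<omega>\<close>.\<close>

definition regular :: "'w \<Rightarrow> bool" where
  "regular \<omega> \<longleftrightarrow> \<omega> \<in> space M \<and>
     (\<forall>C\<in>sets (borel \<Otimes>\<^sub>M borel). emeasure (\<nu> \<omega>) C =
        (\<Sum>n. emeasure (\<nu>h n (H n \<omega>)) (C \<inter> {S n \<omega><..min (S (Suc n) \<omega>) T} \<times> UNIV)))"

lemma AE_regular: "AE \<omega> in M. regular \<omega>"
  using \<nu>_hist AE_space by eventually_elim (simp add: regular_def)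

lemma \<nu>_on_interval:
  assumes \<omega>: "regular \<omega>" and C: "C \<in> sets (borel \<Otimes>\<^sub>M borel)"
    and sub: "C \<subseteq> {S n \<omega><..min (S (Suc n) \<omega>) T} \<times> UNIV"
  shows "emeasure (\<nu> \<omega>) C = emeasure (\<nu>h n (H n \<omega>)) C"
proof -
  let ?e = "\<lambda>m. emeasure (\<nu>h m (H m \<omega>)) (C \<inter> {S m \<omega><..min (S (Suc m) \<omega>) T} \<times> UNIV)"
  have sp: "\<omega> \<in> space M" using \<omega> by (simp add: regular_def)
  have "?e m = 0" if "m \<noteq> n" for m
  proof -
    have "C \<inter> {S m \<omega><..min (S (Suc m) \<omega>) T} \<times> UNIV = {}"
    proof (rule equals0I)
      fix p assume p: "p \<in> C \<inter> {S m \<omega><..min (S (Suc m) \<omega>) T} \<times> UNIV"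
      then have "p \<in> {S n \<omega><..min (S (Suc n) \<omega>) T} \<times> UNIV" using sub by blast
      then have "S n \<omega> < fst p" "fst p \<le> S (Suc n) \<omega>" by auto
      moreover have "S m \<omega> < fst p" "fst p \<le> S (Suc m) \<omega>" using p by auto
      ultimately show False using interval_unique[OF sp, of m "fst p" n] that by simp
    qed
    then show ?thesis by simp
  qed
  then have "(\<Sum>m. ?e m) = (\<Sum>m\<in>{n}. ?e m)"
    by (intro suminf_finite) auto
  also have "\<dots> = emeasure (\<nu>h n (H n \<omega>)) C"
    using sub by (simp add: Int_absorb2)
  finally show ?thesis using \<omega> C by (simp add: regular_def)
qed

lemma \<nu>_no_atom:
  assumes \<omega>: "regular \<omega>" and s: "0 < s" "s \<le> T"
  shows "emeasure (\<nu> \<omega>) ({s} \<times> UNIV) = 0"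
proof -
  have sp: "\<omega> \<in> space M" using \<omega> by (simp add: regular_def)
  obtain n where n: "S n \<omega> < s" "s \<le> S (Suc n) \<omega>" using ex_interval[OF sp s] by blast
  have "emeasure (\<nu> \<omega>) ({s} \<times> UNIV) = emeasure (\<nu>h n (H n \<omega>)) ({s} \<times> UNIV)"
    using n s by (intro \<nu>_on_interval[OF \<omega>] time_strip_sets) auto
  then show ?thesis
    using nu_hist_no_atom[OF history_in_hist_set[OF sp] s] by simp
qed

lemma \<nu>_set_integral_on_interval:
  fixes g :: "ennreal \<times> 'e \<Rightarrow> real"
  assumes \<omega>: "regular \<omega>" and B: "B \<in> sets borel" "B \<subseteq> {S n \<omega><..min (S (Suc n) \<omega>) T}"
  shows "set_integrable (\<nu> \<omega>) (B \<times> UNIV) g \<longleftrightarrow> set_integrable (\<nu>h n (H n \<omega>)) (B \<times> UNIV) g"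
    and "(LINT p:B \<times> UNIV|\<nu> \<omega>. g p) = (LINT p:B \<times> UNIV|\<nu>h n (H n \<omega>). g p)"
proof -
  have sp: "\<omega> \<in> space M" using \<omega> by (simp add: regular_def)
  have sets: "sets (\<nu> \<omega>) = sets (\<nu>h n (H n \<omega>))"
    using \<nu>_sets[OF sp] sets_nu_hist[OF history_in_hist_set[OF sp]] by simp
  have J: "B \<times> UNIV \<in> sets (\<nu> \<omega>)"
    unfolding \<nu>_sets[OF sp] using B(1) by (rule time_strip_sets)
  have agree: "emeasure (\<nu> \<omega>) C = emeasure (\<nu>h n (H n \<omega>)) C"
    if "C \<in> sets (\<nu> \<omega>)" "C \<subseteq> B \<times> UNIV" for C
    using that B(2) \<nu>_sets[OF sp] by (intro \<nu>_on_interval[OF \<omega>]) auto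
  show "set_integrable (\<nu> \<omega>) (B \<times> UNIV) g \<longleftrightarrow> set_integrable (\<nu>h n (H n \<omega>)) (B \<times> UNIV) g"
    "(LINT p:B \<times> UNIV|\<nu> \<omega>. g p) = (LINT p:B \<times> UNIV|\<nu>h n (H n \<omega>). g p)"
    by (rule set_integral_agree[OF sets J agree]; assumption)+
qed

end

section \<open>From the pathwise equations to the BSDE\<close>

locale represented_process = bsde_setting M T \<Delta> S X F A \<phi> \<nu> G \<xi> u f fr
  for M :: "'w measure" and T :: ennreal and \<Delta> :: "'e::topological_space"
    and S :: "nat \<Rightarrow> 'w \<Rightarrow> ennreal" and X :: "nat \<Rightarrow> 'w \<Rightarrow> 'e" and F :: "ennreal \<Rightarrow> 'w measure"
    and A :: "ennreal \<Rightarrow> 'w \<Rightarrow> real" and \<phi> :: "'w \<times> ennreal \<Rightarrow> 'e measure"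
    and \<nu> :: "'w \<Rightarrow> (ennreal \<times> 'e) measure"
    and G :: "nat \<Rightarrow> 'e hist \<Rightarrow> (ennreal \<times> 'e) measure"
    and \<xi> :: "'w \<Rightarrow> real" and u :: "nat \<Rightarrow> 'e hist \<Rightarrow> real"
    and f :: "'w \<Rightarrow> ennreal \<Rightarrow> 'e \<Rightarrow> real \<Rightarrow> ('e \<Rightarrow> real) \<Rightarrow> real"
    and fr :: "nat \<Rightarrow> ('e hist \<Rightarrow> ennreal \<Rightarrow> 'e \<Rightarrow> real) \<Rightarrow>
               'e hist \<Rightarrow> ennreal \<Rightarrow> 'e \<Rightarrow> real \<Rightarrow> real \<Rightarrow> real" +
  fixes Y :: "ennreal \<Rightarrow> 'w \<Rightarrow> real" and y :: "nat \<Rightarrow> 'e hist \<Rightarrow> ennreal \<Rightarrow> real"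
  assumes Y_repr: "represents_Y (space M) T \<Delta> S X Y y"
begin

lemma y_at_infinity:
  "D \<in> hist_set T \<Delta> n \<Longrightarrow> fst (D n) = \<infinity> \<Longrightarrow> t \<le> T \<Longrightarrow> y n D t = 0"
  using Y_repr unfolding represents_Y_def by (metis atLeastAtMost_iff zero_le)

lemma y_continuous: "D \<in> hist_set T \<Delta> n \<Longrightarrow> continuous_on {0..T} (y n D)"
  using Y_repr unfolding represents_Y_def by blast

lemma y_constant:
  assumes "D \<in> hist_set T \<Delta> n" "t \<le> T" "t \<le> fst (D n)"
  shows "y n D t = y n D 0"
proof -
  have "\<forall>t\<in>{0..min T (fst (D n))}. y n D t = y n D 0"
    using Y_repr assms(1) unfolding represents_Y_def by blast
  then show ?thesis by (rule bspec) (use assms in simp)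
qed

lemma y_measurable: "(\<lambda>q. y n (fst q) (snd q)) \<in> borel_measurable (hist_space T \<Delta> n \<Otimes>\<^sub>M time_space T)"
  using Y_repr unfolding represents_Y_def case_prod_beta' by blast

lemma Y_eq_y:
  "\<omega> \<in> space M \<Longrightarrow> S n \<omega> \<le> t \<Longrightarrow> t < S (Suc n) \<omega> \<Longrightarrow> t \<le> T \<Longrightarrow> Y t \<omega> = y n (H n \<omega>) t"
  using Y_repr unfolding represents_Y_def by (metis atLeastAtMost_iff zero_le)

lemma y_left_limit:
  assumes "D \<in> hist_set T \<Delta> n" "s \<le> T"
  shows "(y n D \<longlongrightarrow> y n D s) (at_left s)"
proof -
  have "(y n D \<longlongrightarrow> y n D s) (at s within {0..T})"
    using y_continuous[OF assms(1)] assms(2) by (simp add: continuous_on)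
  then show ?thesis
    by (rule tendsto_within_subset) (use assms(2) in auto)
qed

lemma Y_left_limit:
  assumes \<omega>: "\<omega> \<in> space M" and s: "S n \<omega> < s" "s \<le> S (Suc n) \<omega>" "s \<le> T"
  shows "((\<lambda>r. Y r \<omega>) \<longlongrightarrow> y n (H n \<omega>) s) (at_left s)"
proof -
  have "eventually (\<lambda>r. y n (H n \<omega>) r = Y r \<omega>) (at_left s)"
    unfolding eventually_at_left[OF s(1)]
  proof (intro exI[of _ "S n \<omega>"] conjI s(1) allI impI)
    fix r assume "S n \<omega> < r" "r < s"
    then show "y n (H n \<omega>) r = Y r \<omega>"
      using s by (intro Y_eq_y[OF \<omega>, symmetric]) auto
  qed
  with y_left_limit[OF history_in_hist_set[OF \<omega>] s(3)] show ?thesis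
    by (rule Lim_transform_eventually)
qed

lemma Lim_Y_left:
  assumes "\<omega> \<in> space M" "S n \<omega> < s" "s \<le> S (Suc n) \<omega>" "s \<le> T"
  shows "Lim (at_left s) (\<lambda>r. Y r \<omega>) = y n (H n \<omega>) s"
  using at_left_nontrivial[OF assms(2)] Y_left_limit[OF assms] by (rule tendsto_Lim)

text \<open>Both integrands are taken as functions of the pair \<open>p = (s, x)\<close>: \<open>driver\<close> that of the pathwise
  equation, \<open>bsde_driver\<close> that of the BSDE. The equations are restated with them, and the BSDE
  for a single \<open>\<omega>\<close>.\<close>

definition driver :: "nat \<Rightarrow> 'e hist \<Rightarrow> ennreal \<times> 'e \<Rightarrow> real" where
  "driver n D p = fr n (yhat y n) D (fst p) (snd p) (y n D (fst p)) (- y n D (fst p))"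

definition bsde_driver :: "('w \<Rightarrow> ennreal \<Rightarrow> 'e \<Rightarrow> real) \<Rightarrow> 'w \<Rightarrow> ennreal \<times> 'e \<Rightarrow> real" where
  "bsde_driver Z \<omega> p = f \<omega> (fst p) (snd p) (Lim (at_left (fst p)) (\<lambda>r. Y r \<omega>)) (Z \<omega> (fst p))"

definition bsde_at :: "('w \<Rightarrow> ennreal \<Rightarrow> 'e \<Rightarrow> real) \<Rightarrow> 'w \<Rightarrow> bool" where
  "bsde_at Z \<omega> \<longleftrightarrow> set_integrable (\<nu> \<omega>) ({0<..T} \<times> UNIV) (bsde_driver Z \<omega>) \<and>
     (\<forall>t\<in>{0..T}. Y t \<omega> + (LINT p:{t<..T} \<times> UNIV|jump_measure T S X \<omega>. Z \<omega> (fst p) (snd p)) =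
        \<xi> \<omega> + (LINT p:{t<..T} \<times> UNIV|\<nu> \<omega>. bsde_driver Z \<omega> p))"

lemma bsde_equation_iff: "bsde_equation M T S X \<nu> \<xi> f Y Z \<longleftrightarrow> (AE \<omega> in M. bsde_at Z \<omega>)"
  by (simp add: bsde_equation_def bsde_at_def bsde_driver_def[abs_def] case_prod_beta')

abbreviation pathwise :: "nat \<Rightarrow> 'e hist \<Rightarrow> bool" where
  "pathwise \<equiv> pathwise_equation T G u fr y"

lemma pathwise_iff:
  "pathwise n D \<longleftrightarrow> set_integrable (\<nu>h n D) ({0<..T} \<times> UNIV) (driver n D) \<and>
     (\<forall>t\<in>{0..T}. y n D t = u n D + (LINT p:{t<..T} \<times> UNIV|\<nu>h n D. driver n D p))"
  by (simp add: pathwise_equation_def driver_def[abs_def] case_prod_beta')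

lemma hist_fun_yhat_y: "hist_fun T \<Delta> n (yhat y n)"
  using Y_repr by (rule hist_fun_yhat)

lemma driver_measurable:
  "(\<lambda>q. driver n (fst q) (min (fst (snd q)) T, snd (snd q))) \<in>
     borel_measurable (hist_space T \<Delta> n \<Otimes>\<^sub>M (borel \<Otimes>\<^sub>M borel))"
proof -
  let ?N = "hist_space T \<Delta> n \<Otimes>\<^sub>M ((borel :: ennreal measure) \<Otimes>\<^sub>M (borel :: 'e measure))"
  have time: "(\<lambda>q. min (fst (snd q)) T) \<in> ?N \<rightarrow>\<^sub>M time_space T"
    by measurable
  have "(\<lambda>q. (fst q, min (fst (snd q)) T)) \<in> ?N \<rightarrow>\<^sub>M hist_space T \<Delta> n \<Otimes>\<^sub>M time_space T"
    using time by (intro measurable_Pair) auto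
  from measurable_compose[OF this y_measurable]
  have y: "(\<lambda>q. y n (fst q) (min (fst (snd q)) T)) \<in> borel_measurable ?N" by simp
  have "(\<lambda>q. (fst q, min (fst (snd q)) T, snd (snd q), y n (fst q) (min (fst (snd q)) T),
        - y n (fst q) (min (fst (snd q)) T))) \<in>
      ?N \<rightarrow>\<^sub>M hist_space T \<Delta> n \<Otimes>\<^sub>M time_space T \<Otimes>\<^sub>M borel \<Otimes>\<^sub>M borel \<Otimes>\<^sub>M borel"
    using time y by (intro measurable_Pair) auto
  from measurable_compose[OF this fr_measurable[OF hist_fun_yhat_y]]
  show ?thesis by (simp add: driver_def)
qed

lemma driver_section_measurable:
  assumes "D \<in> hist_set T \<Delta> n"
  shows "(\<lambda>p. driver n D (min (fst p) T, snd p)) \<in> borel_measurable (borel \<Otimes>\<^sub>M borel)"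
  using measurable_Pair2[OF driver_measurable, of D n] assms
  by (simp add: space_hist_space)

abbreviation representing :: "('w \<Rightarrow> ennreal \<Rightarrow> 'e \<Rightarrow> real) \<Rightarrow> bool" where
  "representing Z \<equiv> represents_Z (space M) T \<Delta> S X Z (associated_z y)"

lemma representing_eq:
  "representing Z \<Longrightarrow> \<omega> \<in> space M \<Longrightarrow> S n \<omega> < t \<Longrightarrow> t \<le> S (Suc n) \<omega> \<Longrightarrow> t \<le> T \<Longrightarrow>
    Z \<omega> t x = yhat y n (H n \<omega>) t x - y n (H n \<omega>) t"
  by (simp add: represents_Z_def associated_z_def)

text \<open>On \<open>(S n, S (n + 1)]\<close> the left limit of \<open>Y\<close> is \<open>y n\<close>, and \<open>Z\<close> is \<open>w + yhat y n\<close> for the constant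
  \<open>w = - y n\<close> in the mark: this is the form of \<open>\<zeta>\<close> for which \<open>fr\<close> expresses the generator.\<close>

lemma bsde_driver_eq_driver:
  assumes Z: "representing Z" and \<omega>: "\<omega> \<in> space M"
    and t: "S n \<omega> < fst p" "fst p \<le> S (Suc n) \<omega>" "fst p \<le> T"
  shows "bsde_driver Z \<omega> p = driver n (H n \<omega>) p"
proof -
  have Z_eq: "Z \<omega> (fst p) = (\<lambda>x. - y n (H n \<omega>) (fst p) + yhat y n (H n \<omega>) (fst p) x)"
    using representing_eq[OF Z \<omega> t] by (simp add: fun_eq_iff)
  show ?thesis
    unfolding bsde_driver_def driver_def Lim_Y_left[OF \<omega> t] Z_eq
    by (rule fr_repr[OF hist_fun_yhat_y \<omega> t])
qed

text \<open>Since \<open>y n\<close> is continuous, its value at \<open>S (n + 1)\<close> is the left limit of \<open>Y\<close> there: the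
  associated \<open>Z\<close>, evaluated at a point of the process, is the jump of \<open>Y\<close>.\<close>

lemma representing_at_jump:
  assumes Z: "representing Z" and \<omega>: "\<omega> \<in> space M" and n: "S (Suc n) \<omega> \<le> T"
  shows "Z \<omega> (S (Suc n) \<omega>) (X (Suc n) \<omega>) = Y (S (Suc n) \<omega>) \<omega> - y n (H n \<omega>) (S (Suc n) \<omega>)"
proof -
  have lt: "S n \<omega> < S (Suc n) \<omega>"
    using n S_mono[OF \<omega>, of n] by (intro S_strict[OF \<omega>]) (rule order_trans)
  have "Y (S (Suc n) \<omega>) \<omega> = y (Suc n) (H (Suc n) \<omega>) (S (Suc n) \<omega>)"
    using n by (intro Y_eq_y[OF \<omega>] S_strict[OF \<omega>]) auto
  then show ?thesis
    using representing_eq[OF Z \<omega> lt order_refl n] lt by (simp add: yhat_def history_Suc)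
qed

definition jumps_after :: "'w \<Rightarrow> ennreal \<Rightarrow> nat set" where
  "jumps_after \<omega> t = {k. t < S k \<omega> \<and> S k \<omega> \<le> T}"

lemma finite_jumps:
  assumes "\<omega> \<in> space M" shows "finite {k. S k \<omega> \<le> T}"
proof -
  obtain m where m: "T < S m \<omega>" using nonexplosive assms by blast
  have "k < m" if "S k \<omega> \<le> T" for k
    using S_mono_le[OF assms, of m k] m that by (meson leD le_less_trans not_le_imp_less order_less_le_trans)
  then show ?thesis by (intro finite_subset[OF _ finite_lessThan[of m]]) auto
qed

lemma finite_jumps_after: "\<omega> \<in> space M \<Longrightarrow> finite (jumps_after \<omega> t)"
  unfolding jumps_after_def by (rule finite_subset[OF _ finite_jumps]) auto

lemma jump_integral:
  fixes Z :: "'w \<Rightarrow> ennreal \<Rightarrow> 'e \<Rightarrow> real"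
  assumes Z: "predictable_fun (space M) T F Z" and \<omega>: "\<omega> \<in> space M"
  shows "(LINT p:{t<..T} \<times> UNIV|jump_measure T S X \<omega>. Z \<omega> (fst p) (snd p)) =
    (\<Sum>k\<in>jumps_after \<omega> t. Z \<omega> (S k \<omega>) (X k \<omega>))"
proof -
  let ?K = "{k. 1 \<le> k \<and> S k \<omega> \<le> T}"
  let ?h = "\<lambda>p. indicator ({t<..T} \<times> UNIV) p *\<^sub>R Z \<omega> (fst p) (snd p)"
  have fin: "finite ?K" by (rule finite_subset[OF _ finite_jumps[OF \<omega>]]) auto
  have "(\<lambda>p. indicator ({t<..T} \<times> UNIV) p *\<^sub>R Z \<omega> (min (fst p) T) (snd p)) \<in> borel_measurable (borel \<Otimes>\<^sub>M borel)"
    using predictable_fun_section[OF Z \<omega>]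
    by (intro borel_measurable_scaleR borel_measurable_indicator time_strip_sets)
       (auto simp: case_prod_beta')
  also have "(\<lambda>p. indicator ({t<..T} \<times> UNIV) p *\<^sub>R Z \<omega> (min (fst p) T) (snd p)) = ?h"
    by (auto simp: fun_eq_iff indicator_def min_absorb1)
  finally have h: "?h \<in> borel_measurable (borel \<Otimes>\<^sub>M borel)" .
  have "(LINT p:{t<..T} \<times> UNIV|jump_measure T S X \<omega>. Z \<omega> (fst p) (snd p)) =
      (\<integral>k. ?h (S k \<omega>, X k \<omega>) \<partial>count_space ?K)"
    unfolding set_lebesgue_integral_def jump_measure_def
    by (rule integral_distr[OF _ h]) (simp add: space_pair_measure)
  also have "\<dots> = (\<Sum>k\<in>?K. ?h (S k \<omega>, X k \<omega>))"
    by (rule lebesgue_integral_count_space_finite[OF fin])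
  also have "\<dots> = (\<Sum>k\<in>jumps_after \<omega> t. Z \<omega> (S k \<omega>) (X k \<omega>))"
  proof (rule sum.mono_neutral_cong_right[OF fin])
    have "0 < k" if "t < S k \<omega>" for k
      using that S_0[OF \<omega>] by (cases k) auto
    then show "jumps_after \<omega> t \<subseteq> ?K" by (force simp: jumps_after_def Suc_le_eq)
    show "\<forall>k\<in>?K - jumps_after \<omega> t. ?h (S k \<omega>, X k \<omega>) = 0"
      by (auto simp: jumps_after_def indicator_def)
    show "\<And>k. k \<in> jumps_after \<omega> t \<Longrightarrow> ?h (S k \<omega>, X k \<omega>) = Z \<omega> (S k \<omega>) (X k \<omega>)"
      by (simp add: jumps_after_def)
  qed
  finally show ?thesis .
qed

lemma jumps_after_step:
  assumes \<omega>: "\<omega> \<in> space M" and t: "S n \<omega> \<le> t" "t < S (Suc n) \<omega>" and n: "S (Suc n) \<omega> \<le> T"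
  shows "jumps_after \<omega> t = insert (Suc n) (jumps_after \<omega> (S (Suc n) \<omega>))"
proof -
  have "k = Suc n \<or> S (Suc n) \<omega> < S k \<omega>" if "t < S k \<omega>" for k
  proof -
    have "\<not> k \<le> n" using S_mono_le[OF \<omega>, of k n] t that by (meson leD order_trans)
    then show ?thesis using S_strict_mono[OF \<omega>, of "Suc n" k] n by (cases "k = Suc n") auto
  qed
  then show ?thesis using t n by (auto simp: jumps_after_def intro: less_trans)
qed

lemma jumps_after_last:
  assumes \<omega>: "\<omega> \<in> space M" and t: "S n \<omega> \<le> t" and n: "T < S (Suc n) \<omega>"
  shows "jumps_after \<omega> t = {}"
proof -
  have "\<not> (t < S k \<omega> \<and> S k \<omega> \<le> T)" for k
    using S_mono_le[OF \<omega>, of k n] S_mono_le[OF \<omega>, of "Suc n" k] t n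
    by (cases "k \<le> n") (auto simp: not_le not_less Suc_le_eq intro: order_trans less_le_trans)
  then show ?thesis by (simp add: jumps_after_def)
qed

lemma interval_before_last:
  assumes \<omega>: "\<omega> \<in> space M" and N: "T < S (Suc N) \<omega>" and n: "S n \<omega> \<le> T"
  shows "n \<le> N"
  using S_mono_le[OF \<omega>, of "Suc N" n] N n by (meson leD less_le_trans not_less_eq_eq)

lemma segment_integral:
  assumes \<omega>: "regular \<omega>" and Z: "representing Z" and n: "S n \<omega> \<le> a" "b \<le> S (Suc n) \<omega>" "b \<le> T"
  shows "(LINT p:{a<..b} \<times> UNIV|\<nu> \<omega>. bsde_driver Z \<omega> p) =
    (LINT p:{a<..b} \<times> UNIV|\<nu>h n (H n \<omega>). driver n (H n \<omega>) p)"
    "set_integrable (\<nu> \<omega>) ({a<..b} \<times> UNIV) (bsde_driver Z \<omega>) \<longleftrightarrow>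
     set_integrable (\<nu>h n (H n \<omega>)) ({a<..b} \<times> UNIV) (driver n (H n \<omega>))"
proof -
  have sp: "\<omega> \<in> space M" using \<omega> by (simp add: regular_def)
  have B: "{a<..b} \<subseteq> {S n \<omega><..min (S (Suc n) \<omega>) T}"
    using n by (auto intro: le_less_trans order_trans)
  have eq: "bsde_driver Z \<omega> p = driver n (H n \<omega>) p" if "p \<in> {a<..b} \<times> UNIV" for p
    using that n by (intro bsde_driver_eq_driver[OF Z sp]) (auto intro: le_less_trans order_trans)
  have J: "{a<..b} \<times> UNIV \<in> sets (\<nu> \<omega>)"
    unfolding \<nu>_sets[OF sp] by (rule time_strip_sets) simp
  have "(LINT p:{a<..b} \<times> UNIV|\<nu> \<omega>. bsde_driver Z \<omega> p) = (LINT p:{a<..b} \<times> UNIV|\<nu> \<omega>. driver n (H n \<omega>) p)"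
    using J eq by (intro set_lebesgue_integral_cong) auto
  then show "(LINT p:{a<..b} \<times> UNIV|\<nu> \<omega>. bsde_driver Z \<omega> p) =
    (LINT p:{a<..b} \<times> UNIV|\<nu>h n (H n \<omega>). driver n (H n \<omega>) p)"
    using \<nu>_set_integral_on_interval(2)[OF \<omega> _ B] by simp
  have "set_integrable (\<nu> \<omega>) ({a<..b} \<times> UNIV) (bsde_driver Z \<omega>) \<longleftrightarrow>
      set_integrable (\<nu> \<omega>) ({a<..b} \<times> UNIV) (driver n (H n \<omega>))"
    by (rule set_integrable_cong[OF refl refl eq])
  then show "set_integrable (\<nu> \<omega>) ({a<..b} \<times> UNIV) (bsde_driver Z \<omega>) \<longleftrightarrow>
     set_integrable (\<nu>h n (H n \<omega>)) ({a<..b} \<times> UNIV) (driver n (H n \<omega>))"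
    using \<nu>_set_integral_on_interval(1)[OF \<omega> _ B] by simp
qed

lemma tail_split:
  fixes g :: "ennreal \<times> 'e \<Rightarrow> real"
  assumes "sets N = sets (borel \<Otimes>\<^sub>M borel)" "set_integrable N ({0<..T} \<times> UNIV) g" "a \<le> b" "b \<le> T"
  shows "(LINT p:{a<..T} \<times> UNIV|N. g p) = (LINT p:{a<..b} \<times> UNIV|N. g p) + (LINT p:{b<..T} \<times> UNIV|N. g p)"
proof -
  have int: "set_integrable N (B \<times> UNIV) g" if "B \<in> sets borel" "B \<subseteq> {0<..T}" for B
    using that assms(1) by (intro set_integrable_subset[OF assms(2)]) (auto intro: time_strip_sets)
  have "{a<..T} \<times> (UNIV :: 'e set) = {a<..b} \<times> UNIV \<union> {b<..T} \<times> UNIV"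
    using assms(3,4) by auto
  moreover have "(LINT p:{a<..b} \<times> UNIV \<union> {b<..T} \<times> UNIV|N. g p) =
      (LINT p:{a<..b} \<times> UNIV|N. g p) + (LINT p:{b<..T} \<times> UNIV|N. g p)"
  proof (rule set_integral_Un)
    show "set_integrable N ({a<..b} \<times> UNIV) g" "set_integrable N ({b<..T} \<times> UNIV) g"
      using assms(4) by (auto intro!: int simp: zero_less_iff_neq_zero)
  qed auto
  ultimately show ?thesis by simp
qed

text \<open>Downward induction along the jumps. Over \<open>(t, S (n + 1)]\<close> the compensator integral is the
  increment of \<open>y n\<close> by the pathwise equation of index \<open>n\<close> taken at the two end points, and the jump
  at \<open>S (n + 1)\<close> is the term that the jump measure adds. On the last interval the terminal value
  \<open>u N\<close> of the pathwise equation is \<open>\<xi>\<close>.\<close>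

theorem bsde_at_of_pathwise:
  assumes \<omega>: "regular \<omega>" and Z: "predictable_fun (space M) T F Z" "representing Z"
    and pathwise: "\<And>n. pathwise n (H n \<omega>)"
  shows "bsde_at Z \<omega>"
proof -
  have sp: "\<omega> \<in> space M" using \<omega> by (simp add: regular_def)
  note D = history_in_hist_set[OF sp]
  obtain N where N: "S N \<omega> \<le> T" "T < S (Suc N) \<omega>" using ex_last_jump[OF sp order_refl] by blast
  have int_h: "set_integrable (\<nu>h n (H n \<omega>)) ({0<..T} \<times> UNIV) (driver n (H n \<omega>))"
    and eq_h: "\<And>t. t \<le> T \<Longrightarrow> y n (H n \<omega>) t = u n (H n \<omega>) + (LINT p:{t<..T} \<times> UNIV|\<nu>h n (H n \<omega>). driver n (H n \<omega>) p)"
    for n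
    using pathwise[of n] by (auto simp: pathwise_iff)
  have cover: "{0<..T} \<times> UNIV = (\<Union>n\<in>{..N}. {S n \<omega><..min (S (Suc n) \<omega>) T} \<times> (UNIV :: 'e set))"
  proof (intro equalityI subsetI)
    fix p :: "ennreal \<times> 'e" assume "p \<in> {0<..T} \<times> UNIV"
    then have p: "0 < fst p" "fst p \<le> T" by auto
    then obtain n where n: "S n \<omega> < fst p" "fst p \<le> S (Suc n) \<omega>" using ex_interval[OF sp] by blast
    then have "n \<le> N" using p by (intro interval_before_last[OF sp N(2)]) auto
    with n p show "p \<in> (\<Union>n\<in>{..N}. {S n \<omega><..min (S (Suc n) \<omega>) T} \<times> UNIV)" by (auto simp: mem_Times_iff)
  qed (auto simp: zero_less_iff_neq_zero)
  have int: "set_integrable (\<nu> \<omega>) ({0<..T} \<times> UNIV) (bsde_driver Z \<omega>)"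
    unfolding cover
  proof (rule set_integrable_UN)
    fix n assume "n \<in> {..N}"
    show "{S n \<omega><..min (S (Suc n) \<omega>) T} \<times> UNIV \<in> sets (\<nu> \<omega>)"
      unfolding \<nu>_sets[OF sp] by (rule time_strip_sets) simp
    have "set_integrable (\<nu>h n (H n \<omega>)) ({S n \<omega><..min (S (Suc n) \<omega>) T} \<times> UNIV) (driver n (H n \<omega>))"
      by (rule set_integrable_subset[OF int_h])
         (auto simp: sets_nu_hist[OF D] zero_less_iff_neq_zero intro!: time_strip_sets)
    then show "set_integrable (\<nu> \<omega>) ({S n \<omega><..min (S (Suc n) \<omega>) T} \<times> UNIV) (bsde_driver Z \<omega>)"
      by (subst segment_integral(2)[OF \<omega> Z(2)]) auto
  qed simp
  have eq: "\<forall>t. S n \<omega> \<le> t \<longrightarrow> t < S (Suc n) \<omega> \<longrightarrow> t \<le> T \<longrightarrow>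
      Y t \<omega> + (\<Sum>k\<in>jumps_after \<omega> t. Z \<omega> (S k \<omega>) (X k \<omega>)) =
      \<xi> \<omega> + (LINT p:{t<..T} \<times> UNIV|\<nu> \<omega>. bsde_driver Z \<omega> p)" if "n \<le> N" for n
    using that
  proof (induction rule: inc_induct)
    case base
    show ?case
    proof (intro allI impI)
      fix t assume t: "S N \<omega> \<le> t" "t \<le> T"
      have "\<xi> \<omega> = u N (H N \<omega>)"
        using \<xi>_repr sp N by (simp add: represents_xi_def)
      moreover have "Y t \<omega> = y N (H N \<omega>) t"
        using t N by (intro Y_eq_y[OF sp]) auto
      moreover have "(LINT p:{t<..T} \<times> UNIV|\<nu> \<omega>. bsde_driver Z \<omega> p) =
          (LINT p:{t<..T} \<times> UNIV|\<nu>h N (H N \<omega>). driver N (H N \<omega>) p)"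
        using t N by (intro segment_integral(1)[OF \<omega> Z(2)]) auto
      ultimately show "Y t \<omega> + (\<Sum>k\<in>jumps_after \<omega> t. Z \<omega> (S k \<omega>) (X k \<omega>)) =
          \<xi> \<omega> + (LINT p:{t<..T} \<times> UNIV|\<nu> \<omega>. bsde_driver Z \<omega> p)"
        using jumps_after_last[OF sp t(1) N(2)] eq_h[OF t(2), of N] by simp
    qed
  next
    case (step n)
    let ?t' = "S (Suc n) \<omega>"
    have t'T: "?t' \<le> T"
      using S_mono_le[OF sp, of "Suc n" N] N(1) step.hyps by auto
    show ?case
    proof (intro allI impI)
      fix t assume t: "S n \<omega> \<le> t" "t < ?t'" "t \<le> T"
      have IH: "Y ?t' \<omega> + (\<Sum>k\<in>jumps_after \<omega> ?t'. Z \<omega> (S k \<omega>) (X k \<omega>)) =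
          \<xi> \<omega> + (LINT p:{?t'<..T} \<times> UNIV|\<nu> \<omega>. bsde_driver Z \<omega> p)"
        using step.IH t'T S_strict[OF sp t'T] by simp
      have "(LINT p:{t<..T} \<times> UNIV|\<nu> \<omega>. bsde_driver Z \<omega> p) =
          (LINT p:{t<..?t'} \<times> UNIV|\<nu> \<omega>. bsde_driver Z \<omega> p) +
          (LINT p:{?t'<..T} \<times> UNIV|\<nu> \<omega>. bsde_driver Z \<omega> p)"
        using t t'T by (intro tail_split int \<nu>_sets sp) auto
      moreover have "(LINT p:{t<..?t'} \<times> UNIV|\<nu> \<omega>. bsde_driver Z \<omega> p) =
          (LINT p:{t<..?t'} \<times> UNIV|\<nu>h n (H n \<omega>). driver n (H n \<omega>) p)"
        using t t'T by (intro segment_integral(1)[OF \<omega> Z(2)]) auto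
      moreover have "(LINT p:{t<..T} \<times> UNIV|\<nu>h n (H n \<omega>). driver n (H n \<omega>) p) =
          (LINT p:{t<..?t'} \<times> UNIV|\<nu>h n (H n \<omega>). driver n (H n \<omega>) p) +
          (LINT p:{?t'<..T} \<times> UNIV|\<nu>h n (H n \<omega>). driver n (H n \<omega>) p)"
        using t t'T by (intro tail_split int_h sets_nu_hist D) auto
      moreover have "Y t \<omega> = y n (H n \<omega>) t"
        using t by (intro Y_eq_y[OF sp]) auto
      moreover have "(\<Sum>k\<in>jumps_after \<omega> t. Z \<omega> (S k \<omega>) (X k \<omega>)) =
          Z \<omega> ?t' (X (Suc n) \<omega>) + (\<Sum>k\<in>jumps_after \<omega> ?t'. Z \<omega> (S k \<omega>) (X k \<omega>))"
        unfolding jumps_after_step[OF sp t(1,2) t'T]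
        using finite_jumps_after[OF sp] by (subst sum.insert) (auto simp: jumps_after_def)
      ultimately show "Y t \<omega> + (\<Sum>k\<in>jumps_after \<omega> t. Z \<omega> (S k \<omega>) (X k \<omega>)) =
          \<xi> \<omega> + (LINT p:{t<..T} \<times> UNIV|\<nu> \<omega>. bsde_driver Z \<omega> p)"
        using IH representing_at_jump[OF Z(2) sp t'T] eq_h[OF t(3), of n] eq_h[OF t'T, of n] by simp
    qed
  qed
  show ?thesis
    unfolding bsde_at_def
  proof (intro conjI ballI int)
    fix t assume t: "t \<in> {0..T}"
    then obtain n where n: "S n \<omega> \<le> t" "t < S (Suc n) \<omega>" using ex_last_jump[OF sp] by auto
    then have "n \<le> N" using t by (intro interval_before_last[OF sp N(2)]) auto
    then show "Y t \<omega> + (LINT p:{t<..T} \<times> UNIV|jump_measure T S X \<omega>. Z \<omega> (fst p) (snd p)) =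
        \<xi> \<omega> + (LINT p:{t<..T} \<times> UNIV|\<nu> \<omega>. bsde_driver Z \<omega> p)"
      using eq n t by (simp add: jump_integral[OF Z(1) sp])
  qed
qed

end

section \<open>Null sets of the compensator\<close>

context disintegrated_point_process
begin

text \<open>Testing the compensator with the indicator of \<open>{h \<noteq> 0}\<close> gives a vanishing expectation. To conclude
  that the \<open>\<nu> \<omega>\<close>-measure of this set vanishes almost surely, it has to be measurable in \<open>\<omega>\<close>; this is
  read off from its expression through the kernels \<open>\<nu>h n\<close>.\<close>

lemma compensator_AE_zero:
  fixes h :: "'w \<Rightarrow> ennreal \<Rightarrow> 'e \<Rightarrow> ennreal"
  assumes h: "predictable_fun (space M) T F h"
    and zero: "AE \<omega> in M. \<forall>n. S (Suc n) \<omega> \<le> T \<longrightarrow> h \<omega> (S (Suc n) \<omega>) (X (Suc n) \<omega>) = 0"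
  shows "AE \<omega> in M. AE p in \<nu> \<omega>. fst p \<le> T \<longrightarrow> h \<omega> (fst p) (snd p) = 0"
proof -
  let ?B = "borel \<Otimes>\<^sub>M borel :: (ennreal \<times> 'e) measure"
  define C where "C \<omega> = {p. fst p \<le> T \<and> h \<omega> (min (fst p) T) (snd p) \<noteq> 0}" for \<omega>
  define h' :: "'w \<Rightarrow> ennreal \<Rightarrow> 'e \<Rightarrow> ennreal" where "h' \<omega> t x = (if h \<omega> t x = 0 then 0 else 1)" for \<omega> t x
  have [measurable]: "(\<lambda>q. h (fst q) (min (fst (snd q)) T) (snd (snd q))) \<in> borel_measurable (M \<Otimes>\<^sub>M ?B)"
    using predictable_fun_jointly_measurable[OF h] by (simp add: case_prod_beta')
  have C_sets: "C \<omega> \<in> sets ?B" if "\<omega> \<in> space M" for \<omega>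
  proof -
    have [measurable]: "(\<lambda>p. h \<omega> (min (fst p) T) (snd p)) \<in> borel_measurable ?B"
      using predictable_fun_section[OF h that] by (simp add: case_prod_beta')
    have "{p \<in> space ?B. fst p \<le> T \<and> h \<omega> (min (fst p) T) (snd p) \<noteq> 0} \<in> sets ?B" by measurable
    then show ?thesis by (simp add: C_def space_pair_measure)
  qed
  have "(\<lambda>q. h (fst (fst q)) (snd (fst q)) (snd q)) \<in> borel_measurable (\<P> \<Otimes>\<^sub>M borel)"
    using h by (simp add: predictable_fun_def case_prod_beta')
  then have h': "predictable_fun (space M) T F h'"
    unfolding predictable_fun_def h'_def case_prod_beta' by measurable
  have ind: "h' \<omega> (fst p) (snd p) * indicator ({0..T} \<times> UNIV) p = indicator (C \<omega>) p" for \<omega> p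
    by (auto simp: h'_def C_def indicator_def min_absorb1 mem_Times_iff)
  have expectation: "(\<integral>\<^sup>+\<omega>. (\<integral>\<^sup>+p. indicator (C \<omega>) p \<partial>jump_measure T S X \<omega>) \<partial>M) =
      (\<integral>\<^sup>+\<omega>. (\<integral>\<^sup>+p. indicator (C \<omega>) p \<partial>\<nu> \<omega>) \<partial>M)"
    using \<nu>_compensator[unfolded same_predictable_expectation_def, rule_format, OF h'] unfolding ind .
  have "AE \<omega> in M. (\<integral>\<^sup>+p. indicator (C \<omega>) p \<partial>jump_measure T S X \<omega>) = 0"
    using zero AE_space
  proof eventually_elim
    case (elim \<omega>)
    let ?K = "{n. 1 \<le> n \<and> S n \<omega> \<le> T}"
    have "(\<integral>\<^sup>+p. indicator (C \<omega>) p \<partial>jump_measure T S X \<omega>) =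
        (\<integral>\<^sup>+n. indicator (C \<omega>) (S n \<omega>, X n \<omega>) \<partial>count_space ?K)"
      unfolding jump_measure_def using C_sets[OF elim(2)]
      by (intro nn_integral_distr) (auto simp: space_pair_measure)
    also have "\<dots> = (\<integral>\<^sup>+n. 0 \<partial>count_space ?K)"
    proof (intro nn_integral_cong)
      fix n assume n: "n \<in> space (count_space ?K)"
      then obtain m where "n = Suc m" by (cases n) auto
      with n elim(1) show "indicator (C \<omega>) (S n \<omega>, X n \<omega>) = (0 :: ennreal)"
        by (auto simp: C_def min_absorb1)
    qed
    finally show ?case by simp
  qed
  then have "(\<integral>\<^sup>+\<omega>. (\<integral>\<^sup>+p. indicator (C \<omega>) p \<partial>jump_measure T S X \<omega>) \<partial>M) = (\<integral>\<^sup>+\<omega>. 0 \<partial>M)"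
    by (rule nn_integral_cong_AE)
  then have 0: "(\<integral>\<^sup>+\<omega>. (\<integral>\<^sup>+p. indicator (C \<omega>) p \<partial>\<nu> \<omega>) \<partial>M) = 0"
    using expectation by simp
  \<comment> \<open>the contribution of \<open>(S n, S (n + 1)]\<close>, a measurable function of \<open>\<omega>\<close>\<close>
  define e where "e n \<omega> = (\<integral>\<^sup>+p. (if p \<in> C \<omega> \<and> S n \<omega> < fst p \<and> fst p \<le> S (Suc n) \<omega> then 1 else 0) \<partial>\<nu>h n (H n \<omega>))" for n \<omega>
  have e_meas: "e n \<in> borel_measurable M" for n
    unfolding e_def[abs_def]
  proof (rule nn_integral_nu_hist_measurable[OF history_measurable])
    have [measurable]: "(\<lambda>q. S n (fst q)) \<in> borel_measurable (M \<Otimes>\<^sub>M ?B)" for n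
      by (rule measurable_compose[OF measurable_fst S_measurable])
    show "(\<lambda>q. if snd q \<in> C (fst q) \<and> S n (fst q) < fst (snd q) \<and> fst (snd q) \<le> S (Suc n) (fst q) then 1 else 0 :: ennreal)
        \<in> borel_measurable (M \<Otimes>\<^sub>M ?B)"
      unfolding C_def mem_Collect_eq by measurable
  qed
  have \<nu>_e: "(\<integral>\<^sup>+p. indicator (C \<omega>) p \<partial>\<nu> \<omega>) = (\<Sum>n. e n \<omega>)" if \<omega>: "regular \<omega>" for \<omega>
  proof -
    have sp: "\<omega> \<in> space M" using \<omega> by (simp add: regular_def)
    have "(\<integral>\<^sup>+p. indicator (C \<omega>) p \<partial>\<nu> \<omega>) = emeasure (\<nu> \<omega>) (C \<omega>)"
      using C_sets[OF sp] \<nu>_sets[OF sp] by (intro nn_integral_indicator) simp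
    also have "\<dots> = (\<Sum>n. emeasure (\<nu>h n (H n \<omega>)) (C \<omega> \<inter> {S n \<omega><..min (S (Suc n) \<omega>) T} \<times> UNIV))"
      using \<omega> C_sets[OF sp] by (simp add: regular_def)
    also have "\<dots> = (\<Sum>n. e n \<omega>)"
    proof (rule arg_cong[where f = suminf], rule ext)
      fix n
      have "C \<omega> \<inter> {S n \<omega><..min (S (Suc n) \<omega>) T} \<times> UNIV \<in> sets (\<nu>h n (H n \<omega>))"
        unfolding sets_nu_hist[OF history_in_hist_set[OF sp]]
        by (intro sets.Int C_sets[OF sp] time_strip_sets) simp
      then have "emeasure (\<nu>h n (H n \<omega>)) (C \<omega> \<inter> {S n \<omega><..min (S (Suc n) \<omega>) T} \<times> UNIV) =
          (\<integral>\<^sup>+p. indicator (C \<omega> \<inter> {S n \<omega><..min (S (Suc n) \<omega>) T} \<times> UNIV) p \<partial>\<nu>h n (H n \<omega>))"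
        by (rule nn_integral_indicator[symmetric])
      also have "\<dots> = e n \<omega>"
        unfolding e_def by (intro nn_integral_cong) (auto simp: C_def indicator_def)
      finally show "emeasure (\<nu>h n (H n \<omega>)) (C \<omega> \<inter> {S n \<omega><..min (S (Suc n) \<omega>) T} \<times> UNIV) = e n \<omega>" .
    qed
    finally show ?thesis .
  qed
  have "(\<integral>\<^sup>+\<omega>. (\<Sum>n. e n \<omega>) \<partial>M) = 0"
    unfolding 0[symmetric] using AE_regular by (intro nn_integral_cong_AE) (auto simp: \<nu>_e)
  then have "AE \<omega> in M. (\<Sum>n. e n \<omega>) = 0"
    using e_meas by (subst (asm) nn_integral_0_iff_AE) auto
  with AE_regular show ?thesis
  proof eventually_elim
    case (elim \<omega>)
    have sp: "\<omega> \<in> space M" using elim by (simp add: regular_def)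
    have "emeasure (\<nu> \<omega>) (C \<omega>) = 0"
      using elim \<nu>_e[OF elim(1)] C_sets[OF sp] \<nu>_sets[OF sp] by simp
    then have "C \<omega> \<in> null_sets (\<nu> \<omega>)"
      using C_sets[OF sp] \<nu>_sets[OF sp] by auto
    from AE_not_in[OF this] show ?case
      by eventually_elim (auto simp: C_def min_absorb1)
  qed
qed

lemma \<phi>_space:
  assumes "\<omega> \<in> space M" "t \<le> T"
  shows "sets (\<phi> (\<omega>, t)) = sets borel" "space (\<phi> (\<omega>, t)) = UNIV"
proof -
  have "\<phi> (\<omega>, t) \<in> space (prob_algebra borel)"
    using measurable_space[OF \<phi>_kernel, of "(\<omega>, t)"] assms by (simp add: space_predictable)
  then show s: "sets (\<phi> (\<omega>, t)) = sets borel"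
    by (simp add: space_prob_algebra)
  show "space (\<phi> (\<omega>, t)) = UNIV"
    using sets_eq_imp_space_eq[OF s] by simp
qed

text \<open>The Lipschitz condition in \<open>\<zeta>\<close> compares integrals over the marks at one time \<open>t\<close>. Through the
  disintegration \<open>dA \<phi>\<close>, what it says about \<open>\<phi>\<close>-null sets at each time passes to \<open>\<nu>\<close>-null sets.\<close>

lemma \<nu>_null_transfer:
  assumes \<omega>: "\<omega> \<in> space M"
    and C: "C \<in> sets (borel \<Otimes>\<^sub>M borel)" and C': "C' \<in> sets (borel \<Otimes>\<^sub>M borel)"
    and null: "emeasure (\<nu> \<omega>) C = 0"
    and slices: "\<And>t. t \<le> T \<Longrightarrow> emeasure (\<phi> (\<omega>, t)) {x. (t, x) \<in> C} = 0 \<Longrightarrow> emeasure (\<phi> (\<omega>, t)) {x. (t, x) \<in> C'} = 0"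
  shows "emeasure (\<nu> \<omega>) C' = 0"
proof -
  let ?A = "stieltjes_measure T (\<lambda>t. A t \<omega>)"
  have sets_A: "sets ?A = sets borel" by (simp add: stieltjes_measure_def)
  have "(\<lambda>t. (\<omega>, min t T)) \<in> borel \<rightarrow>\<^sub>M M \<Otimes>\<^sub>M time_space T"
    using \<omega> by (intro measurable_Pair) auto
  from measurable_compose[OF measurable_compose[OF this pair_predictable] measurable_prob_algebraD[OF \<phi>_kernel]]
  have ker: "(\<lambda>t. \<phi> (\<omega>, min t T)) \<in> borel \<rightarrow>\<^sub>M subprob_algebra borel" .
  have "(SIGMA t:space borel. {x. (t, x) \<in> C}) = C" by auto
  then have "(\<lambda>t. emeasure (\<phi> (\<omega>, min t T)) {x. (t, x) \<in> C}) \<in> borel_measurable borel"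
    using C by (intro emeasure_measurable_subprob_algebra2[OF _ ker]) simp
  then have "(\<lambda>t. emeasure (\<phi> (\<omega>, min t T)) {x. (t, x) \<in> C} * indicator {0..T} t) \<in> borel_measurable ?A"
    unfolding measurable_cong_sets[OF sets_A refl] by measurable
  also have "(\<lambda>t. emeasure (\<phi> (\<omega>, min t T)) {x. (t, x) \<in> C} * indicator {0..T} t) =
      (\<lambda>t. emeasure (\<phi> (\<omega>, t)) {x. (t, x) \<in> C} * indicator {0..T} t)"
    by (auto simp: fun_eq_iff indicator_def min_absorb1)
  finally have meas: "(\<lambda>t. emeasure (\<phi> (\<omega>, t)) {x. (t, x) \<in> C} * indicator {0..T} t) \<in> borel_measurable ?A" .
  have "AE t in ?A. emeasure (\<phi> (\<omega>, t)) {x. (t, x) \<in> C} * indicator {0..T} t = 0"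
    using null \<nu>_disintegration[OF \<omega> C] nn_integral_0_iff_AE[OF meas] by simp
  then have "AE t in ?A. emeasure (\<phi> (\<omega>, t)) {x. (t, x) \<in> C'} * indicator {0..T} t = 0"
    by eventually_elim (auto simp: indicator_def slices split: if_splits)
  then have "(\<integral>\<^sup>+t. emeasure (\<phi> (\<omega>, t)) {x. (t, x) \<in> C'} * indicator {0..T} t \<partial>?A) = (\<integral>\<^sup>+t. 0 \<partial>?A)"
    by (rule nn_integral_cong_AE)
  then show ?thesis
    using \<nu>_disintegration[OF \<omega> C'] by simp
qed

end

section \<open>The integrand of a solution is the associated one\<close>

context represented_process
begin

text \<open>The BSDE just before \<open>S (n + 1)\<close>, in the limit, and the BSDE at \<open>S (n + 1)\<close> have the same right-hand
  side. Their left-hand sides differ in that the first contains the left limit of \<open>Y\<close> and the term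
  of \<open>Z\<close> at the jump, the second the value of \<open>Y\<close>.\<close>

lemma jump_of_bsde:
  assumes \<omega>: "regular \<omega>" and Z: "predictable_fun (space M) T F Z" "bsde_at Z \<omega>"
    and Z': "representing Z'" and n: "S (Suc n) \<omega> \<le> T"
  shows "Z \<omega> (S (Suc n) \<omega>) (X (Suc n) \<omega>) = Z' \<omega> (S (Suc n) \<omega>) (X (Suc n) \<omega>)"
proof -
  have sp: "\<omega> \<in> space M" using \<omega> by (simp add: regular_def)
  let ?t = "S (Suc n) \<omega>"
  let ?J = "\<lambda>t. (LINT p:{t<..T} \<times> UNIV|\<nu> \<omega>. bsde_driver Z \<omega> p)"
  let ?\<Sigma> = "\<Sum>k\<in>jumps_after \<omega> ?t. Z \<omega> (S k \<omega>) (X k \<omega>)"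
  have lt: "S n \<omega> < ?t"
    using n S_mono[OF sp, of n] by (intro S_strict[OF sp]) (rule order_trans)
  have pos: "0 < ?t" using S_range[OF sp, of n] by (auto simp: zero_less_iff_neq_zero)
  have int: "set_integrable (\<nu> \<omega>) ({0<..T} \<times> UNIV) (bsde_driver Z \<omega>)"
    and eq: "\<And>t. t \<le> T \<Longrightarrow> Y t \<omega> + (\<Sum>k\<in>jumps_after \<omega> t. Z \<omega> (S k \<omega>) (X k \<omega>)) = \<xi> \<omega> + ?J t"
    using Z(2) by (auto simp: bsde_at_def jump_integral[OF Z(1) sp])
  have before: "y n (H n \<omega>) r + (Z \<omega> ?t (X (Suc n) \<omega>) + ?\<Sigma>) = \<xi> \<omega> + ?J r" if r: "S n \<omega> < r" "r < ?t" for r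
  proof -
    have "(\<Sum>k\<in>jumps_after \<omega> r. Z \<omega> (S k \<omega>) (X k \<omega>)) = Z \<omega> ?t (X (Suc n) \<omega>) + ?\<Sigma>"
      unfolding jumps_after_step[OF sp less_imp_le[OF r(1)] r(2) n]
      using finite_jumps_after[OF sp] by (subst sum.insert) (auto simp: jumps_after_def)
    moreover have "Y r \<omega> = y n (H n \<omega>) r"
      using r n by (intro Y_eq_y[OF sp]) auto
    ultimately show ?thesis using eq[of r] r n by simp
  qed
  have "((\<lambda>r. \<xi> \<omega> + ?J r) \<longlongrightarrow> \<xi> \<omega> + ?J ?t) (at_left ?t)"
    using \<nu>_no_atom[OF \<omega> pos n] pos n
    by (intro tendsto_intros tail_integral_left_limit[OF \<nu>_sets[OF sp] int])
  moreover have "eventually (\<lambda>r. \<xi> \<omega> + ?J r = y n (H n \<omega>) r + (Z \<omega> ?t (X (Suc n) \<omega>) + ?\<Sigma>)) (at_left ?t)"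
    unfolding eventually_at_left[OF lt] using lt before by (intro exI[of _ "S n \<omega>"]) simp
  ultimately have "((\<lambda>r. y n (H n \<omega>) r + (Z \<omega> ?t (X (Suc n) \<omega>) + ?\<Sigma>)) \<longlongrightarrow> \<xi> \<omega> + ?J ?t) (at_left ?t)"
    by (rule Lim_transform_eventually)
  moreover have "((\<lambda>r. y n (H n \<omega>) r + (Z \<omega> ?t (X (Suc n) \<omega>) + ?\<Sigma>)) \<longlongrightarrow>
      y n (H n \<omega>) ?t + (Z \<omega> ?t (X (Suc n) \<omega>) + ?\<Sigma>)) (at_left ?t)"
    using n by (intro tendsto_intros y_left_limit history_in_hist_set sp)
  ultimately have "y n (H n \<omega>) ?t + (Z \<omega> ?t (X (Suc n) \<omega>) + ?\<Sigma>) = \<xi> \<omega> + ?J ?t"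
    using tendsto_unique[OF at_left_nontrivial[OF lt]] by blast
  then show ?thesis
    using eq[OF n] representing_at_jump[OF Z' sp n] by simp
qed

lemma AE_eq_representing:
  assumes Z: "predictable_fun (space M) T F Z" "bsde_equation M T S X \<nu> \<xi> f Y Z"
    and Z': "predictable_fun (space M) T F Z'" "representing Z'"
  shows "AE \<omega> in M. AE p in \<nu> \<omega>. fst p \<le> T \<longrightarrow> Z \<omega> (fst p) (snd p) = Z' \<omega> (fst p) (snd p)"
proof -
  let ?h = "\<lambda>\<omega> t x. if Z \<omega> t x = Z' \<omega> t x then 0 else 1 :: ennreal"
  have [measurable]: "(\<lambda>q. Z (fst (fst q)) (snd (fst q)) (snd q)) \<in> borel_measurable (\<P> \<Otimes>\<^sub>M borel)"
    "(\<lambda>q. Z' (fst (fst q)) (snd (fst q)) (snd q)) \<in> borel_measurable (\<P> \<Otimes>\<^sub>M borel)"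
    using Z(1) Z'(1) by (auto simp: predictable_fun_def case_prod_beta')
  have "predictable_fun (space M) T F ?h"
    unfolding predictable_fun_def case_prod_beta' by measurable
  moreover have "AE \<omega> in M. \<forall>n. S (Suc n) \<omega> \<le> T \<longrightarrow> ?h \<omega> (S (Suc n) \<omega>) (X (Suc n) \<omega>) = 0"
    using AE_regular Z(2)[unfolded bsde_equation_iff]
    by eventually_elim (auto dest: jump_of_bsde[OF _ Z(1) _ Z'(2)])
  ultimately have "AE \<omega> in M. AE p in \<nu> \<omega>. fst p \<le> T \<longrightarrow> ?h \<omega> (fst p) (snd p) = 0"
    by (rule compensator_AE_zero)
  then show ?thesis
    by eventually_elim (auto elim!: eventually_mono split: if_splits)
qed

text \<open>For a time at which \<open>Z\<close> and \<open>Z'\<close> agree \<open>\<phi>\<close>-almost everywhere, the right-hand side of the Lipschitz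
  condition vanishes, so the generators agree \<open>\<phi>\<close>-almost everywhere too.\<close>

lemma bsde_driver_AE_eq_driver:
  assumes \<omega>: "regular \<omega>"
    and Z: "predictable_fun (space M) T F Z" and Z': "predictable_fun (space M) T F Z'" "representing Z'"
    and int: "set_integrable (\<nu> \<omega>) ({0<..T} \<times> UNIV) (bsde_driver Z \<omega>)"
    and ae: "AE p in \<nu> \<omega>. fst p \<le> T \<longrightarrow> Z \<omega> (fst p) (snd p) = Z' \<omega> (fst p) (snd p)"
  shows "AE p in \<nu> \<omega>. S n \<omega> < fst p \<and> fst p \<le> min (S (Suc n) \<omega>) T \<longrightarrow>
    bsde_driver Z \<omega> p = driver n (H n \<omega>) p"
proof -
  let ?B = "borel \<Otimes>\<^sub>M borel :: (ennreal \<times> 'e) measure"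
  have sp: "\<omega> \<in> space M" using \<omega> by (simp add: regular_def)
  \<comment> \<open>the two integrands, cut off or clamped so as to be measurable on \<open>[0,\<infinity>] \<times> E\<close>\<close>
  define c where "c p = indicator ({0<..T} \<times> UNIV) p *\<^sub>R bsde_driver Z \<omega> p" for p
  define d where "d p = driver n (H n \<omega>) (min (fst p) T, snd p)" for p
  have [measurable]: "c \<in> borel_measurable ?B"
    using int \<nu>_sets[OF sp] by (auto simp: set_integrable_def c_def[abs_def] cong: measurable_cong_sets)
  have [measurable]: "d \<in> borel_measurable ?B"
    unfolding d_def[abs_def] by (rule driver_section_measurable[OF history_in_hist_set[OF sp]])
  have [measurable]: "(\<lambda>p. Z \<omega> (min (fst p) T) (snd p)) \<in> borel_measurable ?B"
    "(\<lambda>p. Z' \<omega> (min (fst p) T) (snd p)) \<in> borel_measurable ?B"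
    using predictable_fun_section[OF Z sp] predictable_fun_section[OF Z'(1) sp]
    by (simp_all add: case_prod_beta')
  define C where "C = {p. fst p \<le> T \<and> Z \<omega> (min (fst p) T) (snd p) \<noteq> Z' \<omega> (min (fst p) T) (snd p)}"
  define C' where "C' = {p. S n \<omega> < fst p \<and> fst p \<le> min (S (Suc n) \<omega>) T \<and> c p \<noteq> d p}"
  have "{p \<in> space ?B. fst p \<le> T \<and> Z \<omega> (min (fst p) T) (snd p) \<noteq> Z' \<omega> (min (fst p) T) (snd p)} \<in> sets ?B"
    by measurable
  then have C: "C \<in> sets ?B" by (simp add: C_def space_pair_measure)
  have "{p \<in> space ?B. S n \<omega> < fst p \<and> fst p \<le> min (S (Suc n) \<omega>) T \<and> c p \<noteq> d p} \<in> sets ?B"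
    by measurable
  then have C': "C' \<in> sets ?B" by (simp add: C'_def space_pair_measure)
  obtain L where L: "0 \<le> L" "\<And>\<omega> t y \<zeta> \<zeta>'. \<omega> \<in> space M \<Longrightarrow> t \<in> {0..T} \<Longrightarrow>
      \<zeta> \<in> borel_measurable borel \<Longrightarrow> \<zeta>' \<in> borel_measurable borel \<Longrightarrow>
      (\<integral>\<^sup>+x. ennreal \<bar>f \<omega> t x y \<zeta> - f \<omega> t x y \<zeta>'\<bar> \<partial>\<phi> (\<omega>, t)) \<le>
        ennreal L * (\<integral>\<^sup>+x. ennreal \<bar>\<zeta>' x - \<zeta> x\<bar> \<partial>\<phi> (\<omega>, t))"
    using f_lipschitz_z by blast
  have "emeasure (\<nu> \<omega>) C' = 0"
  proof (rule \<nu>_null_transfer[OF sp C C'])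
    have "C \<in> sets (\<nu> \<omega>)" using C \<nu>_sets[OF sp] by simp
    then show "emeasure (\<nu> \<omega>) C = 0"
      using ae by (intro AE_iff_measurable[THEN iffD1, of C])
        (auto simp: C_def min_absorb1 sets_eq_imp_space_eq[OF \<nu>_sets[OF sp]] space_pair_measure elim: eventually_mono)
    fix t assume t: "t \<le> T" and null: "emeasure (\<phi> (\<omega>, t)) {x. (t, x) \<in> C} = 0"
    note \<phi> = \<phi>_space[OF sp t]
    show "emeasure (\<phi> (\<omega>, t)) {x. (t, x) \<in> C'} = 0"
    proof (cases "S n \<omega> < t \<and> t \<le> S (Suc n) \<omega>")
      case False
      then have empty: "{x. (t, x) \<in> C'} = {}" by (auto simp: C'_def)
      show ?thesis unfolding empty by simp
    next
      case True
      let ?y = "Lim (at_left t) (\<lambda>r. Y r \<omega>)"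
      have slice: "{x. (t, x) \<in> C} \<in> sets (\<phi> (\<omega>, t))"
        using sets_Pair1[OF C, of t] \<phi>(1) by (simp add: vimage_def)
      then have "{x. (t, x) \<in> C} \<in> null_sets (\<phi> (\<omega>, t))" using null by auto
      from AE_not_in[OF this] have Z_eq: "AE x in \<phi> (\<omega>, t). ennreal \<bar>Z' \<omega> t x - Z \<omega> t x\<bar> = 0"
        using t by (auto simp: C_def min_absorb1 elim!: eventually_mono)
      have "(\<integral>\<^sup>+x. ennreal \<bar>Z' \<omega> t x - Z \<omega> t x\<bar> \<partial>\<phi> (\<omega>, t)) = (\<integral>\<^sup>+x. 0 \<partial>\<phi> (\<omega>, t))"
        using Z_eq by (rule nn_integral_cong_AE)
      moreover have "(\<integral>\<^sup>+x. ennreal \<bar>f \<omega> t x ?y (Z \<omega> t) - f \<omega> t x ?y (Z' \<omega> t)\<bar> \<partial>\<phi> (\<omega>, t)) \<le>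
          ennreal L * (\<integral>\<^sup>+x. ennreal \<bar>Z' \<omega> t x - Z \<omega> t x\<bar> \<partial>\<phi> (\<omega>, t))"
        using t by (intro L(2) sp predictable_fun_slice[OF Z sp t] predictable_fun_slice[OF Z'(1) sp t]) simp
      ultimately have le: "(\<integral>\<^sup>+x. ennreal \<bar>f \<omega> t x ?y (Z \<omega> t) - f \<omega> t x ?y (Z' \<omega> t)\<bar> \<partial>\<phi> (\<omega>, t)) \<le> 0"
        by simp
      have fc: "f \<omega> t x ?y (Z \<omega> t) = c (t, x)" for x
        using t True by (auto simp: c_def bsde_driver_def indicator_def zero_less_iff_neq_zero)
      have fd: "f \<omega> t x ?y (Z' \<omega> t) = d (t, x)" for x
        using bsde_driver_eq_driver[OF Z'(2) sp, of n "(t, x)"] t True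
        by (simp add: d_def bsde_driver_def min_absorb1)
      have "(\<lambda>x. ennreal \<bar>c (t, x) - d (t, x)\<bar>) \<in> borel_measurable (\<phi> (\<omega>, t))"
        unfolding measurable_cong_sets[OF \<phi>(1) refl] by measurable
      then have "AE x in \<phi> (\<omega>, t). ennreal \<bar>c (t, x) - d (t, x)\<bar> = 0"
        using le unfolding fc fd by (simp add: nn_integral_0_iff_AE)
      then have "AE x in \<phi> (\<omega>, t). (t, x) \<notin> C'"
        by eventually_elim (simp add: C'_def)
      then show ?thesis
        using AE_iff_measurable[of "{x. (t, x) \<in> C'}" "\<phi> (\<omega>, t)" "\<lambda>x. (t, x) \<notin> C'"] sets_Pair1[OF C', of t] \<phi>
        by (simp add: vimage_def)
    qed
  qed
  then have "C' \<in> null_sets (\<nu> \<omega>)" using C' \<nu>_sets[OF sp] by auto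
  from AE_not_in[OF this] show ?thesis
  proof eventually_elim
    case (elim p)
    show ?case
    proof
      assume p: "S n \<omega> < fst p \<and> fst p \<le> min (S (Suc n) \<omega>) T"
      then have "0 < fst p" by (auto simp: zero_less_iff_neq_zero)
      with p elim show "bsde_driver Z \<omega> p = driver n (H n \<omega>) p"
        by (auto simp: C'_def c_def d_def mem_Times_iff min_absorb1)
    qed
  qed
qed

end

section \<open>Conditioning on the absence of further jumps\<close>

context disintegrated_point_process
begin

lemma sigma_finite_pre_sigma: "sigma_finite_subalgebra M (pre_sigma (S n))"
  by (rule finite_measure_subalgebra_is_sigma_finite)
     (simp add: finite_measure_subalgebra_def finite_measure_axioms finite_measure_subalgebra_axioms_def
        subalgebra_pre_sigma)

lemma conditional_law_null:
  assumes E: "E \<in> sets (pre_sigma (S n))" and C: "C \<in> sets (borel \<Otimes>\<^sub>M borel)"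
    and zero: "AE \<omega> in M. \<omega> \<in> E \<longrightarrow> (S (Suc n) \<omega>, X (Suc n) \<omega>) \<notin> C"
  shows "AE \<omega> in M. \<omega> \<in> E \<longrightarrow> emeasure (G n (H n \<omega>)) C = 0"
proof -
  interpret sub: sigma_finite_subalgebra M "pre_sigma (S n)" by (rule sigma_finite_pre_sigma)
  let ?A = "{\<omega> \<in> space M. (S (Suc n) \<omega>, X (Suc n) \<omega>) \<in> C}"
  let ?c = "real_cond_exp M (pre_sigma (S n)) (indicator ?A)"
  have E_M: "E \<in> sets M" using E subalgebra_pre_sigma by (auto simp: subalgebra_def)
  have "(\<lambda>\<omega>. (S (Suc n) \<omega>, X (Suc n) \<omega>)) \<in> M \<rightarrow>\<^sub>M borel \<Otimes>\<^sub>M borel"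
    using S_measurable X_measurable by (intro measurable_Pair)
  from measurable_sets[OF this C] have "?A \<in> sets M"
    by (simp add: vimage_def Int_def conj_commute)
  then have int: "integrable M (indicator ?A :: 'w \<Rightarrow> real)"
    by (simp add: emeasure_eq_measure)
  have "(\<integral>\<omega>\<in>E. ?c \<omega> \<partial>M) = (\<integral>\<omega>\<in>E. indicator ?A \<omega> \<partial>M)"
    using sub.real_cond_exp_intA[OF int E] by simp
  also have "\<dots> = (\<integral>\<omega>. 0 \<partial>M)"
    unfolding set_lebesgue_integral_def using zero E_M \<open>?A \<in> sets M\<close>
    by (intro integral_cong_AE) (auto simp: indicator_def elim!: eventually_mono)
  finally have "(\<integral>\<omega>. indicator E \<omega> * ?c \<omega> \<partial>M) = 0"
    by (simp add: set_lebesgue_integral_def)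
  moreover have "integrable M (\<lambda>\<omega>. indicator E \<omega> * ?c \<omega>)"
    using integrable_mult_indicator[OF E_M sub.real_cond_exp_int(1)[OF int]] by simp
  moreover have nonneg: "AE \<omega> in M. 0 \<le> indicator E \<omega> * ?c \<omega>"
    using G_conditional_law[OF C, of n] by eventually_elim (simp add: indicator_def)
  ultimately have "AE \<omega> in M. indicator E \<omega> * ?c \<omega> = 0"
    using integral_nonneg_eq_0_iff_AE by blast
  with G_conditional_law[OF C, of n] AE_space show ?thesis
  proof eventually_elim
    case (elim \<omega>)
    interpret N: prob_space "G n (H n \<omega>)"
      by (rule G_prob_sets[OF history_in_hist_set[OF elim(2)]])
    show ?case
      using elim by (auto simp: N.emeasure_eq_measure indicator_def)
  qed
qed

text \<open>Suppose that \<open>B\<close> fails with positive probability on \<open>{S n \<le> T}\<close>. This event belongs to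
  \<open>\<F>\<^bsub>S n\<^esub>\<close>, and given \<open>\<F>\<^bsub>S n\<^esub>\<close> the next jump comes after \<open>T\<close> with probability \<open>surv (G n D) T > 0\<close>.
  So \<open>B\<close> also fails with positive probability when no jump follows up to \<open>T\<close>.\<close>

lemma AE_history_if_AE_last:
  assumes B: "Measurable.pred (hist_space T \<Delta> n) B"
    and last: "AE \<omega> in M. S n \<omega> \<le> T \<and> T < S (Suc n) \<omega> \<longrightarrow> B (H n \<omega>)"
  shows "AE \<omega> in M. S n \<omega> \<le> T \<longrightarrow> B (H n \<omega>)"
proof -
  define E where "E = {\<omega> \<in> space M. S n \<omega> \<le> T \<and> \<not> B (H n \<omega>)}"
  note [measurable] = B history_pre_sigma[of n] measurable_stopping_time_pre_sigma[OF stopping_time_S, of n]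
  have "{\<omega> \<in> space (pre_sigma (S n)). S n \<omega> \<le> T \<and> \<not> B (H n \<omega>)} \<in> sets (pre_sigma (S n))"
    by measurable
  then have E: "E \<in> sets (pre_sigma (S n))"
    by (simp add: E_def space_pre_sigma)
  have "AE \<omega> in M. \<omega> \<in> E \<longrightarrow> emeasure (G n (H n \<omega>)) ({T<..} \<times> UNIV) = 0"
    using last by (intro conditional_law_null[OF E] time_strip_sets) (auto simp: E_def)
  with AE_space show ?thesis
  proof eventually_elim
    case (elim \<omega>)
    have "0 < surv (G n (H n \<omega>)) T"
      using surv_T_pos[OF history_in_hist_set[OF elim(1)]] .
    then show ?case using elim by (auto simp: E_def surv_def)
  qed
qed

end

section \<open>From the BSDE to the pathwise equations\<close>

context represented_process
begin

lemma AE_after_history: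
  assumes "D \<in> hist_set T \<Delta> n" "fst (D n) \<le> T"
  shows "AE p in \<nu>h n D. fst (D n) < fst p"
proof -
  have "{..fst (D n)} \<times> UNIV \<in> null_sets (\<nu>h n D)"
    using nu_hist_null_past[OF assms(1)] assms T_finite
    by (auto simp: sets_nu_hist time_strip_sets intro: le_less_trans)
  from AE_not_in[OF this] show ?thesis
    by eventually_elim (auto simp: mem_Times_iff not_le)
qed

lemma tail_driver_measurable:
  assumes D: "D \<in> hist_set T \<Delta> n" and N: "sets N = sets (borel \<Otimes>\<^sub>M borel)"
  shows "(\<lambda>p. indicator ({t<..T} \<times> UNIV) p *\<^sub>R driver n D p) \<in> borel_measurable N"
proof -
  have "(\<lambda>p. indicator ({t<..T} \<times> UNIV) p *\<^sub>R driver n D (min (fst p) T, snd p)) \<in> borel_measurable (borel \<Otimes>\<^sub>M borel)"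
    using driver_section_measurable[OF D]
    by (intro borel_measurable_scaleR borel_measurable_indicator time_strip_sets) simp_all
  also have "(\<lambda>p. indicator ({t<..T} \<times> UNIV) p *\<^sub>R driver n D (min (fst p) T, snd p)) =
      (\<lambda>p. indicator ({t<..T} \<times> UNIV) p *\<^sub>R driver n D p)"
    by (auto simp: fun_eq_iff indicator_def min_absorb1)
  finally show ?thesis
    unfolding measurable_cong_sets[OF N refl] .
qed

lemma driver_past_negligible:
  assumes D: "D \<in> hist_set T \<Delta> n" "fst (D n) \<le> T" and t: "t \<le> fst (D n)"
  shows "set_integrable (\<nu>h n D) ({t<..T} \<times> UNIV) (driver n D) \<longleftrightarrow>
      set_integrable (\<nu>h n D) ({fst (D n)<..T} \<times> UNIV) (driver n D)"
    and "(LINT p:{t<..T} \<times> UNIV|\<nu>h n D. driver n D p) = (LINT p:{fst (D n)<..T} \<times> UNIV|\<nu>h n D. driver n D p)"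
proof -
  let ?I = "\<lambda>t p. indicator ({t<..T} \<times> UNIV) p *\<^sub>R driver n D p"
  have meas: "?I t \<in> borel_measurable (\<nu>h n D)" for t
    by (rule tail_driver_measurable[OF D(1) sets_nu_hist[OF D(1)]])
  have ae: "AE p in \<nu>h n D. ?I t p = ?I (fst (D n)) p"
    using AE_after_history[OF D] by eventually_elim (use t in \<open>auto simp: indicator_def mem_Times_iff\<close>)
  show "set_integrable (\<nu>h n D) ({t<..T} \<times> UNIV) (driver n D) \<longleftrightarrow>
      set_integrable (\<nu>h n D) ({fst (D n)<..T} \<times> UNIV) (driver n D)"
    unfolding set_integrable_def by (rule integrable_cong_AE[OF meas meas ae])
  show "(LINT p:{t<..T} \<times> UNIV|\<nu>h n D. driver n D p) = (LINT p:{fst (D n)<..T} \<times> UNIV|\<nu>h n D. driver n D p)"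
    unfolding set_lebesgue_integral_def by (rule integral_cong_AE[OF meas meas ae])
qed

lemma pathwise_from_last_time:
  assumes D: "D \<in> hist_set T \<Delta> n" "fst (D n) \<le> T"
    and int: "set_integrable (\<nu>h n D) ({fst (D n)<..T} \<times> UNIV) (driver n D)"
    and eq: "\<And>t. fst (D n) \<le> t \<Longrightarrow> t \<le> T \<Longrightarrow> y n D t = u n D + (LINT p:{t<..T} \<times> UNIV|\<nu>h n D. driver n D p)"
  shows "pathwise n D"
  unfolding pathwise_iff
proof (intro conjI ballI)
  show "set_integrable (\<nu>h n D) ({0<..T} \<times> UNIV) (driver n D)"
    using driver_past_negligible(1)[OF D zero_le] int by simp
  fix t assume t: "t \<in> {0..T}"
  show "y n D t = u n D + (LINT p:{t<..T} \<times> UNIV|\<nu>h n D. driver n D p)"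
  proof (cases "fst (D n) \<le> t")
    case True then show ?thesis using eq t by simp
  next
    case False
    then have le: "t \<le> fst (D n)" by simp
    have "y n D t = y n D (fst (D n))"
      using y_constant[OF D(1), of t] y_constant[OF D(1), of "fst (D n)"] t le D(2) by simp
    then show ?thesis
      using eq[OF order_refl D(2)] driver_past_negligible(2)[OF D le] by simp
  qed
qed

text \<open>On \<open>{S n \<le> T < S (n + 1)}\<close> no jump occurs after \<open>S n\<close> and \<open>\<xi> = u n D\<close>: the BSDE on \<open>[S n, T]\<close> is
  the pathwise equation.\<close>

lemma pathwise_on_last_interval:
  assumes \<omega>: "regular \<omega>" and Z: "predictable_fun (space M) T F Z" "bsde_at Z \<omega>"
    and ae: "AE p in \<nu> \<omega>. S n \<omega> < fst p \<and> fst p \<le> min (S (Suc n) \<omega>) T \<longrightarrow>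
      bsde_driver Z \<omega> p = driver n (H n \<omega>) p"
    and n: "S n \<omega> \<le> T" "T < S (Suc n) \<omega>"
  shows "pathwise n (H n \<omega>)"
proof -
  have sp: "\<omega> \<in> space M" using \<omega> by (simp add: regular_def)
  note D = history_in_hist_set[OF sp, of n]
  have int: "set_integrable (\<nu> \<omega>) ({0<..T} \<times> UNIV) (bsde_driver Z \<omega>)"
    and eq: "\<And>t. t \<le> T \<Longrightarrow> Y t \<omega> + (\<Sum>k\<in>jumps_after \<omega> t. Z \<omega> (S k \<omega>) (X k \<omega>)) =
        \<xi> \<omega> + (LINT p:{t<..T} \<times> UNIV|\<nu> \<omega>. bsde_driver Z \<omega> p)"
    using Z(2) by (auto simp: bsde_at_def jump_integral[OF Z(1) sp])
  have B: "{t<..T} \<subseteq> {S n \<omega><..min (S (Suc n) \<omega>) T}" if "S n \<omega> \<le> t" for t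
    using that n(2) by auto
  have pos: "0 < s" if "S n \<omega> \<le> t" "t < s" for s t :: ennreal
    using that by (auto simp: zero_less_iff_neq_zero)
  have int_t: "set_integrable (\<nu> \<omega>) ({t<..T} \<times> UNIV) (bsde_driver Z \<omega>)" if "S n \<omega> \<le> t" for t
    using that by (intro set_integrable_subset[OF int])
      (auto simp: \<nu>_sets[OF sp] time_strip_sets intro: pos)
  have meas1: "(\<lambda>p. indicator ({t<..T} \<times> UNIV) p *\<^sub>R bsde_driver Z \<omega> p) \<in> borel_measurable (\<nu> \<omega>)"
    if "S n \<omega> \<le> t" for t
    using int_t[OF that] by (auto simp: set_integrable_def)
  have meas2: "(\<lambda>p. indicator ({t<..T} \<times> UNIV) p *\<^sub>R driver n (H n \<omega>) p) \<in> borel_measurable (\<nu> \<omega>)" for t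
    by (rule tail_driver_measurable[OF D \<nu>_sets[OF sp]])
  have ae_t: "AE p in \<nu> \<omega>. indicator ({t<..T} \<times> UNIV) p *\<^sub>R bsde_driver Z \<omega> p =
      indicator ({t<..T} \<times> UNIV) p *\<^sub>R driver n (H n \<omega>) p" if "S n \<omega> \<le> t" for t
    using ae by eventually_elim (use B[OF that] in \<open>auto simp: indicator_def mem_Times_iff subset_iff\<close>)
  show ?thesis
  proof (rule pathwise_from_last_time[OF D])
    show "fst (H n \<omega> n) \<le> T" using n by simp
    have "set_integrable (\<nu> \<omega>) ({S n \<omega><..T} \<times> UNIV) (driver n (H n \<omega>))"
      using int_t[of "S n \<omega>"] integrable_cong_AE[OF meas1[OF order_refl] meas2 ae_t[OF order_refl]]
      by (simp add: set_integrable_def)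
    then show "set_integrable (\<nu>h n (H n \<omega>)) ({fst (H n \<omega> n)<..T} \<times> UNIV) (driver n (H n \<omega>))"
      using \<nu>_set_integral_on_interval(1)[OF \<omega> _ B] by simp
    fix t assume t: "fst (H n \<omega> n) \<le> t" "t \<le> T"
    then have St: "S n \<omega> \<le> t" by simp
    have "Y t \<omega> = y n (H n \<omega>) t"
      using St t n by (intro Y_eq_y[OF sp]) auto
    moreover have "\<xi> \<omega> = u n (H n \<omega>)"
      using \<xi>_repr sp n by (simp add: represents_xi_def)
    moreover have "(LINT p:{t<..T} \<times> UNIV|\<nu> \<omega>. bsde_driver Z \<omega> p) = (LINT p:{t<..T} \<times> UNIV|\<nu> \<omega>. driver n (H n \<omega>) p)"
      unfolding set_lebesgue_integral_def by (rule integral_cong_AE[OF meas1[OF St] meas2 ae_t[OF St]])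
    moreover have "(LINT p:{t<..T} \<times> UNIV|\<nu> \<omega>. driver n (H n \<omega>) p) = (LINT p:{t<..T} \<times> UNIV|\<nu>h n (H n \<omega>). driver n (H n \<omega>) p)"
      using \<nu>_set_integral_on_interval(2)[OF \<omega> _ B[OF St]] by simp
    ultimately show "y n (H n \<omega>) t = u n (H n \<omega>) + (LINT p:{t<..T} \<times> UNIV|\<nu>h n (H n \<omega>). driver n (H n \<omega>) p)"
      using eq[OF t(2)] jumps_after_last[OF sp St n(2)] by simp
  qed
qed

text \<open>Both sides of the pathwise equation are right-continuous in \<open>t\<close>, so countably many times
  suffice, which makes the validity of the equation a measurable property of the history.\<close>

lemma pathwise_countable:
  assumes D: "D \<in> hist_set T \<Delta> n"
    and Q: "\<And>a b :: ennreal. a < b \<Longrightarrow> \<exists>q\<in>Q. a < q \<and> q < b"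
  shows "pathwise n D \<longleftrightarrow> set_integrable (\<nu>h n D) ({0<..T} \<times> UNIV) (driver n D) \<and>
     (\<forall>t\<in>insert T (Q \<inter> {..T}). y n D t = u n D + (LINT p:{t<..T} \<times> UNIV|\<nu>h n D. driver n D p))"
    (is "_ \<longleftrightarrow> ?int \<and> (\<forall>t\<in>_. ?eq t)")
proof
  assume "pathwise n D" then show "?int \<and> (\<forall>t\<in>insert T (Q \<inter> {..T}). ?eq t)"
    by (auto simp: pathwise_iff)
next
  assume *: "?int \<and> (\<forall>t\<in>insert T (Q \<inter> {..T}). ?eq t)"
  then have int: ?int and eq: "\<And>t. t \<in> Q \<Longrightarrow> t \<le> T \<Longrightarrow> ?eq t" "?eq T" by auto
  let ?g = "\<lambda>r. y n D r - (u n D + (LINT p:{r<..T} \<times> UNIV|\<nu>h n D. driver n D p))"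
  have "?g t = 0" if t: "t < T" for t
  proof (rule ccontr)
    assume ne: "?g t \<noteq> 0"
    have "(y n D \<longlongrightarrow> y n D t) (at t within {0..T})"
      using y_continuous[OF D] t by (simp add: continuous_on)
    then have "(y n D \<longlongrightarrow> y n D t) (at t within {t<..T})"
      by (rule tendsto_within_subset) auto
    also have "at t within {t<..T} = at_right t"
      using t by (intro at_within_nhd[of t "{..<T}"]) auto
    finally have "(?g \<longlongrightarrow> ?g t) (at_right t)"
      by (intro tendsto_intros tail_integral_right_limit[OF sets_nu_hist[OF D] int t])
    from tendsto_imp_eventually_ne[OF this ne]
    obtain b where b: "t < b" "\<And>r. t < r \<Longrightarrow> r < b \<Longrightarrow> ?g r \<noteq> 0"
      unfolding eventually_at_right[OF t] by blast
    obtain q where "q \<in> Q" "t < q" "q < min b T" using Q[of t "min b T"] b t by auto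
    then show False using b(2)[of q] eq(1)[of q] by (simp add: less_imp_le)
  qed
  then have "?eq t" if "t \<le> T" for t
    using that eq(2) by (cases "t = T") (auto simp: less_le)
  then show "pathwise n D" using int by (simp add: pathwise_iff)
qed

lemma pathwise_measurable: "Measurable.pred (hist_space T \<Delta> n) (pathwise n)"
proof -
  obtain Q :: "ennreal set" where Q: "countable Q" "\<And>U. open U \<Longrightarrow> U \<noteq> {} \<Longrightarrow> \<exists>d\<in>Q. d \<in> U"
    using countable_dense_setE by auto
  have dense_Q: "\<exists>q\<in>Q. a < q \<and> q < b" if "a < b" for a b :: ennreal
    using Q(2)[of "{a<..<b}"] dense[OF that] by auto
  have h: "(\<lambda>q. indicator ({t<..T} \<times> UNIV) (snd q) *\<^sub>R driver n (fst q) (snd q)) \<in>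
      borel_measurable (hist_space T \<Delta> n \<Otimes>\<^sub>M (borel \<Otimes>\<^sub>M borel))" for t
  proof -
    have "(\<lambda>q. indicator ({t<..T} \<times> UNIV) (snd q) *\<^sub>R driver n (fst q) (min (fst (snd q)) T, snd (snd q))) \<in>
        borel_measurable (hist_space T \<Delta> n \<Otimes>\<^sub>M (borel \<Otimes>\<^sub>M borel))"
      using driver_measurable
      by (intro borel_measurable_scaleR measurable_compose[OF measurable_snd borel_measurable_indicator] time_strip_sets) auto
    also have "(\<lambda>q. indicator ({t<..T} \<times> UNIV) (snd q) *\<^sub>R driver n (fst q) (min (fst (snd q)) T, snd (snd q))) =
        (\<lambda>q. indicator ({t<..T} \<times> UNIV) (snd q) *\<^sub>R driver n (fst q) (snd q))"
      by (auto simp: fun_eq_iff indicator_def min_absorb1)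
    finally show ?thesis .
  qed
  have id: "(\<lambda>D. D) \<in> hist_space T \<Delta> n \<rightarrow>\<^sub>M hist_space T \<Delta> n" by simp
  have [measurable]: "Measurable.pred (hist_space T \<Delta> n) (\<lambda>D. set_integrable (\<nu>h n D) ({0<..T} \<times> UNIV) (driver n D))"
    unfolding set_integrable_def by (rule integrable_nu_hist_measurable[OF id h])
  have [measurable]: "(\<lambda>D. LINT p:{t<..T} \<times> UNIV|\<nu>h n D. driver n D p) \<in> borel_measurable (hist_space T \<Delta> n)" for t
    unfolding set_lebesgue_integral_def by (rule integral_nu_hist_measurable[OF id h])
  have [measurable]: "u n \<in> borel_measurable (hist_space T \<Delta> n)"
    using \<xi>_repr by (simp add: represents_xi_def)
  have y: "(\<lambda>D. y n D t) \<in> borel_measurable (hist_space T \<Delta> n)" if "t \<le> T" for t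
    using measurable_Pair1[OF y_measurable, of t n] that by (simp add: space_restrict_space)
  have "Measurable.pred (hist_space T \<Delta> n) (\<lambda>D. set_integrable (\<nu>h n D) ({0<..T} \<times> UNIV) (driver n D) \<and>
     (\<forall>t\<in>insert T (Q \<inter> {..T}). y n D t = u n D + (LINT p:{t<..T} \<times> UNIV|\<nu>h n D. driver n D p)))"
  proof (intro pred_intros_logic measurable_pred_countable)
    show "countable (insert T (Q \<inter> {..T}))" using Q(1) by auto
    fix t assume "t \<in> insert T (Q \<inter> {..T})"
    then have [measurable]: "(\<lambda>D. y n D t) \<in> borel_measurable (hist_space T \<Delta> n)" by (intro y) auto
    show "Measurable.pred (hist_space T \<Delta> n) (\<lambda>D. y n D t = u n D + (LINT p:{t<..T} \<times> UNIV|\<nu>h n D. driver n D p))"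
      unfolding pred_def by (rule borel_measurable_eq) measurable
  qed measurable
  then show ?thesis
    by (rule measurable_cong[THEN iffD2, rotated]) (simp add: space_hist_space pathwise_countable[OF _ dense_Q])
qed

lemma driver_at_infinity:
  assumes "D \<in> hist_set T \<Delta> n" "fst (D n) = \<infinity>" "fst p \<le> T"
  shows "driver n D p = 0"
  unfolding driver_def using fr_infinity[OF hist_fun_yhat_y assms(1,2)] assms(3) by simp

lemma pathwise_at_infinity:
  assumes D: "D \<in> hist_set T \<Delta> n" "fst (D n) = \<infinity>"
  shows "pathwise n D"
proof -
  have ind: "indicator ({t<..T} \<times> UNIV) p *\<^sub>R driver n D p = 0" for t p
    using driver_at_infinity[OF D, of p] by (auto simp: indicator_def)
  have "u n D = 0" using \<xi>_repr D by (simp add: represents_xi_def)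
  then show ?thesis
    using y_at_infinity[OF D]
    unfolding pathwise_iff set_integrable_def set_lebesgue_integral_def ind by simp
qed

theorem AE_pathwise_of_bsde:
  assumes Z: "predictable_fun (space M) T F Z" "bsde_equation M T S X \<nu> \<xi> f Y Z"
  shows "AE \<omega> in M. \<forall>n. pathwise n (H n \<omega>)"
  unfolding AE_all_countable
proof
  fix n
  obtain Z' where Z': "predictable_fun (space M) T F Z'" "representing Z'"
    using ex_predictable_representing[OF hist_fun_associated_z[OF Y_repr]] by blast
  have "AE \<omega> in M. S n \<omega> \<le> T \<and> T < S (Suc n) \<omega> \<longrightarrow> pathwise n (H n \<omega>)"
    using AE_regular Z(2)[unfolded bsde_equation_iff] AE_eq_representing[OF Z Z']
  proof eventually_elim
    case (elim \<omega>)
    then have "set_integrable (\<nu> \<omega>) ({0<..T} \<times> UNIV) (bsde_driver Z \<omega>)" by (simp add: bsde_at_def)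
    from bsde_driver_AE_eq_driver[OF elim(1) Z(1) Z' this elim(3)] show ?case
      using pathwise_on_last_interval[OF elim(1) Z(1) elim(2)] by blast
  qed
  from AE_history_if_AE_last[OF pathwise_measurable this] AE_space
  show "AE \<omega> in M. pathwise n (H n \<omega>)"
  proof eventually_elim
    case (elim \<omega>)
    then show ?case
      using pathwise_at_infinity[OF history_in_hist_set[OF elim(2)]] S_le_T_iff[OF elim(2), of n]
      by (cases "S n \<omega> \<le> T") auto
  qed
qed

theorem bsde_of_AE_pathwise:
  assumes "predictable_fun (space M) T F Z" "representing Z"
    and "AE \<omega> in M. \<forall>n. pathwise n (H n \<omega>)"
  shows "bsde_equation M T S X \<nu> \<xi> f Y Z"
  unfolding bsde_equation_iff using AE_regular assms(3)
  by eventually_elim (rule bsde_at_of_pathwise[OF _ assms(1,2)], auto)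

section \<open>The equivalences\<close>

theorem ex_bsde_iff_pathwise:
  "(\<exists>Z. predictable_fun (space M) T F Z \<and> bsde_equation M T S X \<nu> \<xi> f Y Z) \<longleftrightarrow>
     (AE \<omega> in M. \<forall>n. pathwise n (H n \<omega>))"
proof
  assume "AE \<omega> in M. \<forall>n. pathwise n (H n \<omega>)"
  moreover obtain Z where "predictable_fun (space M) T F Z" "representing Z"
    using ex_predictable_representing[OF hist_fun_associated_z[OF Y_repr]] by blast
  ultimately show "\<exists>Z. predictable_fun (space M) T F Z \<and> bsde_equation M T S X \<nu> \<xi> f Y Z"
    using bsde_of_AE_pathwise by blast
qed (use AE_pathwise_of_bsde in blast)

text \<open>A solution differs from the processes of \<open>ex_bsde_iff_pathwise\<close> by the integrability of its \<open>Z\<close>,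
  which passes to the associated function because the two agree almost everywhere for \<open>\<nu>\<close>.\<close>

theorem solution_iff_pathwise:
  assumes Y: "adapted_cadlag (space M) T F Y"
  shows "bsde_solution M T S X F \<nu> \<xi> f Y \<longleftrightarrow>
    associated_Z_integrable M T \<Delta> S X F \<nu> y \<and> (AE \<omega> in M. \<forall>n. pathwise n (H n \<omega>))"
proof
  assume "bsde_solution M T S X F \<nu> \<xi> f Y"
  then obtain Z where Z: "predictable_fun (space M) T F Z" "nu_integrable M T \<nu> Z"
      "bsde_equation M T S X \<nu> \<xi> f Y Z"
    by (auto simp: bsde_solution_def)
  obtain Z' where Z': "predictable_fun (space M) T F Z'" "representing Z'"
    using ex_predictable_representing[OF hist_fun_associated_z[OF Y_repr]] by blast
  have "nu_integrable M T \<nu> Z'"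
    unfolding nu_integrable_def
    using Z(2)[unfolded nu_integrable_def] AE_eq_representing[OF Z(1,3) Z']
  proof eventually_elim
    case (elim \<omega>)
    have "(\<integral>\<^sup>+p\<in>{0..T} \<times> UNIV. ennreal \<bar>Z' \<omega> (fst p) (snd p)\<bar> \<partial>\<nu> \<omega>) =
        (\<integral>\<^sup>+p\<in>{0..T} \<times> UNIV. ennreal \<bar>Z \<omega> (fst p) (snd p)\<bar> \<partial>\<nu> \<omega>)"
      using elim(2) by (intro nn_integral_cong_AE) (auto simp: indicator_def elim!: eventually_mono)
    then show ?case using elim(1) by simp
  qed
  then have "associated_Z_integrable M T \<Delta> S X F \<nu> y"
    using Z' by (auto simp: associated_Z_integrable_def)
  then show "associated_Z_integrable M T \<Delta> S X F \<nu> y \<and> (AE \<omega> in M. \<forall>n. pathwise n (H n \<omega>))"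
    using AE_pathwise_of_bsde[OF Z(1,3)] by blast
next
  assume "associated_Z_integrable M T \<Delta> S X F \<nu> y \<and> (AE \<omega> in M. \<forall>n. pathwise n (H n \<omega>))"
  then show "bsde_solution M T S X F \<nu> \<xi> f Y"
    using Y bsde_of_AE_pathwise by (auto simp: bsde_solution_def associated_Z_integrable_def)
qed

text \<open>If almost surely no point follows the \<open>m\<close>-th one, then its conditional law \<open>G m D\<close> does not
  charge \<open>[0,T]\<close> along the histories, nor does \<open>\<nu>h m D\<close>; and histories of more than \<open>m\<close> points end at
  \<open>\<infinity>\<close>, where \<open>y\<close>, \<open>u\<close> and the generator are zero.\<close>

lemma AE_pathwise_iff_bounded_jumps:
  assumes m: "AE \<omega> in M. S (Suc m) \<omega> = \<infinity>"
  shows "(AE \<omega> in M. \<forall>n. pathwise n (H n \<omega>)) \<longleftrightarrow>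
    (AE \<omega> in M. (\<forall>n<m. pathwise n (H n \<omega>)) \<and> (\<forall>t\<in>{0..T}. y m (H m \<omega>) t = u m (H m \<omega>)))"
proof (rule eventually_subst)
  have "space M \<in> sets (pre_sigma (S m))"
    using sets.top[of "pre_sigma (S m)"] by (simp add: space_pre_sigma)
  then have "AE \<omega> in M. \<omega> \<in> space M \<longrightarrow> emeasure (G m (H m \<omega>)) ({..T} \<times> UNIV) = 0"
    using m T_finite by (intro conditional_law_null time_strip_sets) auto
  with m AE_space show "AE \<omega> in M. (\<forall>n. pathwise n (H n \<omega>)) \<longleftrightarrow>
      ((\<forall>n<m. pathwise n (H n \<omega>)) \<and> (\<forall>t\<in>{0..T}. y m (H m \<omega>) t = u m (H m \<omega>)))"
  proof eventually_elim
    case (elim \<omega>)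
    note D = history_in_hist_set[OF elim(2)]
    have "pathwise n (H n \<omega>)" if "m < n" for n
      using S_mono_le[OF elim(2), of "Suc m" n] that elim(1)
      by (intro pathwise_at_infinity[OF D]) (simp add: top_unique)
    moreover have "pathwise m (H m \<omega>) \<longleftrightarrow> (\<forall>t\<in>{0..T}. y m (H m \<omega>) t = u m (H m \<omega>))"
    proof -
      have "{..T} \<times> UNIV \<in> null_sets (\<nu>h m (H m \<omega>))"
        using elim nu_hist_null[OF D time_strip_sets] by (auto simp: sets_nu_hist[OF D] time_strip_sets)
      from AE_not_in[OF this]
      have 0: "AE p in \<nu>h m (H m \<omega>). indicator ({t<..T} \<times> UNIV) p *\<^sub>R driver m (H m \<omega>) p = 0" for t
        by eventually_elim (auto simp: indicator_def mem_Times_iff)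
      have meas: "(\<lambda>p. indicator ({t<..T} \<times> UNIV) p *\<^sub>R driver m (H m \<omega>) p) \<in> borel_measurable (\<nu>h m (H m \<omega>))" for t
        by (rule tail_driver_measurable[OF D sets_nu_hist[OF D]])
      have "set_integrable (\<nu>h m (H m \<omega>)) ({0<..T} \<times> UNIV) (driver m (H m \<omega>))"
        unfolding set_integrable_def
        using integrable_cong_AE[OF meas borel_measurable_const 0] by simp
      moreover have "(LINT p:{t<..T} \<times> UNIV|\<nu>h m (H m \<omega>). driver m (H m \<omega>) p) = 0" for t
        unfolding set_lebesgue_integral_def
        using integral_cong_AE[OF meas borel_measurable_const 0] by simp
      ultimately show ?thesis by (simp add: pathwise_iff)
    qed
    ultimately show ?case by (metis linorder_neqE_nat)
  qed
qed

lemma u_eq_xi_bounded_jumps: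
  assumes m: "AE \<omega> in M. S (Suc m) \<omega> = \<infinity>"
  shows "AE \<omega> in M. S m \<omega> \<le> T \<longrightarrow> u m (H m \<omega>) = \<xi> \<omega>"
  using m AE_space
proof eventually_elim
  case (elim \<omega>)
  then have "S m \<omega> \<le> T \<Longrightarrow> \<xi> \<omega> = u m (H m \<omega>)"
    using \<xi>_repr T_finite by (simp add: represents_xi_def)
  then show ?case by simp
qed

end

theorem lemma7:
  fixes M :: "'w measure" and T :: ennreal and \<Delta> :: "'e::topological_space"
    and S :: "nat \<Rightarrow> 'w \<Rightarrow> ennreal" and X :: "nat \<Rightarrow> 'w \<Rightarrow> 'e" and F :: "ennreal \<Rightarrow> 'w measure"
    and A :: "ennreal \<Rightarrow> 'w \<Rightarrow> real" and \<phi> :: "'w \<times> ennreal \<Rightarrow> 'e measure"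
    and \<nu> :: "'w \<Rightarrow> (ennreal \<times> 'e) measure"
    and G :: "nat \<Rightarrow> 'e hist \<Rightarrow> (ennreal \<times> 'e) measure"
    and \<xi> :: "'w \<Rightarrow> real" and u :: "nat \<Rightarrow> 'e hist \<Rightarrow> real"
    and f :: "'w \<Rightarrow> ennreal \<Rightarrow> 'e \<Rightarrow> real \<Rightarrow> ('e \<Rightarrow> real) \<Rightarrow> real"
    and fr :: "nat \<Rightarrow> ('e hist \<Rightarrow> ennreal \<Rightarrow> 'e \<Rightarrow> real) \<Rightarrow>
               'e hist \<Rightarrow> ennreal \<Rightarrow> 'e \<Rightarrow> real \<Rightarrow> real \<Rightarrow> real"
    and Y :: "ennreal \<Rightarrow> 'w \<Rightarrow> real" and y :: "nat \<Rightarrow> 'e hist \<Rightarrow> ennreal \<Rightarrow> real"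
  assumes setting: "bsde_setting M T \<Delta> S X F A \<phi> \<nu> G \<xi> u f fr"
    and A: "assumption_A M T S F A"
    and Y: "adapted_cadlag (space M) T F Y"
    and Y_repr: "represents_Y (space M) T \<Delta> S X Y y"
  shows "(bsde_solution M T S X F \<nu> \<xi> f Y \<longleftrightarrow>
           associated_Z_integrable M T \<Delta> S X F \<nu> y \<and>
           (AE \<omega> in M. \<forall>n. pathwise_equation T G u fr y n (history S X n \<omega>))) \<and>
         ((\<exists>Z. predictable_fun (space M) T F Z \<and> bsde_equation M T S X \<nu> \<xi> f Y Z) \<longleftrightarrow>
           (AE \<omega> in M. \<forall>n. pathwise_equation T G u fr y n (history S X n \<omega>))) \<and>
         (\<forall>m. measure M {\<omega> \<in> space M. S (Suc m) \<omega> = \<infinity>} = 1 \<longrightarrow>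
           (bsde_solution M T S X F \<nu> \<xi> f Y \<longleftrightarrow>
             associated_Z_integrable M T \<Delta> S X F \<nu> y \<and>
             (AE \<omega> in M. (\<forall>n<m. pathwise_equation T G u fr y n (history S X n \<omega>)) \<and>
                (\<forall>t\<in>{0..T}. y m (history S X m \<omega>) t = u m (history S X m \<omega>)))) \<and>
           ((\<exists>Z. predictable_fun (space M) T F Z \<and> bsde_equation M T S X \<nu> \<xi> f Y Z) \<longleftrightarrow>
             (AE \<omega> in M. (\<forall>n<m. pathwise_equation T G u fr y n (history S X n \<omega>)) \<and>
                (\<forall>t\<in>{0..T}. y m (history S X m \<omega>) t = u m (history S X m \<omega>)))) \<and>
           (AE \<omega> in M. S m \<omega> \<le> T \<longrightarrow> u m (history S X m \<omega>) = \<xi> \<omega>))"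
proof -
  interpret represented_process M T \<Delta> S X F A \<phi> \<nu> G \<xi> u f fr Y y
    using setting Y_repr by (simp add: represented_process_def represented_process_axioms_def)
  show ?thesis
  proof (intro conjI allI impI)
    show "bsde_solution M T S X F \<nu> \<xi> f Y \<longleftrightarrow>
        associated_Z_integrable M T \<Delta> S X F \<nu> y \<and> (AE \<omega> in M. \<forall>n. pathwise n (H n \<omega>))"
      by (rule solution_iff_pathwise[OF Y])
    show "(\<exists>Z. predictable_fun (space M) T F Z \<and> bsde_equation M T S X \<nu> \<xi> f Y Z) \<longleftrightarrow>
        (AE \<omega> in M. \<forall>n. pathwise n (H n \<omega>))"
      by (rule ex_bsde_iff_pathwise)
    fix m assume "measure M {\<omega> \<in> space M. S (Suc m) \<omega> = \<infinity>} = 1"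
    from AE_prob_1[OF this] have m: "AE \<omega> in M. S (Suc m) \<omega> = \<infinity>"
      by eventually_elim simp
    show "bsde_solution M T S X F \<nu> \<xi> f Y \<longleftrightarrow>
        associated_Z_integrable M T \<Delta> S X F \<nu> y \<and>
        (AE \<omega> in M. (\<forall>n<m. pathwise n (H n \<omega>)) \<and> (\<forall>t\<in>{0..T}. y m (H m \<omega>) t = u m (H m \<omega>)))"
      unfolding solution_iff_pathwise[OF Y] AE_pathwise_iff_bounded_jumps[OF m] ..
    show "(\<exists>Z. predictable_fun (space M) T F Z \<and> bsde_equation M T S X \<nu> \<xi> f Y Z) \<longleftrightarrow>
        (AE \<omega> in M. (\<forall>n<m. pathwise n (H n \<omega>)) \<and> (\<forall>t\<in>{0..T}. y m (H m \<omega>) t = u m (H m \<omega>)))"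
      unfolding ex_bsde_iff_pathwise AE_pathwise_iff_bounded_jumps[OF m] ..
    show "AE \<omega> in M. S m \<omega> \<le> T \<longrightarrow> u m (H m \<omega>) = \<xi> \<omega>"
      by (rule u_eq_xi_bounded_jumps[OF m])
  qed
qed

end
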